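(* For the following four classical series of symmetric pairs $X=(\mathfrak g,\mathfrak k)$ of even type, the radial parts $\mathfrak L_{rad}$ of the Laplace–Beltrami operators are conjugated to the deformed CMS operators of classical type. More precisely: (a) For $X=(\mathfrak{gl}(n,2m),\mathfrak{osp}(n,2m))$, $\mathfrak L_{rad}$ is conjugated to the deformed CMS operator of type $A(n-1,m-1)$ with $k=-\frac12$. For the three other series $\mathfrak L_{rad}$ is conjugated to the deformed CMS operator of type $BC(n,m)$ with the following parameters: (b) for $X=(\mathfrak{gl}(n_1+n_2,m_1+m_2),\mathfrak{gl}(n_1,m_1)\oplus\mathfrak{gl}(n_2,m_2))$ of even type: $n=\min(n_1,n_2)$, $m=\min(m_1,m_2)$, $k=-1$, $p=|m_1-m_2|-|n_1-n_2|=-r$, $q=s=-\frac12$; (c) for $X=(\mathfrak{osp}(n_1+n_2,2m_1+2m_2),\mathfrak{osp}(n_1,2m_1)\oplus\mathfrak{osp}(n_2,2m_2))$ of even type: $n=\min(n_1,n_2)$, $m=\min(m_1,m_2)$, $k=-\frac12$, $p=|m_1-m_2|-\frac12|n_1-n_2|=-\frac12r$, $q=0$, $s=-\frac32$; (d) for $X=(\mathfrak{osp}(2l,2m),\mathfrak{gl}(l,m))$: $k=-2$, $q=s=-\frac12$, with $p=r=0$ if $l=2n$, and $p=-2$, $r=1$ if $l=2n+1$.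
   Context: **Even type.** A symmetric pair $(\mathfrak g,\mathfrak k)$ comes from an involution of the Lie superalgebra $\mathfrak g$ with eigenspace decomposition $\mathfrak g=\mathfrak k\oplus\mathfrak p$; it is of even type if a Cartan subspace $\mathfrak a\subset\mathfrak p$ (a commutative subalgebra, reductive in $\mathfrak g$, equal to its centraliser in $\mathfrak p$) can be chosen to be even. For the series (b) and (c) the paper states the even type condition as $(n_1-m_1)(n_2-m_2)\ge0$. **Radial part.** On $\mathfrak a$ with coordinates $x_1,\dots,x_n,y_1,\dots,y_m$ the invariant quadratic form is $x_1^2+\dots+x_n^2+k^{-1}(y_1^2+\dots+y_m^2)$, so on $\mathfrak a^*$ the coordinates are orthogonal with $(x_i,x_i)=1$, $(y_j,y_j)=k$. The radial part of the Laplace–Beltrami operator (given by the quadratic Casimir element of $\mathfrak g$) is $\mathfrak L_{rad}=\Delta+\sum_{\alpha\in R_+(X)}\mu_\alpha\frac{e^{2\alpha}+1}{e^{2\alpha}-1}\partial_\alpha$, where $\Delta=\sum\partial_{x_i}^2+k\sum\partial_{y_j}^2$, $\partial_\alpha e^\lambda=(\alpha,\lambda)e^\lambda$, and the sum is over the positive restricted roots considered with multiplicities. The restricted roots are the nonzero weights of $\mathfrak a$ on $\mathfrak g$, and multiplicities $\mu$ are superdimensions of the weight spaces (negative for odd roots). Explicitly (with $i<j$ for pairs of the same type): (a) $k=-\frac12$: even $\pm(x_i-x_j)$, $\mu=1$; $\pm(y_i-y_j)$, $\mu=4$; odd $\pm(x_i-y_j)$, $\mu=-2$. (b) $k=-1$: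 even $\pm x_i$, $\mu=2|n_1-n_2|$; $\pm2x_i$, $\mu=1$; $\pm x_i\pm x_j$, $\mu=2$; $\pm y_i$, $\mu=2|m_1-m_2|$; $\pm2y_i$, $\mu=1$; $\pm y_i\pm y_j$, $\mu=2$; odd $\pm x_i\pm y_j$, $\mu=-2$; $\pm x_i$, $\mu=-2|m_1-m_2|$; $\pm y_j$, $\mu=-2|n_1-n_2|$. (c) $k=-\frac12$: even $\pm x_i$, $\mu=|n_1-n_2|$; $\pm x_i\pm x_j$, $\mu=1$; $\pm y_i$, $\mu=4|m_1-m_2|$; $\pm2y_i$, $\mu=3$; $\pm y_i\pm y_j$, $\mu=4$; odd $\pm x_i\pm y_j$, $\mu=-2$; $\pm x_i$, $\mu=-2|m_1-m_2|$; $\pm y_j$, $\mu=-2|n_1-n_2|$. (d) $k=-2$: even $\pm2x_i$, $\mu=1$; $\pm x_i\pm x_j$, $\mu=4$; $\pm2y_i$, $\mu=1$; $\pm y_i\pm y_j$, $\mu=1$; odd $\pm x_i\pm y_j$, $\mu=-2$; and if $l=2n+1$ additionally even $\pm x_i$, $\mu=4$, and odd $\pm y_j$, $\mu=-2$. **Deformed CMS operators.** With $\Delta_n=\sum_{i=1}^n\partial_{x_i}^2$, $\Delta_m=\sum_{j=1}^m\partial_{y_j}^2$: Type $A(n-1,m-1)$: $L=-\Delta_n-k\Delta_m+\sum_{i<j}^n\frac{2k(k+1)}{\sinh^2(x_i-x_j)}+\sum_{i<j}^m\frac{2(k^{-1}+1)}{\sinh^2(y_i-y_j)}+\sum_{i=1}^n\sum_{j=1}^m\frac{2(k+1)}{\sinh^2(x_i-y_j)}$.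 Type $BC(n,m)$ (parameters $k,p,q,r,s$ with $p=kr$, $2q+1=k(2s+1)$): $L=-\Delta_n-k\Delta_m+\sum_{i<j}^n\big(\frac{2k(k+1)}{\sinh^2(x_i-x_j)}+\frac{2k(k+1)}{\sinh^2(x_i+x_j)}\big)+\sum_{i<j}^m\big(\frac{2(k^{-1}+1)}{\sinh^2(y_i-y_j)}+\frac{2(k^{-1}+1)}{\sinh^2(y_i+y_j)}\big)+\sum_{i=1}^n\sum_{j=1}^m\big(\frac{2(k+1)}{\sinh^2(x_i-y_j)}+\frac{2(k+1)}{\sinh^2(x_i+y_j)}\big)+\sum_{i=1}^n\frac{p(p+2q+1)}{\sinh^2x_i}+\sum_{i=1}^n\frac{4q(q+1)}{\sinh^22x_i}+\sum_{j=1}^m\frac{kr(r+2s+1)}{\sinh^2y_j}+\sum_{j=1}^m\frac{4ks(s+1)}{\sinh^22y_j}$. "Conjugated" means conjugated by multiplication by a function, up to overall sign and an additive constant (the operators $L$ are written with leading part $-\Delta$). *)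

theory Defs
  imports "HOL-Analysis.Analysis" "HOL-Library.Function_Algebras"
begin

section \<open>Matrix Lie superalgebras\<close>

text \<open>
  The superspace \<open>V\<close> of superdimension \<open>N|M\<close> has the basis indexed by \<open>ixs N M\<close>; an index
  \<open>Inl a\<close> is even and \<open>Inr b\<close> is odd. An endomorphism is its matrix, extended by \<open>0\<close> outside
  the index set; column \<open>j\<close> of \<open>A\<close> is the image of the basis vector \<open>j\<close>.
\<close>

type_synonym ix = "nat + nat"
type_synonym smat = "ix \<Rightarrow> ix \<Rightarrow> complex"

definition ixs :: "nat \<Rightarrow> nat \<Rightarrow> ix set" where
  "ixs N M = Inl ` {..<N} \<union> Inr ` {..<M}"

definition mscale :: "complex \<Rightarrow> smat \<Rightarrow> smat" where
  "mscale c A = (\<lambda>i j. c * A i j)"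

global_interpretation smat: vector_space mscale
  by unfold_locales (auto simp: mscale_def fun_eq_iff algebra_simps)

definition mmul :: "ix set \<Rightarrow> smat \<Rightarrow> smat \<Rightarrow> smat" where
  "mmul I A B = (\<lambda>i j. \<Sum>l\<in>I. A i l * B l j)"

definition munit :: "ix \<Rightarrow> ix \<Rightarrow> smat" where
  "munit a b = (\<lambda>i j. if i = a \<and> j = b then 1 else 0)"

definition even_part :: "smat \<Rightarrow> smat" where
  "even_part A = (\<lambda>i j. if isl i = isl j then A i j else 0)"

definition odd_part :: "smat \<Rightarrow> smat" where
  "odd_part A = (\<lambda>i j. if isl i = isl j then 0 else A i j)"

text \<open>
  Bilinear extension of \<open>[A,B] = A B - (-1)^(|A||B|) B A\<close>.
\<close>

definition sbracket :: "ix set \<Rightarrow> smat \<Rightarrow> smat \<Rightarrow> smat" where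
  "sbracket I A B = mmul I A B - mmul I (even_part B) (even_part A)
     - mmul I (even_part B) (odd_part A) - mmul I (odd_part B) (even_part A)
     + mmul I (odd_part B) (odd_part A)"

definition supertrace :: "ix set \<Rightarrow> smat \<Rightarrow> complex" where
  "supertrace I A = (\<Sum>i\<in>I. if isl i then A i i else - A i i)"

definition superdim :: "smat set \<Rightarrow> int" where
  "superdim S = int (smat.dim {A \<in> S. odd_part A = 0}) - int (smat.dim {A \<in> S. even_part A = 0})"

definition super_subspace :: "smat set \<Rightarrow> bool" where
  "super_subspace W \<longleftrightarrow> smat.subspace W \<and> (\<forall>A\<in>W. even_part A \<in> W \<and> odd_part A \<in> W)"

definition gl_alg :: "nat \<Rightarrow> nat \<Rightarrow> smat set" where
  "gl_alg N M = {A. \<forall>i j. i \<notin> ixs N M \<or> j \<notin> ixs N M \<longrightarrow> A i j = 0}"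

text \<open>
  \<open>ksign i j = (-1)^(|i|(|i|+|j|))\<close>. For an even form \<open>G\<close> and homogeneous \<open>A\<close>, the condition
  \<open>G(A e_i, e_j) + (-1)^(|A||i|) G(e_i, A e_j) = 0\<close> is trivial unless \<open>|A| = |i| + |j|\<close>. Hence
  the condition in \<open>osp_alg\<close> is the invariance of \<open>G\<close> under both homogeneous components.
\<close>

definition ksign :: "ix \<Rightarrow> ix \<Rightarrow> complex" where
  "ksign i j = (if \<not> isl i \<and> isl j then - 1 else 1)"

definition osp_alg :: "nat \<Rightarrow> nat \<Rightarrow> smat \<Rightarrow> smat set" where
  "osp_alg N M G = {A \<in> gl_alg N M. \<forall>i\<in>ixs N M. \<forall>j\<in>ixs N M.
     (\<Sum>l\<in>ixs N M. A l i * G l j) + ksign i j * (\<Sum>l\<in>ixs N M. G i l * A l j) = 0}"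

text \<open>
  Two even supersymmetric nondegenerate forms (symmetric on the even part, alternating on the odd
  part): in \<open>form_std\<close> the even basis is orthonormal and the odd basis vectors \<open>2b, 2b+1\<close> are
  paired; in \<open>form_split l m\<close> the index \<open>a\<close> is paired with \<open>a + l\<close> (even) or \<open>a + m\<close> (odd).
\<close>

fun form_std :: smat where
  "form_std (Inl a) (Inl b) = (if a = b then 1 else 0)"
| "form_std (Inr a) (Inr b) =
     (if even a \<and> b = a + 1 then 1 else if even b \<and> a = b + 1 then - 1 else 0)"
| "form_std _ _ = 0"

fun form_split :: "nat \<Rightarrow> nat \<Rightarrow> smat" where
  "form_split l m (Inl a) (Inl b) = (if b = a + l \<or> a = b + l then 1 else 0)"
| "form_split l m (Inr a) (Inr b) = (if b = a + m then 1 else if a = b + m then - 1 else 0)"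
| "form_split l m _ _ = 0"

text \<open>
  The adjoint \<open>A'\<close> of \<open>A\<close>, determined by \<open>G(A v, w) = (-1)^(|A||v|) G(v, A' w)\<close>, for a form whose
  matrix satisfies \<open>G^(-1) = G^T\<close>, as that of \<open>form_std\<close> does.
\<close>

definition superadjoint :: "ix set \<Rightarrow> smat \<Rightarrow> smat \<Rightarrow> smat" where
  "superadjoint I G A = (\<lambda>l j. \<Sum>i\<in>I. G i l * ksign i j * (\<Sum>c\<in>I. A c i * G c j))"

definition sign_conj :: "(ix \<Rightarrow> bool) \<Rightarrow> smat \<Rightarrow> smat" where
  "sign_conj S A = (\<lambda>i j. if S i = S j then A i j else - A i j)"

section \<open>Symmetric pairs, Cartan subspaces and even type\<close>

text \<open>
  A symmetric pair is given by its Lie superalgebra \<open>alg\<close> of matrices over \<open>idx\<close> and an involution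
  \<open>invol\<close>. It comes with linear coordinates on a subspace \<open>\<aa>\<close> of \<open>\<pp>\<close>: \<open>base c\<close> is the
  vector whose only nonzero coordinate is \<open>c = 1\<close>, where \<open>Inl i\<close> stands for \<open>x_i\<close> and \<open>Inr j\<close>
  for \<open>y_j\<close>. The invariant form on \<open>alg\<close> is the supertrace form divided by \<open>scal\<close>, which
  normalises \<open>x_i\<close> to have norm \<open>1\<close>.
\<close>

record sym_pair =
  idx :: "ix set"
  alg :: "smat set"
  invol :: "smat \<Rightarrow> smat"
  coords :: "ix set"
  base :: "ix \<Rightarrow> smat"
  scal :: real

definition fixed_alg :: "sym_pair \<Rightarrow> smat set" where
  "fixed_alg X = {A \<in> alg X. invol X A = A}"

definition anti_part :: "sym_pair \<Rightarrow> smat set" where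
  "anti_part X = {A \<in> alg X. invol X A = - A}"

definition reductive_in :: "sym_pair \<Rightarrow> smat set \<Rightarrow> bool" where
  "reductive_in X \<aa> \<longleftrightarrow>
     (\<forall>W. super_subspace W \<and> W \<subseteq> alg X \<and> (\<forall>H\<in>\<aa>. \<forall>A\<in>W. sbracket (idx X) H A \<in> W) \<longrightarrow>
       (\<exists>W'. super_subspace W' \<and> W' \<subseteq> alg X \<and> (\<forall>H\<in>\<aa>. \<forall>A\<in>W'. sbracket (idx X) H A \<in> W') \<and>
             W \<inter> W' = {0} \<and> alg X = {A + B |A B. A \<in> W \<and> B \<in> W'}))"

definition cartan_subspace :: "sym_pair \<Rightarrow> smat set \<Rightarrow> bool" where
  "cartan_subspace X \<aa> \<longleftrightarrow>
     super_subspace \<aa> \<and> \<aa> \<subseteq> anti_part X \<and>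
     (\<forall>A\<in>\<aa>. \<forall>B\<in>\<aa>. sbracket (idx X) A B = 0) \<and>
     reductive_in X \<aa> \<and>
     {A \<in> anti_part X. \<forall>H\<in>\<aa>. sbracket (idx X) H A = 0} = \<aa>"

definition even_type :: "sym_pair \<Rightarrow> bool" where
  "even_type X \<longleftrightarrow> (\<exists>\<aa>. cartan_subspace X \<aa> \<and> (\<forall>A\<in>\<aa>. odd_part A = 0))"

section \<open>The four classical series\<close>

text \<open>
  In each series \<open>base\<close> spans an even Cartan subspace whenever the pair is of even type.
\<close>

text \<open>\<open>(gl(n,2m), osp(n,2m))\<close>\<close>

definition pair_gl_osp :: "nat \<Rightarrow> nat \<Rightarrow> sym_pair" where
  "pair_gl_osp n m =
    \<lparr> idx = ixs n (2 * m),
      alg = gl_alg n (2 * m),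
      invol = (\<lambda>A. - superadjoint (ixs n (2 * m)) form_std A),
      coords = ixs n m,
      base = (\<lambda>c. case c of
         Inl i \<Rightarrow> munit (Inl i) (Inl i)
       | Inr j \<Rightarrow> munit (Inr (2 * j)) (Inr (2 * j)) + munit (Inr (2 * j + 1)) (Inr (2 * j + 1))),
      scal = 1 \<rparr>"

text \<open>
  \<open>(gl(n1+n2,m1+m2), gl(n1,m1) + gl(n2,m2))\<close>: the first summand acts on the even indices
  \<open>a < n1\<close> and the odd indices \<open>b < m1\<close>, the second on the remaining ones.
\<close>

definition in_first :: "nat \<Rightarrow> nat \<Rightarrow> ix \<Rightarrow> bool" where
  "in_first N M i \<longleftrightarrow> (case i of Inl a \<Rightarrow> a < N | Inr b \<Rightarrow> b < M)"

definition pair_gl_gl :: "nat \<Rightarrow> nat \<Rightarrow> nat \<Rightarrow> nat \<Rightarrow> sym_pair" where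
  "pair_gl_gl n1 n2 m1 m2 =
    \<lparr> idx = ixs (n1 + n2) (m1 + m2),
      alg = gl_alg (n1 + n2) (m1 + m2),
      invol = sign_conj (in_first n1 m1),
      coords = ixs (min n1 n2) (min m1 m2),
      base = (\<lambda>c. case c of
         Inl i \<Rightarrow> munit (Inl i) (Inl (n1 + i)) + munit (Inl (n1 + i)) (Inl i)
       | Inr j \<Rightarrow> munit (Inr j) (Inr (m1 + j)) + munit (Inr (m1 + j)) (Inr j)),
      scal = 2 \<rparr>"

text \<open>
  \<open>(osp(n1+n2,2m1+2m2), osp(n1,2m1) + osp(n2,2m2))\<close>. The factor \<open>\<i>\<close> makes the eigenvalues of
  \<open>ad \<aa>\<close> real.
\<close>

definition rot :: "ix \<Rightarrow> ix \<Rightarrow> smat" where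
  "rot a b = mscale \<i> (munit b a - munit a b)"

definition pair_osp_osp :: "nat \<Rightarrow> nat \<Rightarrow> nat \<Rightarrow> nat \<Rightarrow> sym_pair" where
  "pair_osp_osp n1 n2 m1 m2 =
    \<lparr> idx = ixs (n1 + n2) (2 * m1 + 2 * m2),
      alg = osp_alg (n1 + n2) (2 * m1 + 2 * m2) form_std,
      invol = sign_conj (in_first n1 (2 * m1)),
      coords = ixs (min n1 n2) (min m1 m2),
      base = (\<lambda>c. case c of
         Inl i \<Rightarrow> rot (Inl i) (Inl (n1 + i))
       | Inr j \<Rightarrow> rot (Inr (2 * j)) (Inr (2 * m1 + 2 * j))
                + rot (Inr (2 * j + 1)) (Inr (2 * m1 + 2 * j + 1))),
      scal = 2 \<rparr>"

text \<open>
  \<open>(osp(2l,2m), gl(l,m))\<close>: \<open>V\<close> is the sum of the isotropic subspaces \<open>W\<close> (even indices \<open>a < l\<close>,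
  odd indices \<open>b < m\<close>) and \<open>W*\<close>; the fixed points of the involution preserve \<open>W\<close> and \<open>W*\<close>, and
  are determined by their restriction to \<open>W\<close>, which is an arbitrary element of \<open>gl(l,m)\<close>.
\<close>

definition pair_osp_gl :: "nat \<Rightarrow> nat \<Rightarrow> sym_pair" where
  "pair_osp_gl l m =
    \<lparr> idx = ixs (2 * l) (2 * m),
      alg = osp_alg (2 * l) (2 * m) (form_split l m),
      invol = sign_conj (in_first l m),
      coords = ixs (l div 2) m,
      base = (\<lambda>c. case c of
         Inl i \<Rightarrow> munit (Inl (l + 2 * i + 1)) (Inl (2 * i)) - munit (Inl (l + 2 * i)) (Inl (2 * i + 1))
                + munit (Inl (2 * i)) (Inl (l + 2 * i + 1)) - munit (Inl (2 * i + 1)) (Inl (l + 2 * i))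
       | Inr j \<Rightarrow> munit (Inr (m + j)) (Inr j) + munit (Inr j) (Inr (m + j))),
      scal = 4 \<rparr>"

subsection \<open>The fixed subalgebras\<close>

lemma fixed_sign_conj: "sign_conj S A = A \<longleftrightarrow> (\<forall>i j. S i \<noteq> S j \<longrightarrow> A i j = 0)"
  by (auto simp: sign_conj_def fun_eq_iff)

lemma fixed_alg_gl_gl:
  "fixed_alg (pair_gl_gl n1 n2 m1 m2) =
     {A \<in> gl_alg (n1 + n2) (m1 + m2). \<forall>i j. in_first n1 m1 i \<noteq> in_first n1 m1 j \<longrightarrow> A i j = 0}"
  by (simp add: fixed_alg_def pair_gl_gl_def fixed_sign_conj)

lemma fixed_alg_osp_osp:
  "fixed_alg (pair_osp_osp n1 n2 m1 m2) =
     {A \<in> osp_alg (n1 + n2) (2 * m1 + 2 * m2) form_std.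
        \<forall>i j. in_first n1 (2 * m1) i \<noteq> in_first n1 (2 * m1) j \<longrightarrow> A i j = 0}"
  by (simp add: fixed_alg_def pair_osp_osp_def fixed_sign_conj)

lemma fixed_alg_osp_gl:
  "fixed_alg (pair_osp_gl l m) =
     {A \<in> osp_alg (2 * l) (2 * m) (form_split l m).
        \<forall>i j. in_first l m i \<noteq> in_first l m j \<longrightarrow> A i j = 0}"
  by (simp add: fixed_alg_def pair_osp_gl_def fixed_sign_conj)

lemma form_std_orthogonal:
  assumes "l \<in> ixs n (2 * m)" "l' \<in> ixs n (2 * m)"
  shows "(\<Sum>i\<in>ixs n (2 * m). form_std i l * form_std i l') = (if l = l' then 1 else 0)"
    and "(\<Sum>i\<in>ixs n (2 * m). form_std l i * form_std l' i) = (if l = l' then 1 else 0)"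
proof -
  define \<sigma> :: "ix \<Rightarrow> ix" where
    "\<sigma> i = (case i of Inl a \<Rightarrow> Inl a | Inr b \<Rightarrow> Inr (if even b then b + 1 else b - 1))" for i
  define \<epsilon> :: "ix \<Rightarrow> complex" where
    "\<epsilon> i = (case i of Inl a \<Rightarrow> 1 | Inr b \<Rightarrow> if even b then 1 else - 1)" for i
  have G: "form_std i j = (if j = \<sigma> i then \<epsilon> i else 0)" for i j
    by (cases i; cases j) (auto simp: \<sigma>_def \<epsilon>_def elim!: oddE)
  have G': "form_std i j = (if i = \<sigma> j then \<epsilon> i else 0)" for i j
    by (cases i; cases j) (auto simp: \<sigma>_def \<epsilon>_def elim!: oddE)
  have \<epsilon>: "\<epsilon> i * \<epsilon> i = 1" for i by (cases i) (auto simp: \<epsilon>_def)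
  have \<sigma>: "\<sigma> i \<in> ixs n (2 * m)" if "i \<in> ixs n (2 * m)" for i
    using that by (auto simp: \<sigma>_def ixs_def elim!: evenE oddE)
  have inv: "\<sigma> (\<sigma> i) = i" for i
    by (cases i) (auto simp: \<sigma>_def elim!: oddE)
  have inj: "\<sigma> i = \<sigma> j \<Longrightarrow> i = j" for i j
    by (metis inv)
  have fin: "finite (ixs n (2 * m))" by (simp add: ixs_def)
  show "(\<Sum>i\<in>ixs n (2 * m). form_std i l * form_std i l') = (if l = l' then 1 else 0)"
    unfolding G' using fin \<sigma>[OF assms(1)] \<epsilon> inj
    by (auto simp: if_distrib[where f="\<lambda>x. x * _"] cong: if_cong)
  show "(\<Sum>i\<in>ixs n (2 * m). form_std l i * form_std l' i) = (if l = l' then 1 else 0)"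
    unfolding G using fin \<sigma>[OF assms(1)] \<epsilon> inj
    by (auto simp: if_distrib[where f="\<lambda>x. x * _"] cong: if_cong)
qed

lemma form_std_outside:
  assumes "i \<in> ixs n (2 * m)" "l \<notin> ixs n (2 * m)"
  shows "form_std i l = 0"
  using assms by (cases i; cases l) (auto simp: ixs_def elim!: evenE oddE)

lemma fixed_alg_gl_osp: "fixed_alg (pair_gl_osp n m) = osp_alg n (2 * m) form_std"
proof -
  define I where "I = ixs n (2 * m)"
  have fin: "finite I" by (simp add: I_def ixs_def)
  have ks: "ksign i j * ksign i j = 1" for i j by (simp add: ksign_def)
  have "- superadjoint I form_std A = A \<longleftrightarrow>
     (\<forall>i\<in>I. \<forall>j\<in>I. (\<Sum>l\<in>I. A l i * form_std l j) + ksign i j * (\<Sum>l\<in>I. form_std i l * A l j) = 0)"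
    (is "?L \<longleftrightarrow> ?R") if A: "A \<in> gl_alg n (2 * m)" for A
  proof
    assume L: ?L
    have e: "A l j = - (\<Sum>i\<in>I. form_std i l * ksign i j * (\<Sum>c\<in>I. A c i * form_std c j))" for l j
      using fun_cong[OF fun_cong[OF L], of l j] by (simp add: superadjoint_def)
    show ?R
    proof (intro ballI)
      fix i j assume i: "i \<in> I" and j: "j \<in> I"
      define T where "T i = ksign i j * (\<Sum>c\<in>I. A c i * form_std c j)" for i
      have "(\<Sum>l\<in>I. form_std i l * A l j) = - (\<Sum>l\<in>I. \<Sum>i'\<in>I. form_std i l * form_std i' l * T i')"
        by (subst e) (simp add: T_def sum_distrib_left sum_negf mult.assoc)
      also have "\<dots> = - (\<Sum>i'\<in>I. (\<Sum>l\<in>I. form_std i l * form_std i' l) * T i')"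
        by (subst sum.swap) (simp only: sum_distrib_right)
      also have "\<dots> = - (\<Sum>i'\<in>I. (if i = i' then 1 else 0) * T i')"
        using i by (intro arg_cong[where f=uminus] sum.cong refl) (simp only: I_def form_std_orthogonal(2))
      also have "\<dots> = - T i" using i fin by (simp add: if_distrib[where f="\<lambda>x. x * _"] cong: if_cong)
      finally show "(\<Sum>l\<in>I. A l i * form_std l j) + ksign i j * (\<Sum>l\<in>I. form_std i l * A l j) = 0"
        by (simp add: T_def mult.assoc[symmetric] ks)
    qed
  next
    assume R: ?R
    show ?L
    proof (intro ext)
      fix l j
      define T where "T i = ksign i j * (\<Sum>c\<in>I. A c i * form_std c j)" for i
      have *: "(- superadjoint I form_std A) l j = - (\<Sum>i\<in>I. form_std i l * T i)"
        by (simp add: superadjoint_def T_def mult.assoc)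
      show "(- superadjoint I form_std A) l j = A l j"
      proof (cases "l \<in> I \<and> j \<in> I")
        case False
        then have "form_std i l * T i = 0" if "i \<in> I" for i
        proof (cases "l \<in> I")
          case False
          then show ?thesis using that form_std_outside[of i n m l] by (simp add: I_def)
        next
          case True
          then have "form_std c j = 0" if "c \<in> I" for c
            using \<open>\<not> (l \<in> I \<and> j \<in> I)\<close> that form_std_outside[of c n m j] by (simp add: I_def)
          then show ?thesis by (simp add: T_def)
        qed
        moreover have "A l j = 0" using False A by (auto simp: gl_alg_def I_def)
        ultimately show ?thesis unfolding * by (simp add: sum.neutral)
      next
        case True
        have T: "T i = - (\<Sum>l\<in>I. form_std i l * A l j)" if "i \<in> I" for i
        proof -
          have "ksign i j * ((\<Sum>l\<in>I. A l i * form_std l j) + ksign i j * (\<Sum>l\<in>I. form_std i l * A l j)) = 0"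
            using R that True by simp
          then show ?thesis
            by (simp add: T_def distrib_left mult.assoc[symmetric] ks eq_neg_iff_add_eq_0)
        qed
        have "- (\<Sum>i\<in>I. form_std i l * T i) = (\<Sum>i\<in>I. \<Sum>l'\<in>I. form_std i l * form_std i l' * A l' j)"
          by (simp add: T sum_distrib_left sum_negf mult.assoc)
        also have "\<dots> = (\<Sum>l'\<in>I. (\<Sum>i\<in>I. form_std i l * form_std i l') * A l' j)"
          by (subst sum.swap) (simp only: sum_distrib_right)
        also have "\<dots> = (\<Sum>l'\<in>I. (if l = l' then 1 else 0) * A l' j)"
          using True by (intro sum.cong refl) (simp only: I_def form_std_orthogonal(1))
        also have "\<dots> = A l j" using True fin by (simp add: if_distrib[where f="\<lambda>x. x * _"] cong: if_cong)
        finally show ?thesis unfolding * .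
      qed
    qed
  qed
  then show ?thesis
    by (auto simp: fixed_alg_def pair_gl_osp_def osp_alg_def I_def)
qed

section \<open>Restricted roots and the radial part\<close>

text \<open>
  A weight is the family of its values on \<open>base\<close>. In the four series \<open>ad \<aa>\<close> is diagonalisable
  with real eigenvalues on \<open>base\<close>, so real weights suffice.
\<close>

definition weight_space :: "sym_pair \<Rightarrow> (ix \<Rightarrow> real) \<Rightarrow> smat set" where
  "weight_space X \<alpha> =
     {A \<in> alg X. \<forall>c\<in>coords X. sbracket (idx X) (base X c) A = mscale (of_real (\<alpha> c)) A}"

definition restricted_roots :: "sym_pair \<Rightarrow> (ix \<Rightarrow> real) set" where
  "restricted_roots X = {\<alpha>. (\<forall>c. c \<notin> coords X \<longrightarrow> \<alpha> c = 0) \<and> (\<exists>c\<in>coords X. \<alpha> c \<noteq> 0) \<and>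
                             weight_space X \<alpha> \<noteq> {0}}"

definition root_mult :: "sym_pair \<Rightarrow> (ix \<Rightarrow> real) \<Rightarrow> real" where
  "root_mult X \<alpha> = of_int (superdim (weight_space X \<alpha>))"

text \<open>The value of the functional \<open>\<alpha>\<close> at the point with coordinates \<open>z\<close>.\<close>

definition app :: "sym_pair \<Rightarrow> (ix \<Rightarrow> real) \<Rightarrow> (ix \<Rightarrow> real) \<Rightarrow> real" where
  "app X \<alpha> z = (\<Sum>c\<in>coords X. \<alpha> c * z c)"

definition positive_roots :: "sym_pair \<Rightarrow> (ix \<Rightarrow> real) set \<Rightarrow> bool" where
  "positive_roots X P \<longleftrightarrow>
     (\<exists>h. (\<forall>\<alpha>\<in>restricted_roots X. app X \<alpha> h \<noteq> 0) \<and>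
          P = {\<alpha> \<in> restricted_roots X. app X \<alpha> h > 0})"

text \<open>
  The vectors \<open>base c\<close> are orthogonal for the invariant form, so on the dual of \<open>\<aa>\<close> the
  coordinate functions are orthogonal, and \<open>dual_norm X c\<close> is the square \<open>(c,c)\<close>.
\<close>

definition dual_norm :: "sym_pair \<Rightarrow> ix \<Rightarrow> real" where
  "dual_norm X c = scal X / Re (supertrace (idx X) (mmul (idx X) (base X c) (base X c)))"

definition pd :: "ix \<Rightarrow> ((ix \<Rightarrow> real) \<Rightarrow> real) \<Rightarrow> (ix \<Rightarrow> real) \<Rightarrow> real" where
  "pd c f z = deriv (\<lambda>t. f (z(c := t))) (z c)"

definition root_deriv ::
  "sym_pair \<Rightarrow> (ix \<Rightarrow> real) \<Rightarrow> ((ix \<Rightarrow> real) \<Rightarrow> real) \<Rightarrow> (ix \<Rightarrow> real) \<Rightarrow> real" where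
  "root_deriv X \<alpha> f z = (\<Sum>c\<in>coords X. dual_norm X c * \<alpha> c * pd c f z)"

definition radial_part ::
  "sym_pair \<Rightarrow> (ix \<Rightarrow> real) set \<Rightarrow> ((ix \<Rightarrow> real) \<Rightarrow> real) \<Rightarrow> (ix \<Rightarrow> real) \<Rightarrow> real" where
  "radial_part X P f z =
     (\<Sum>c\<in>coords X. dual_norm X c * pd c (pd c f) z) +
     (\<Sum>\<alpha>\<in>P. root_mult X \<alpha> * ((exp (2 * app X \<alpha> z) + 1) / (exp (2 * app X \<alpha> z) - 1)) *
            root_deriv X \<alpha> f z)"

text \<open>Points of \<open>\<aa>\<close> (vectors supported on \<open>coords\<close>) off the root hyperplanes.\<close>

definition regular_set :: "sym_pair \<Rightarrow> (ix \<Rightarrow> real) set" where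
  "regular_set X = {z. (\<forall>c. c \<notin> coords X \<longrightarrow> z c = 0) \<and> (\<forall>\<alpha>\<in>restricted_roots X. app X \<alpha> z \<noteq> 0)}"

section \<open>Deformed CMS operators and conjugation\<close>

definition deformed_CMS_A ::
  "nat \<Rightarrow> nat \<Rightarrow> real \<Rightarrow> ((ix \<Rightarrow> real) \<Rightarrow> real) \<Rightarrow> (ix \<Rightarrow> real) \<Rightarrow> real" where
  "deformed_CMS_A n m k f z = (let x = (\<lambda>i. z (Inl i)); y = (\<lambda>j. z (Inr j)) in
     - (\<Sum>i<n. pd (Inl i) (pd (Inl i) f) z) - k * (\<Sum>j<m. pd (Inr j) (pd (Inr j) f) z) +
     ((\<Sum>j<n. \<Sum>i<j. 2 * k * (k + 1) / (sinh (x i - x j))\<^sup>2) +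
      (\<Sum>j<m. \<Sum>i<j. 2 * (1 / k + 1) / (sinh (y i - y j))\<^sup>2) +
      (\<Sum>i<n. \<Sum>j<m. 2 * (k + 1) / (sinh (x i - y j))\<^sup>2)) * f z)"

definition deformed_CMS_BC ::
  "nat \<Rightarrow> nat \<Rightarrow> real \<Rightarrow> real \<Rightarrow> real \<Rightarrow> real \<Rightarrow> real \<Rightarrow>
   ((ix \<Rightarrow> real) \<Rightarrow> real) \<Rightarrow> (ix \<Rightarrow> real) \<Rightarrow> real" where
  "deformed_CMS_BC n m k p q r s f z = (let x = (\<lambda>i. z (Inl i)); y = (\<lambda>j. z (Inr j)) in
     - (\<Sum>i<n. pd (Inl i) (pd (Inl i) f) z) - k * (\<Sum>j<m. pd (Inr j) (pd (Inr j) f) z) +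
     ((\<Sum>j<n. \<Sum>i<j. 2 * k * (k + 1) / (sinh (x i - x j))\<^sup>2 +
                      2 * k * (k + 1) / (sinh (x i + x j))\<^sup>2) +
      (\<Sum>j<m. \<Sum>i<j. 2 * (1 / k + 1) / (sinh (y i - y j))\<^sup>2 +
                      2 * (1 / k + 1) / (sinh (y i + y j))\<^sup>2) +
      (\<Sum>i<n. \<Sum>j<m. 2 * (k + 1) / (sinh (x i - y j))\<^sup>2 +
                      2 * (k + 1) / (sinh (x i + y j))\<^sup>2) +
      (\<Sum>i<n. p * (p + 2 * q + 1) / (sinh (x i))\<^sup>2) +
      (\<Sum>i<n. 4 * q * (q + 1) / (sinh (2 * x i))\<^sup>2) +
      (\<Sum>j<m. k * r * (r + 2 * s + 1) / (sinh (y j))\<^sup>2) +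
      (\<Sum>j<m. 4 * k * s * (s + 1) / (sinh (2 * y j))\<^sup>2)) * f z)"

definition BC_parameters :: "real \<Rightarrow> real \<Rightarrow> real \<Rightarrow> real \<Rightarrow> real \<Rightarrow> bool" where
  "BC_parameters k p q r s \<longleftrightarrow> p = k * r \<and> 2 * q + 1 = k * (2 * s + 1)"

text \<open>
  Differentiability of order \<open>N\<close> in the coordinates \<open>D\<close>. The sets \<open>U\<close> of interest are relatively
  open in the space of vectors supported on the finite set \<open>D\<close>, whose product topology is the
  Euclidean one.
\<close>

fun Ck_on :: "nat \<Rightarrow> ix set \<Rightarrow> (ix \<Rightarrow> real) set \<Rightarrow> ((ix \<Rightarrow> real) \<Rightarrow> real) \<Rightarrow> bool" where
  "Ck_on 0 D U f \<longleftrightarrow> continuous_on U f"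
| "Ck_on (Suc N) D U f \<longleftrightarrow> continuous_on U f \<and>
     (\<forall>c\<in>D. (\<forall>z\<in>U. (\<lambda>t. f (z(c := t))) differentiable at (z c)) \<and> Ck_on N D U (pd c f))"

definition smooth_on :: "ix set \<Rightarrow> (ix \<Rightarrow> real) set \<Rightarrow> ((ix \<Rightarrow> real) \<Rightarrow> real) \<Rightarrow> bool" where
  "smooth_on D U f \<longleftrightarrow> (\<forall>N. Ck_on N D U f)"

text \<open>
  \<open>\<L>\<close> is conjugated to \<open>L\<close> if \<open>\<delta> \<circ> \<L> \<circ> \<delta>\<^sup>-\<^sup>1 = - L + const\<close> for a nowhere vanishing function \<open>\<delta>\<close>; the
  sign is forced, since \<open>\<L>\<close> has leading part \<open>\<Delta>\<close> and \<open>L\<close> has leading part \<open>-\<Delta>\<close>.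
\<close>

definition conjugated ::
  "ix set \<Rightarrow> (ix \<Rightarrow> real) set \<Rightarrow>
   (((ix \<Rightarrow> real) \<Rightarrow> real) \<Rightarrow> (ix \<Rightarrow> real) \<Rightarrow> real) \<Rightarrow>
   (((ix \<Rightarrow> real) \<Rightarrow> real) \<Rightarrow> (ix \<Rightarrow> real) \<Rightarrow> real) \<Rightarrow> bool" where
  "conjugated D U \<L> L \<longleftrightarrow>
     (\<exists>\<delta> const. smooth_on D U \<delta> \<and> (\<forall>z\<in>U. \<delta> z \<noteq> 0) \<and>
        (\<forall>f. smooth_on D U f \<longrightarrow>
           (\<forall>z\<in>U. \<delta> z * \<L> (\<lambda>w. f w / \<delta> w) z = - L f z + const * f z)))"

definition radial_part_conjugated ::
  "sym_pair \<Rightarrow> (((ix \<Rightarrow> real) \<Rightarrow> real) \<Rightarrow> (ix \<Rightarrow> real) \<Rightarrow> real) \<Rightarrow> bool" where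
  "radial_part_conjugated X L \<longleftrightarrow>
     (\<forall>P. positive_roots X P \<longrightarrow> conjugated (coords X) (regular_set X) (radial_part X P) L)"

end

theory Submission
  imports Defs
begin

text \<open>
  Let \<open>\<delta> = \<Prod> \<bar>sinh \<alpha>\<bar> ^ (\<mu>\<^sub>\<alpha> / 2)\<close> over the positive roots. Since \<open>2 \<nabla> log \<delta>\<close> is the vector field
  \<open>\<Sum> \<mu>\<^sub>\<alpha> coth \<alpha> \<partial>\<^sub>\<alpha>\<close>, conjugation by \<open>\<delta>\<close> removes the first order terms of the radial part and leaves
  the potential \<open>\<bar>\<nabla> log \<delta>\<bar>\<^sup>2 + \<Delta> log \<delta>\<close>. With \<open>w = 1\<close> on the \<open>x\<close>-coordinates and \<open>w = 1 / k\<close> on the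
  \<open>y\<close>-coordinates, all multiplicities have the form \<open>- 2 k w\<^sub>I w\<^sub>J\<close> for the roots pairing two coordinates,
  so the three-body terms of the potential are constant by a cyclic identity, which becomes Lagrange
  interpolation in the variables \<open>cosh (2 z\<^sub>I)\<close>; the remaining cross terms are constant because of
  \<open>p = k r\<close> and \<open>2 q + 1 = k (2 s + 1)\<close>.

  The multiplicities are never computed one by one. The algebra is \<open>V \<otimes> V\<^sup>*\<close> or the super exterior
  square of \<open>V\<close>, so it has a homogeneous basis of weight vectors indexed by pairs of weight vectors of
  \<open>V\<close>, and a sum over the roots is a signed double sum over the weights of \<open>V\<close>.
\<close>

section \<open>Conjugation of the radial part\<close>

text \<open>Multiplicities do not tell which functionals are roots: the even and odd parts of a
  weight space can have equal dimension, and then the root still cuts out a hyperplane although it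
  drops out of every sum. Which functionals vanish at no regular point is therefore recovered from
  the sum formula itself, by test functions supported on the functionals that vanish at the given
  point. A coordinate whose one-index multiplicities are zero may vanish at a regular point, so the
  one-body identities allow this alternative.

  All parameters come from the signed weights of V. Let V have superdimension \<open>m0\<close> in
  weight 0 and \<open>d * w J\<close> in each weight \<open>\<plusminus> unit_wt J\<close>.
  Comparing the two-index roots gives \<open>k = - d\<^sup>2\<close> for V tensor its dual and
  \<open>k = - d\<^sup>2 / 2\<close> for the super exterior square; the one-index multiplicities are
  proportional to \<open>m0 * d * w J\<close>. Here d counts the basis vectors of V of a given
  weight x_i, and \<open>w\<close> on the y-coordinates is minus the ratio of the counts for y and
  x, the sign being the parity. In type A only the weights \<open>unit_wt J\<close> occur,
  \<open>w J\<close> times each, and \<open>k = - 1 / 2\<close>.\<close>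

definition coth :: "real \<Rightarrow> real" where
  "coth x = cosh x / sinh x"

lemma coth_minus [simp]: "coth (- x) = - coth x"
  by (simp add: coth_def)

lemma coth_exp: "(exp (2 * x) + 1) / (exp (2 * x) - 1) = coth x"
proof -
  have "exp (2 * x) = exp x * exp x" by (metis exp_double power2_eq_square)
  then have "exp (2 * x) + 1 = 2 * exp x * cosh x" "exp (2 * x) - 1 = 2 * exp x * sinh x"
    by (simp_all add: cosh_field_def sinh_field_def exp_minus field_simps)
  then show ?thesis by (simp add: coth_def)
qed

lemma coth_squared: "x \<noteq> 0 \<Longrightarrow> (coth x)\<^sup>2 = 1 + 1 / (sinh x)\<^sup>2"
  by (simp add: coth_def cosh_square_eq field_simps)

lemma DERIV_coth:
  assumes "x \<noteq> 0"
  shows "(coth has_real_derivative 1 - (coth x)\<^sup>2) (at x)"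
  unfolding coth_def
  by (rule derivative_eq_intros refl | use assms in \<open>simp add: field_simps power2_eq_square\<close>)+

section \<open>Linear functionals and differentiability along coordinate lines\<close>

definition lin :: "ix set \<Rightarrow> (ix \<Rightarrow> real) \<Rightarrow> (ix \<Rightarrow> real) \<Rightarrow> real" where
  "lin D \<alpha> z = (\<Sum>c\<in>D. \<alpha> c * z c)"

lemma app_lin: "app X \<alpha> z = lin (coords X) \<alpha> z"
  by (simp add: app_def lin_def)

lemma lin_upd:
  assumes "finite D" "c \<in> D"
  shows "lin D \<alpha> (z(c := t)) = lin D \<alpha> z + \<alpha> c * (t - z c)"
  unfolding lin_def sum.remove[OF assms] by (simp add: algebra_simps)

lemma continuous_on_lin: "continuous_on U (lin D \<alpha>)"
  unfolding lin_def by (intro continuous_intros continuous_on_product_then_coordinatewise)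

text \<open>Both \<open>pd\<close> and \<open>Ck_on\<close> look along coordinate lines, and this is
  the openness that makes them local. \<open>regular_set\<close> is not open in the full function
  space, because its elements are supported on \<open>coords\<close>.\<close>

definition line_open :: "ix set \<Rightarrow> (ix \<Rightarrow> real) set \<Rightarrow> bool" where
  "line_open D U \<longleftrightarrow> (\<forall>z\<in>U. \<forall>c\<in>D. \<forall>\<^sub>F t in nhds (z c). z(c := t) \<in> U)"

lemma pd_eqI: "((\<lambda>t. f (z(c := t))) has_real_derivative d) (at (z c)) \<Longrightarrow> pd c f z = d"
  unfolding pd_def by (rule DERIV_imp_deriv)

lemma line_open_eq:
  assumes "line_open D U" "z \<in> U" "c \<in> D" "\<And>w. w \<in> U \<Longrightarrow> f w = g w"
  shows "\<forall>\<^sub>F t in nhds (z c). f (z(c := t)) = g (z(c := t))"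
  using assms unfolding line_open_def by (fastforce elim: eventually_mono)

lemma pd_cong_on:
  assumes "line_open D U" "z \<in> U" "c \<in> D" "\<And>w. w \<in> U \<Longrightarrow> f w = g w"
  shows "pd c f z = pd c g z"
  unfolding pd_def using line_open_eq[OF assms] by (intro deriv_cong_ev refl)

lemma DERIV_cong_on:
  assumes "line_open D U" "z \<in> U" "c \<in> D" "\<And>w. w \<in> U \<Longrightarrow> f w = g w"
  shows "((\<lambda>t. f (z(c := t))) has_real_derivative d) (at (z c)) \<longleftrightarrow>
         ((\<lambda>t. g (z(c := t))) has_real_derivative d) (at (z c))"
  using line_open_eq[OF assms] by (intro DERIV_cong_ev refl)

lemma Ck_on_imp_DERIV:
  assumes "Ck_on (Suc N) D U f" "c \<in> D" "z \<in> U"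
  shows "((\<lambda>t. f (z(c := t))) has_real_derivative pd c f z) (at (z c))"
  using assms by (auto simp: pd_def real_differentiable_def dest: DERIV_imp_deriv)

text \<open>By line openness \<open>pd c f\<close> and \<open>pd c g\<close> again agree on
  \<open>U\<close>, so the induction goes through. A formula valid only on \<open>U\<close> may thus
  replace a derivative.\<close>

lemma Ck_on_cong:
  assumes "line_open D U" "\<And>w. w \<in> U \<Longrightarrow> f w = g w" "Ck_on N D U f"
  shows "Ck_on N D U g"
  using assms(2,3)
proof (induction N arbitrary: f g)
  case 0
  then show ?case by (simp cong: continuous_on_cong_simp)
next
  case (Suc N)
  have "continuous_on U g" using Suc.prems continuous_on_eq by (metis Ck_on.simps(2))
  moreover have "Ck_on N D U (pd c g)" if "c \<in> D" for c
  proof (rule Suc.IH)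
    show "pd c f w = pd c g w" if "w \<in> U" for w
      using pd_cong_on[OF assms(1) that \<open>c \<in> D\<close> Suc.prems(1)] .
    show "Ck_on N D U (pd c f)" using Suc.prems(2) that by simp
  qed
  moreover have "(\<lambda>t. g (z(c := t))) differentiable at (z c)" if "c \<in> D" "z \<in> U" for c z
  proof -
    have "((\<lambda>t. f (z(c := t))) has_real_derivative d) (at (z c)) \<longleftrightarrow>
         ((\<lambda>t. g (z(c := t))) has_real_derivative d) (at (z c))" for d
      by (rule DERIV_cong_on[OF assms(1) that(2,1)]) (rule Suc.prems(1))
    then show ?thesis
      using Ck_on_imp_DERIV[OF Suc.prems(2) that] unfolding real_differentiable_def by blast
  qed
  ultimately show ?case by simp
qed

text \<open>The induction step for concrete functions: a derivative \<open>f'\<close> is exhibited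
  by a formula, and \<open>Ck_on_cong\<close> carries its regularity over to
  \<open>pd c f\<close>.\<close>

lemma Ck_on_SucI:
  assumes "line_open D U" "continuous_on U f"
    and "\<And>c z. c \<in> D \<Longrightarrow> z \<in> U \<Longrightarrow>
      ((\<lambda>t. f (z(c := t))) has_real_derivative f' c z) (at (z c))"
    and "\<And>c. c \<in> D \<Longrightarrow> Ck_on N D U (f' c)"
  shows "Ck_on (Suc N) D U f"
proof -
  have "Ck_on N D U (pd c f)" if "c \<in> D" for c
    by (rule Ck_on_cong[OF assms(1) _ assms(4)[OF that]])
       (rule pd_eqI[OF assms(3)[OF that], symmetric])
  then show ?thesis using assms by (auto simp: real_differentiable_def)
qed

lemma Ck_on_imp_continuous: "Ck_on N D U f \<Longrightarrow> continuous_on U f"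
  by (cases N) auto

lemma Ck_on_SucD: "Ck_on (Suc N) D U f \<Longrightarrow> Ck_on N D U f"
  by (induction N arbitrary: f) auto

lemma Ck_on_const: "line_open D U \<Longrightarrow> Ck_on N D U (\<lambda>_. a)"
proof (induction N arbitrary: a)
  case (Suc N)
  then show ?case by (intro Ck_on_SucI[where f' = "\<lambda>_ _. 0"]) auto
qed simp

lemma Ck_on_add:
  assumes "line_open D U" "Ck_on N D U f" "Ck_on N D U g"
  shows "Ck_on N D U (\<lambda>z. f z + g z)"
  using assms(2,3)
proof (induction N arbitrary: f g)
  case (Suc N)
  show ?case
    using Suc.prems Suc.IH
    by (intro Ck_on_SucI[OF assms(1), where f' = "\<lambda>c z. pd c f z + pd c g z"]
          continuous_on_add DERIV_add Ck_on_imp_DERIV) auto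
qed (auto intro: continuous_intros)

lemma Ck_on_mult:
  assumes "line_open D U" "Ck_on N D U f" "Ck_on N D U g"
  shows "Ck_on N D U (\<lambda>z. f z * g z)"
  using assms(2,3)
proof (induction N arbitrary: f g)
  case (Suc N)
  have D: "((\<lambda>t. f (z(c := t)) * g (z(c := t))) has_real_derivative pd c f z * g z + pd c g z * f z) (at (z c))"
    if "c \<in> D" "z \<in> U" for c z
    using DERIV_mult[OF Ck_on_imp_DERIV[OF Suc.prems(1) that] Ck_on_imp_DERIV[OF Suc.prems(2) that]]
    by (simp only: fun_upd_triv)
  show ?case
    using Suc.prems Suc.IH Ck_on_SucD[OF Suc.prems(1)] Ck_on_SucD[OF Suc.prems(2)]
    by (intro Ck_on_SucI[OF assms(1), where f' = "\<lambda>c z. pd c f z * g z + pd c g z * f z"]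
          continuous_on_mult D Ck_on_add[OF assms(1)]) auto
qed (auto intro: continuous_intros)

lemma Ck_on_sum:
  assumes "line_open D U" "\<And>i. i \<in> A \<Longrightarrow> Ck_on N D U (f i)"
  shows "Ck_on N D U (\<lambda>z. \<Sum>i\<in>A. f i z)"
  using assms(2)
  by (induction A rule: infinite_finite_induct)
     (auto intro: Ck_on_const Ck_on_add assms(1))

lemma DERIV_coth_lin:
  assumes "finite D" "c \<in> D" "lin D \<alpha> z \<noteq> 0"
  shows "((\<lambda>t. coth (lin D \<alpha> (z(c := t)))) has_real_derivative
           \<alpha> c * (1 - (coth (lin D \<alpha> z))\<^sup>2)) (at (z c))"
proof -
  have "((\<lambda>t. lin D \<alpha> (z(c := t))) has_real_derivative \<alpha> c) (at (z c))"
    unfolding lin_upd[OF assms(1,2)] by (auto intro!: derivative_eq_intros)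
  from DERIV_chain2[OF _ this, of coth "1 - (coth (lin D \<alpha> z))\<^sup>2"] show ?thesis
    using DERIV_coth[OF assms(3)] by (simp add: mult.commute)
qed

text \<open>The derivative of \<open>coth\<close> is the polynomial \<open>1 - coth\<^sup>2\<close>
  in \<open>coth\<close> itself, so order N passes to order N + 1.\<close>

lemma Ck_on_coth_lin:
  assumes "line_open D U" "finite D" "\<And>z. z \<in> U \<Longrightarrow> lin D \<alpha> z \<noteq> 0"
  shows "Ck_on N D U (\<lambda>z. coth (lin D \<alpha> z))"
proof (induction N)
  case 0
  show ?case using assms(3) by (auto simp: coth_def intro!: continuous_intros continuous_on_lin)
next
  case (Suc N)
  have "Ck_on N D U (\<lambda>z. \<alpha> c * (1 + (-1) * (coth (lin D \<alpha> z) * coth (lin D \<alpha> z))))" for c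
    by (intro Ck_on_mult Ck_on_add Ck_on_const Suc assms(1))
  then show ?case
    using assms
    by (intro Ck_on_SucI[where f' = "\<lambda>c z. \<alpha> c * (1 - (coth (lin D \<alpha> z))\<^sup>2)"] DERIV_coth_lin
          Ck_on_imp_continuous[OF Suc])
       (auto simp: power2_eq_square)
qed

text \<open>\<open>sinh\<^sup>2\<close> is used instead of \<open>\<bar>sinh\<bar>\<close> to stay within differentiable functions.\<close>

definition weyl_fn :: "ix set \<Rightarrow> (ix \<Rightarrow> real) set \<Rightarrow> ((ix \<Rightarrow> real) \<Rightarrow> real) \<Rightarrow> (ix \<Rightarrow> real) \<Rightarrow> real" where
  "weyl_fn D P \<mu> z = exp (\<Sum>\<alpha>\<in>P. \<mu> \<alpha> / 4 * ln ((sinh (lin D \<alpha> z))\<^sup>2))"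

text \<open>The partial derivative of the logarithm of \<open>weyl_fn\<close>: the factor 1/4 turns
  into 1/2 because \<open>ln (sinh\<^sup>2)\<close> has the derivative
  \<open>2 * coth\<close>.\<close>

definition log_weyl_pd ::
  "ix set \<Rightarrow> (ix \<Rightarrow> real) set \<Rightarrow> ((ix \<Rightarrow> real) \<Rightarrow> real) \<Rightarrow> ix \<Rightarrow> (ix \<Rightarrow> real) \<Rightarrow> real" where
  "log_weyl_pd D P \<mu> c z = (\<Sum>\<alpha>\<in>P. \<mu> \<alpha> / 2 * (\<alpha> c * coth (lin D \<alpha> z)))"

section \<open>Derivatives of the Weyl function and conjugation by it\<close>

context
  fixes D :: "ix set" and P :: "(ix \<Rightarrow> real) set" and U :: "(ix \<Rightarrow> real) set"
    and \<mu> :: "(ix \<Rightarrow> real) \<Rightarrow> real"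
  assumes lo: "line_open D U" and finD: "finite D"
    and reg: "\<And>z \<alpha>. z \<in> U \<Longrightarrow> \<alpha> \<in> P \<Longrightarrow> lin D \<alpha> z \<noteq> 0"
begin

lemma DERIV_weyl_fn:
  assumes "c \<in> D" "z \<in> U"
  shows "((\<lambda>t. weyl_fn D P \<mu> (z(c := t))) has_real_derivative
           weyl_fn D P \<mu> z * log_weyl_pd D P \<mu> c z) (at (z c))"
proof -
  have 1: "((\<lambda>t. lin D \<alpha> (z(c := t))) has_real_derivative \<alpha> c) (at (z c))" for \<alpha>
    unfolding lin_upd[OF finD assms(1)] by (auto intro!: derivative_eq_intros)
  have 2: "((\<lambda>t. ln ((sinh (lin D \<alpha> (z(c := t))))\<^sup>2)) has_real_derivative
      2 * (\<alpha> c * coth (lin D \<alpha> z))) (at (z c))" if "\<alpha> \<in> P" for \<alpha>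
    by (rule DERIV_cong[OF DERIV_chain2[OF DERIV_ln DERIV_power[OF has_field_derivative_sinh[OF 1]]]])
       (use reg[OF assms(2) that] in \<open>simp_all add: coth_def power2_eq_square field_simps zero_less_mult_iff linorder_neq_iff disj_commute\<close>)
  have 3: "((\<lambda>t. \<Sum>\<alpha>\<in>P. \<mu> \<alpha> / 4 * ln ((sinh (lin D \<alpha> (z(c := t))))\<^sup>2)) has_real_derivative
      log_weyl_pd D P \<mu> c z) (at (z c))"
    unfolding log_weyl_pd_def
    by (rule DERIV_cong[OF DERIV_sum[OF DERIV_cmult[OF 2]]]) (auto intro!: sum.cong)
  show ?thesis
    unfolding weyl_fn_def using DERIV_chain2[OF DERIV_exp 3] by simp
qed

lemma smooth_on_weyl_fn: "smooth_on D U (weyl_fn D P \<mu>)"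
proof -
  have "Ck_on N D U (weyl_fn D P \<mu>)" for N
  proof (induction N)
    case 0
    show ?case
      using reg by (auto simp: weyl_fn_def intro!: continuous_intros continuous_on_lin)
  next
    case (Suc N)
    show ?case
      using reg
      by (intro Ck_on_SucI[OF lo, where f' = "\<lambda>c z. weyl_fn D P \<mu> z * log_weyl_pd D P \<mu> c z"]
            DERIV_weyl_fn Ck_on_imp_continuous[OF Suc] Ck_on_mult[OF lo] Suc)
         (auto simp: log_weyl_pd_def simp del: times_divide_eq_left
           intro!: Ck_on_sum Ck_on_mult Ck_on_const lo Ck_on_coth_lin finD)
  qed
  then show ?thesis by (simp add: smooth_on_def)
qed

lemma weyl_fn_nonzero [simp]: "weyl_fn D P \<mu> z \<noteq> 0"
  by (simp add: weyl_fn_def)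

lemma DERIV_log_weyl_pd:
  assumes "c \<in> D" "z \<in> U"
  shows "((\<lambda>t. log_weyl_pd D P \<mu> c (z(c := t))) has_real_derivative
     - (\<Sum>\<alpha>\<in>P. \<mu> \<alpha> / 2 * ((\<alpha> c)\<^sup>2 / (sinh (lin D \<alpha> z))\<^sup>2))) (at (z c))"
  unfolding log_weyl_pd_def
  by (rule DERIV_cong[OF DERIV_sum[OF DERIV_cmult[OF DERIV_cmult[OF DERIV_coth_lin]]]])
     (use reg finD assms in \<open>auto simp: coth_squared power2_eq_square[of "_ c"] sum_negf[symmetric] intro!: sum.cong\<close>)

lemma pd_quotient_weyl_fn:
  assumes f: "smooth_on D U f" and "c \<in> D" "z \<in> U"
  shows "pd c (\<lambda>w. f w / weyl_fn D P \<mu> w) z =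
    (pd c f z - f z * log_weyl_pd D P \<mu> c z) / weyl_fn D P \<mu> z"
proof (rule pd_eqI)
  have "Ck_on (Suc 0) D U f" using f by (simp add: smooth_on_def)
  note df = Ck_on_imp_DERIV[OF this assms(2,3)]
  show "((\<lambda>t. f (z(c := t)) / weyl_fn D P \<mu> (z(c := t))) has_real_derivative
      (pd c f z - f z * log_weyl_pd D P \<mu> c z) / weyl_fn D P \<mu> z) (at (z c))"
    by (rule DERIV_cong[OF DERIV_divide[OF df DERIV_weyl_fn[OF assms(2,3)]]])
       (simp_all add: field_simps)
qed

text \<open>With \<open>l\<close> the logarithmic derivative of the Weyl function \<open>d\<close>,
  this is \<open>d * (f / d)'' = f'' - 2 * l * f' + (l\<^sup>2 - l') * f\<close>. The sum over
  \<open>P\<close> is \<open>- l'\<close>, as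
  \<open>1 - coth\<^sup>2 = - 1 / sinh\<^sup>2\<close>.\<close>

lemma pd_pd_quotient_weyl_fn:
  assumes f: "smooth_on D U f" and "c \<in> D" "z \<in> U"
  shows "weyl_fn D P \<mu> z * pd c (pd c (\<lambda>w. f w / weyl_fn D P \<mu> w)) z =
    pd c (pd c f) z - 2 * log_weyl_pd D P \<mu> c z * pd c f z
      + ((log_weyl_pd D P \<mu> c z)\<^sup>2
         + (\<Sum>\<alpha>\<in>P. \<mu> \<alpha> / 2 * ((\<alpha> c)\<^sup>2 / (sinh (lin D \<alpha> z))\<^sup>2))) * f z"
proof -
  have C2: "Ck_on (Suc (Suc 0)) D U f" using f unfolding smooth_on_def by blast
  have df: "((\<lambda>t. f (z(c := t))) has_real_derivative pd c f z) (at (z c))"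
    using Ck_on_imp_DERIV[OF C2 assms(2,3)] .
  have "Ck_on (Suc 0) D U (pd c f)" using C2 assms(2) by simp
  note ddf = Ck_on_imp_DERIV[OF this assms(2,3)]
  have eq: "pd c (pd c (\<lambda>w. f w / weyl_fn D P \<mu> w)) z =
    pd c (\<lambda>w. (pd c f w - f w * log_weyl_pd D P \<mu> c w) / weyl_fn D P \<mu> w) z"
    by (rule pd_cong_on[OF lo assms(3,2)]) (rule pd_quotient_weyl_fn[OF f assms(2)])
  also have "\<dots> = (pd c (pd c f) z - 2 * log_weyl_pd D P \<mu> c z * pd c f z
      + ((log_weyl_pd D P \<mu> c z)\<^sup>2
         + (\<Sum>\<alpha>\<in>P. \<mu> \<alpha> / 2 * ((\<alpha> c)\<^sup>2 / (sinh (lin D \<alpha> z))\<^sup>2))) * f z) / weyl_fn D P \<mu> z"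
    by (rule pd_eqI, rule DERIV_cong[OF DERIV_divide[OF DERIV_diff[OF ddf
            DERIV_mult[OF df DERIV_log_weyl_pd[OF assms(2,3)]]] DERIV_weyl_fn[OF assms(2,3)]]])
       (simp_all add: field_simps power2_eq_square)
  finally show ?thesis by simp
qed

text \<open>Exchanging the sums, the first order operator has the coefficients
  \<open>2 * g c * l c\<close>, where \<open>l\<close> is the logarithmic derivative. Its derivative
  terms cancel the terms \<open>- 2 * l * f'\<close> of the second order part, and its terms in
  \<open>f\<close> turn \<open>+ l\<^sup>2\<close> into \<open>- l\<^sup>2\<close>. What remains is
  the potential \<open>l\<^sup>2 + l'\<close>, with a minus sign in front.\<close>

lemma conjugate_by_weyl_fn:
  assumes f: "smooth_on D U f" and z: "z \<in> U"
  shows "weyl_fn D P \<mu> z *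
     ((\<Sum>c\<in>D. g c * pd c (pd c (\<lambda>w. f w / weyl_fn D P \<mu> w)) z) +
      (\<Sum>\<alpha>\<in>P. \<mu> \<alpha> * coth (lin D \<alpha> z) *
         (\<Sum>c\<in>D. g c * \<alpha> c * pd c (\<lambda>w. f w / weyl_fn D P \<mu> w) z))) =
     (\<Sum>c\<in>D. g c * pd c (pd c f) z) -
     (\<Sum>c\<in>D. g c * ((log_weyl_pd D P \<mu> c z)\<^sup>2
        - (\<Sum>\<alpha>\<in>P. \<mu> \<alpha> / 2 * ((\<alpha> c)\<^sup>2 / (sinh (lin D \<alpha> z))\<^sup>2)))) * f z"
proof -
  let ?d = "weyl_fn D P \<mu> z" and ?q = "\<lambda>w. f w / weyl_fn D P \<mu> w" and ?l = "\<lambda>c. log_weyl_pd D P \<mu> c z"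
    and ?s = "\<lambda>c. \<Sum>\<alpha>\<in>P. \<mu> \<alpha> / 2 * ((\<alpha> c)\<^sup>2 / (sinh (lin D \<alpha> z))\<^sup>2)"
  have "(\<Sum>\<alpha>\<in>P. \<mu> \<alpha> * coth (lin D \<alpha> z) * (\<Sum>c\<in>D. g c * \<alpha> c * pd c ?q z)) =
      (\<Sum>c\<in>D. g c * (2 * ?l c) * pd c ?q z)"
    unfolding log_weyl_pd_def sum_distrib_left sum_distrib_right
    by (subst sum.swap) (simp add: algebra_simps)
  then have "?d * ((\<Sum>c\<in>D. g c * pd c (pd c ?q) z) +
      (\<Sum>\<alpha>\<in>P. \<mu> \<alpha> * coth (lin D \<alpha> z) * (\<Sum>c\<in>D. g c * \<alpha> c * pd c ?q z))) =
      (\<Sum>c\<in>D. g c * (?d * pd c (pd c ?q) z) + g c * (2 * ?l c) * (?d * pd c ?q z))"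
    by (simp add: sum_distrib_left distrib_left sum.distrib algebra_simps)
  also have "\<dots> = (\<Sum>c\<in>D. g c * pd c (pd c f) z - g c * ((?l c)\<^sup>2 - ?s c) * f z)"
  proof (rule sum.cong[OF refl])
    fix c assume c: "c \<in> D"
    have "?d * pd c ?q z = pd c f z - f z * ?l c"
      using pd_quotient_weyl_fn[OF f c z] by simp
    then show "g c * (?d * pd c (pd c ?q) z) + g c * (2 * ?l c) * (?d * pd c ?q z) =
        g c * pd c (pd c f) z - g c * ((?l c)\<^sup>2 - ?s c) * f z"
      unfolding pd_pd_quotient_weyl_fn[OF f c z] \<open>?d * pd c ?q z = _\<close> by (simp add: algebra_simps power2_eq_square)
  qed
  finally show ?thesis by (simp add: sum_subtractf sum_distrib_right)
qed

end

section \<open>From the conjugation formula to a comparison of potentials\<close>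

lemma regular_line_open:
  assumes "finite (coords X)" "finite (restricted_roots X)"
  shows "line_open (coords X) (regular_set X)"
  unfolding line_open_def
proof (intro ballI)
  fix z c assume z: "z \<in> regular_set X" and c: "c \<in> coords X"
  have "\<forall>\<^sub>F t in nhds (z c). app X \<alpha> (z(c := t)) \<noteq> 0" if "\<alpha> \<in> restricted_roots X" for \<alpha>
  proof -
    have "open {t. lin (coords X) \<alpha> z + \<alpha> c * (t - z c) \<noteq> 0}"
      by (intro open_Collect_neq continuous_intros)
    moreover have "z c \<in> {t. lin (coords X) \<alpha> z + \<alpha> c * (t - z c) \<noteq> 0}"
      using z that by (simp add: regular_set_def app_lin)
    ultimately show ?thesis
      unfolding app_lin lin_upd[OF assms(1) c] eventually_nhds by blast
  qed
  then have "\<forall>\<^sub>F t in nhds (z c). \<forall>\<alpha>\<in>restricted_roots X. app X \<alpha> (z(c := t)) \<noteq> 0"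
    using assms(2) by (simp add: eventually_ball_finite_distrib)
  then show "\<forall>\<^sub>F t in nhds (z c). z(c := t) \<in> regular_set X"
    using z c by (auto elim!: eventually_mono simp: regular_set_def)
qed

text \<open>\<open>V\<close> is the potential of \<open>L\<close>. The conjugated radial part is the
  Laplacian minus its potential, so agreement of the two potentials up to \<open>C\<close> is
  conjugacy with the additive constant \<open>- C\<close>, which may depend on
  \<open>P\<close>.\<close>

lemma radial_part_conjugatedI:
  assumes "finite (coords X)" "finite (restricted_roots X)"
    and "\<And>f z. L f z = - (\<Sum>c\<in>coords X. dual_norm X c * pd c (pd c f) z) + V z * f z"
    and "\<And>P. positive_roots X P \<Longrightarrow> \<exists>C. \<forall>z\<in>regular_set X.
      (\<Sum>c\<in>coords X. dual_norm X c * ((log_weyl_pd (coords X) P (root_mult X) c z)\<^sup>2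
        - (\<Sum>\<alpha>\<in>P. root_mult X \<alpha> / 2 * ((\<alpha> c)\<^sup>2 / (sinh (lin (coords X) \<alpha> z))\<^sup>2)))) = V z + C"
  shows "radial_part_conjugated X L"
  unfolding radial_part_conjugated_def
proof (intro allI impI)
  fix P assume P: "positive_roots X P"
  let ?D = "coords X" and ?U = "regular_set X" and ?\<mu> = "root_mult X"
  from assms(4)[OF P] obtain C where C: "\<And>z. z \<in> ?U \<Longrightarrow>
      (\<Sum>c\<in>?D. dual_norm X c * ((log_weyl_pd ?D P ?\<mu> c z)\<^sup>2
        - (\<Sum>\<alpha>\<in>P. ?\<mu> \<alpha> / 2 * ((\<alpha> c)\<^sup>2 / (sinh (lin ?D \<alpha> z))\<^sup>2)))) = V z + C"
    by blast
  have reg: "lin ?D \<alpha> z \<noteq> 0" if "z \<in> ?U" "\<alpha> \<in> P" for z \<alpha>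
    using P that by (auto simp: positive_roots_def regular_set_def app_lin)
  note lo = regular_line_open[OF assms(1,2)]
  show "conjugated ?D ?U (radial_part X P) L"
    unfolding conjugated_def
  proof (rule exI[of _ "weyl_fn ?D P ?\<mu>"], rule exI[of _ "- C"], intro conjI allI impI ballI)
    show "smooth_on ?D ?U (weyl_fn ?D P ?\<mu>)"
      by (rule smooth_on_weyl_fn[OF lo assms(1)]) (rule reg)
    show "weyl_fn ?D P ?\<mu> z \<noteq> 0" for z by (simp add: weyl_fn_def)
    fix f z assume f: "smooth_on ?D ?U f" and z: "z \<in> ?U"
    show "weyl_fn ?D P ?\<mu> z * radial_part X P (\<lambda>w. f w / weyl_fn ?D P ?\<mu> w) z = - L f z + - C * f z"
      using conjugate_by_weyl_fn[OF lo assms(1) reg f z, where P = P and \<mu> = ?\<mu> and g = "dual_norm X"]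
      unfolding radial_part_def root_deriv_def app_lin coth_exp assms(3) C[OF z]
      by (simp add: algebra_simps)
  qed
qed

section \<open>Root systems of types A and BC\<close>

lemma finite_ixs [simp]: "finite (ixs n m)"
  by (simp add: ixs_def)

lemma sum_ixs: "sum f (ixs n m) = (\<Sum>i<n. f (Inl i)) + (\<Sum>j<m. f (Inr j))"
  unfolding ixs_def
  by (subst sum.union_disjoint) (auto simp: sum.reindex inj_on_def)

section \<open>Sums over ordered pairs and triples of coordinates\<close>

lemma sum_swap_off_diagonal:
  assumes "finite A"
  shows "(\<Sum>i\<in>A. \<Sum>j\<in>A - {i}. f i j) = (\<Sum>i\<in>A. \<Sum>j\<in>A - {i}. f j i)"
proof -
  have "(\<Sum>i\<in>A. \<Sum>j\<in>A - {i}. g i j) = (\<Sum>(i,j)\<in>Sigma A (\<lambda>i. A - {i}). g i j)" for g :: "'a \<Rightarrow> 'a \<Rightarrow> 'b"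
    using assms by (simp add: sum.Sigma)
  moreover have "(\<Sum>(i,j)\<in>Sigma A (\<lambda>i. A - {i}). f i j) = (\<Sum>(i,j)\<in>Sigma A (\<lambda>i. A - {i}). f j i)"
    by (rule sum.reindex_bij_witness[of _ prod.swap prod.swap]) auto
  ultimately show ?thesis by simp
qed

lemma sum_symmetrize_off_diagonal:
  fixes f :: "'a \<Rightarrow> 'a \<Rightarrow> real"
  assumes "finite A"
  shows "(\<Sum>i\<in>A. \<Sum>j\<in>A - {i}. f i j) = (\<Sum>i\<in>A. \<Sum>j\<in>A - {i}. (f i j + f j i) / 2)"
  using sum_swap_off_diagonal[OF assms, of f]
  by (simp add: sum.distrib add_divide_distrib flip: sum_divide_distrib)

text \<open>Rotation is a bijection of the triples with distinct entries, so three times the sum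
  equals the sum of the cyclic totals.\<close>

lemma sum_cyclic_distinct_triples:
  fixes f c :: "'a \<Rightarrow> 'a \<Rightarrow> 'a \<Rightarrow> real"
  assumes "finite A"
    and "\<And>i j k. i \<in> A \<Longrightarrow> j \<in> A \<Longrightarrow> k \<in> A \<Longrightarrow> i \<noteq> j \<Longrightarrow> i \<noteq> k \<Longrightarrow> j \<noteq> k \<Longrightarrow>
      f i j k + f j k i + f k i j = c i j k"
  shows "(\<Sum>i\<in>A. \<Sum>j\<in>A - {i}. \<Sum>k\<in>A - {i} - {j}. f i j k) =
         (\<Sum>i\<in>A. \<Sum>j\<in>A - {i}. \<Sum>k\<in>A - {i} - {j}. c i j k / 3)"
proof -
  let ?S = "Sigma A (\<lambda>i. Sigma (A - {i}) (\<lambda>j. A - {i} - {j}))"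
  have S: "(\<Sum>i\<in>A. \<Sum>j\<in>A - {i}. \<Sum>k\<in>A - {i} - {j}. g i j k) = (\<Sum>(i,j,k)\<in>?S. g i j k)"
    for g :: "'a \<Rightarrow> 'a \<Rightarrow> 'a \<Rightarrow> real"
    using assms(1) by (simp add: sum.Sigma)
  have 1: "(\<Sum>(i,j,k)\<in>?S. f i j k) = (\<Sum>(i,j,k)\<in>?S. f j k i)"
    by (rule sum.reindex_bij_witness[of _ "\<lambda>(i,j,k). (j,k,i)" "\<lambda>(i,j,k). (k,i,j)"]) auto
  have 2: "(\<Sum>(i,j,k)\<in>?S. f i j k) = (\<Sum>(i,j,k)\<in>?S. f k i j)"
    by (rule sum.reindex_bij_witness[of _ "\<lambda>(i,j,k). (k,i,j)" "\<lambda>(i,j,k). (j,k,i)"]) auto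
  have "3 * (\<Sum>(i,j,k)\<in>?S. f i j k) = (\<Sum>(i,j,k)\<in>?S. f i j k + f j k i + f k i j)"
    using 1 2 by (simp add: sum.distrib case_prod_unfold)
  also have "\<dots> = (\<Sum>(i,j,k)\<in>?S. c i j k)"
    using assms(2) by (intro sum.cong) auto
  finally show ?thesis unfolding S by (simp add: case_prod_unfold flip: sum_divide_distrib)
qed

lemma sum_ixs_off_diagonal:
  fixes f :: "ix \<Rightarrow> ix \<Rightarrow> real"
  assumes sym: "\<And>i j. f i j = f j i"
  shows "(\<Sum>i\<in>ixs n m. \<Sum>j\<in>ixs n m - {i}. f i j) =
    (\<Sum>j<n. \<Sum>i<j. 2 * f (Inl i) (Inl j)) + (\<Sum>j<m. \<Sum>i<j. 2 * f (Inr i) (Inr j))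
       + (\<Sum>i<n. \<Sum>j<m. 2 * f (Inl i) (Inr j))"
proof -
  have tri: "(\<Sum>i<n. \<Sum>j<n. g i j) - (\<Sum>i<n. g i i) = 2 * (\<Sum>j<n. \<Sum>i<j. g i j)"
    if "\<And>i j. g i j = g j i" for g :: "nat \<Rightarrow> nat \<Rightarrow> real" and n
  proof (induction n)
    case (Suc n)
    have "(\<Sum>i<n. g n i) = (\<Sum>i<n. g i n)" using that by simp
    with Suc show ?case by (simp add: sum.distrib)
  qed simp
  have "(\<Sum>i\<in>ixs n m. \<Sum>j\<in>ixs n m - {i}. f i j) =
    (\<Sum>i\<in>ixs n m. \<Sum>j\<in>ixs n m. f i j) - (\<Sum>i\<in>ixs n m. f i i)"
    by (simp add: sum_diff1 flip: sum_subtractf)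
  also have "\<dots> = ((\<Sum>i<n. \<Sum>j<n. f (Inl i) (Inl j)) - (\<Sum>i<n. f (Inl i) (Inl i)))
    + ((\<Sum>i<m. \<Sum>j<m. f (Inr i) (Inr j)) - (\<Sum>i<m. f (Inr i) (Inr i)))
    + (\<Sum>i<n. \<Sum>j<m. f (Inl i) (Inr j)) + (\<Sum>j<m. \<Sum>i<n. f (Inr j) (Inl i))"
    by (simp add: sum_ixs sum.distrib)
  also have "(\<Sum>j<m. \<Sum>i<n. f (Inr j) (Inl i)) = (\<Sum>i<n. \<Sum>j<m. f (Inl i) (Inr j))"
    by (subst sum.swap) (simp add: sym[of "Inl _"])
  finally show ?thesis
    using tri[of "\<lambda>i j. f (Inl i) (Inl j)" n] tri[of "\<lambda>i j. f (Inr i) (Inr j)" m] sym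
    by (simp flip: sum_distrib_left)
qed

section \<open>Weights as linear functionals, and sums over the roots\<close>

definition unit_wt :: "ix \<Rightarrow> ix \<Rightarrow> real" where
  "unit_wt I = (\<lambda>c. if c = I then 1 else 0)"

lemma unit_wt_apply: "unit_wt I c = (if c = I then 1 else 0)"
  by (simp add: unit_wt_def)

lemma lin_unit_wt [simp]: "finite D \<Longrightarrow> I \<in> D \<Longrightarrow> lin D (unit_wt I) z = z I"
  by (simp add: lin_def unit_wt_def if_distrib[where f = "\<lambda>x. x * _"] cong: if_cong)

lemma lin_add [simp]: "lin D (\<alpha> + \<beta>) z = lin D \<alpha> z + lin D \<beta> z"
  by (simp add: lin_def distrib_right sum.distrib)

lemma lin_double [simp]: "lin D (2 * \<alpha>) z = 2 * lin D \<alpha> z"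
  by (simp only: mult_2 lin_add)

lemma lin_minus [simp]: "lin D (- \<alpha>) z = - lin D \<alpha> z" "lin D (\<lambda>c. - \<alpha> c) z = - lin D \<alpha> z"
  by (simp_all add: lin_def sum_negf)

lemma lin_diff [simp]: "lin D (\<alpha> - \<beta>) z = lin D \<alpha> z - lin D \<beta> z"
  by (simp add: lin_def left_diff_distrib sum_subtractf)

lemma lin_0 [simp]: "lin D 0 z = 0"
  by (simp add: lin_def)

text \<open>The nonvanishing condition of \<open>regular_set\<close> without the support condition,
  so that it also covers the vector \<open>h\<close> that defines a set of positive roots.\<close>

definition regular_pt :: "sym_pair \<Rightarrow> (ix \<Rightarrow> real) \<Rightarrow> bool" where
  "regular_pt X h \<longleftrightarrow> (\<forall>\<alpha>\<in>restricted_roots X. lin (coords X) \<alpha> h \<noteq> 0)"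

text \<open>
  A restricted root system of type \<open>A\<close> (\<open>\<theta> = 0\<close>) or \<open>BC\<close> (\<open>\<theta> = 1\<close>) in which the squared norm of
  \<open>unit_wt I\<close> is \<open>1 / w I\<close>, its multiplicity is \<open>U I\<close> and that of its double is \<open>V I\<close>; the
  multiplicity of \<open>unit_wt I \<plusminus> unit_wt J\<close> is \<open>- 2 k (w I) (w J)\<close>.
\<close>

locale root_data =
  fixes X :: sym_pair and k :: real and w :: "ix \<Rightarrow> real" and \<theta> :: real and U V :: "ix \<Rightarrow> real"
  assumes finite_coords: "finite (coords X)" and finite_roots: "finite (restricted_roots X)"
    and w_nz: "\<And>I. w I \<noteq> 0" and k_nz: "k \<noteq> 0" and \<theta>_nonneg: "0 \<le> \<theta>"
    and sum_roots: "\<And>F F'. F 0 = 0 \<Longrightarrow> (\<And>\<alpha>. F' \<alpha> = F \<alpha> + F (- \<alpha>)) \<Longrightarrow>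
       (\<Sum>\<alpha>\<in>restricted_roots X. root_mult X \<alpha> * F \<alpha>) =
       (\<Sum>I\<in>coords X. U I * F' (unit_wt I) + V I * F' (unit_wt I + unit_wt I))
       - k * (\<Sum>I\<in>coords X. \<Sum>J\<in>coords X - {I}. w I * w J *
           (F' (unit_wt I - unit_wt J) + \<theta> * F' (unit_wt I + unit_wt J)))"
begin

abbreviation "D \<equiv> coords X"

lemma sum_off_diagonal_at:
  fixes f :: "ix \<Rightarrow> ix \<Rightarrow> real"
  assumes "c \<in> D" "\<And>I J. I \<in> D \<Longrightarrow> J \<in> D \<Longrightarrow> I \<noteq> c \<Longrightarrow> J \<noteq> c \<Longrightarrow> f I J = 0"
  shows "(\<Sum>I\<in>D. \<Sum>J\<in>D - {I}. f I J) = (\<Sum>J\<in>D - {c}. f c J + f J c)"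
proof -
  have "(\<Sum>J\<in>D - {I}. f I J) = f I c" if "I \<in> D - {c}" for I
  proof -
    have "(\<Sum>J\<in>D - {I}. f I J) = (\<Sum>J\<in>{c}. f I J)"
      using that assms finite_coords by (intro sum.mono_neutral_right) auto
    then show ?thesis by simp
  qed
  then show ?thesis
    by (simp add: sum.remove[OF finite_coords assms(1)] sum.distrib)
qed

text \<open>A function supported on functionals that vanish at a regular point is zero on every
  root, so its sum over the roots is zero. Applied to half of it, \<open>sum_roots\<close> turns
  this into a relation between multiplicities, from which roots are detected.\<close>

lemma sum_roots_regular:
  assumes h: "regular_pt X h" and F: "\<And>\<alpha>. lin D \<alpha> h \<noteq> 0 \<Longrightarrow> F \<alpha> = 0" "F 0 = 0" "\<And>\<alpha>. F (- \<alpha>) = F \<alpha>"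
  shows "(\<Sum>I\<in>D. U I * F (unit_wt I) + V I * F (unit_wt I + unit_wt I)) =
     k * (\<Sum>I\<in>D. \<Sum>J\<in>D - {I}. w I * w J *
           (F (unit_wt I - unit_wt J) + \<theta> * F (unit_wt I + unit_wt J)))"
proof -
  have "(\<Sum>\<alpha>\<in>restricted_roots X. root_mult X \<alpha> * (F \<alpha> / 2)) = 0"
    using h F(1) by (intro sum.neutral) (auto simp: regular_pt_def)
  then show ?thesis
    by (subst (asm) sum_roots[where F' = F]) (simp_all add: F)
qed

text \<open>
  Positivity of the test function \<open>\<alpha> \<mapsto> (\<alpha> I)\<^sup>2 (\<alpha> J)\<^sup>2\<close> shows that the roots
  \<open>unit_wt I \<plusminus> unit_wt J\<close> really occur.
\<close>

lemma regular_pair: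
  assumes h: "regular_pt X h" and IJ: "I \<in> D" "J \<in> D" "I \<noteq> J"
  shows "h I \<noteq> h J" "\<theta> \<noteq> 0 \<Longrightarrow> h I + h J \<noteq> 0"
proof -
  define F where "F \<alpha> = (if lin D \<alpha> h = 0 then (\<alpha> I)\<^sup>2 * (\<alpha> J)\<^sup>2 else 0)" for \<alpha>
  define f where "f K L = w K * w L * (F (unit_wt K - unit_wt L) + \<theta> * F (unit_wt K + unit_wt L))" for K L
  have F0: "F \<alpha> = 0" if "\<alpha> I = 0 \<or> \<alpha> J = 0" for \<alpha>
    using that by (auto simp: F_def)
  have Fv: "F (unit_wt I - unit_wt J) = (if h I = h J then 1 else 0)"
    "F (unit_wt J - unit_wt I) = (if h I = h J then 1 else 0)"
    "F (unit_wt I + unit_wt J) = (if h I + h J = 0 then 1 else 0)"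
    "F (unit_wt J + unit_wt I) = (if h I + h J = 0 then 1 else 0)"
    using IJ finite_coords by (auto simp: F_def unit_wt_apply add.commute)
  have single: "F (unit_wt K) = 0" "F (unit_wt K + unit_wt K) = 0" for K
    by (rule F0, use IJ in \<open>auto simp: unit_wt_apply\<close>)+
  have "(\<Sum>K\<in>D. U K * F (unit_wt K) + V K * F (unit_wt K + unit_wt K)) = k * (\<Sum>K\<in>D. \<Sum>L\<in>D - {K}. f K L)"
    unfolding f_def by (rule sum_roots_regular[OF h]) (auto simp: F_def)
  then have "(\<Sum>K\<in>D. \<Sum>L\<in>D - {K}. f K L) = 0"
    using k_nz unfolding single by simp
  also have "(\<Sum>K\<in>D. \<Sum>L\<in>D - {K}. f K L) = (\<Sum>L\<in>D - {I}. f I L + f L I)"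
    using IJ by (intro sum_off_diagonal_at) (simp_all add: f_def F0 unit_wt_apply)
  also have "\<dots> = (\<Sum>L\<in>{J}. f I L + f L I)"
    using IJ finite_coords by (intro sum.mono_neutral_right) (auto simp: f_def F0 unit_wt_apply)
  also have "\<dots> = 2 * (w I * w J) * ((if h I = h J then 1 else 0) + \<theta> * (if h I + h J = 0 then 1 else 0))"
    unfolding f_def sum.insert_remove[OF finite.emptyI] using Fv by (simp add: algebra_simps)
  finally have "(if h I = h J then 1 else 0) + \<theta> * (if h I + h J = 0 then 1 else 0) = 0"
    using w_nz by simp
  \<comment> \<open>Since \<open>\<theta>\<close> is nonnegative, the two terms cannot cancel each
    other.\<close>
  then show "h I \<noteq> h J" "\<theta> \<noteq> 0 \<Longrightarrow> h I + h J \<noteq> 0"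
    using \<theta>_nonneg by (auto split: if_splits)
qed

lemma regular_diff:
  "regular_pt X h \<Longrightarrow> I \<in> D \<Longrightarrow> J \<in> D \<Longrightarrow> I \<noteq> J \<Longrightarrow> h I \<noteq> h J"
  by (rule regular_pair)

lemma regular_add:
  "regular_pt X h \<Longrightarrow> I \<in> D \<Longrightarrow> J \<in> D \<Longrightarrow> I \<noteq> J \<Longrightarrow> \<theta> \<noteq> 0 \<Longrightarrow> h I + h J \<noteq> 0"
  by (rule regular_pair)

text \<open>If \<open>h I = 0\<close>, then \<open>unit_wt I\<close> and its double vanish at
  \<open>h\<close>, while by \<open>regular_pair\<close> no pair functional with nonzero coefficient
  does. Testing with \<open>(\<alpha> I) ^ n\<close> for n = 2 and n = 4 gives
  \<open>U I + 4 * V I = 0\<close> and \<open>U I + 16 * V I = 0\<close>. Two exponents are used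
  because \<open>U I\<close> and \<open>V I\<close> can have opposite signs.\<close>

lemma regular_unit:
  assumes h: "regular_pt X h" and I: "I \<in> D" and UV: "U I \<noteq> 0 \<or> V I \<noteq> 0"
  shows "h I \<noteq> 0"
proof
  assume h0: "h I = 0"
  have *: "U I + V I * 2 ^ n = 0" if n: "even n" "n > 0" for n
  proof -
    define F where "F \<alpha> = (if lin D \<alpha> h = 0 then (\<alpha> I) ^ n else 0)" for \<alpha>
    have "(\<Sum>K\<in>D. U K * F (unit_wt K) + V K * F (unit_wt K + unit_wt K)) =
      k * (\<Sum>K\<in>D. \<Sum>L\<in>D - {K}. w K * w L * (F (unit_wt K - unit_wt L) + \<theta> * F (unit_wt K + unit_wt L)))"
      by (rule sum_roots_regular[OF h]) (use n in \<open>auto simp: F_def\<close>)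
    also have "(\<Sum>K\<in>D. \<Sum>L\<in>D - {K}. w K * w L * (F (unit_wt K - unit_wt L) + \<theta> * F (unit_wt K + unit_wt L))) = 0"
      using regular_diff[OF h] regular_add[OF h] finite_coords
      by (intro sum.neutral ballI) (auto simp: F_def)
    also have "(\<Sum>K\<in>D. U K * F (unit_wt K) + V K * F (unit_wt K + unit_wt K)) =
        (\<Sum>K\<in>{I}. U K * F (unit_wt K) + V K * F (unit_wt K + unit_wt K))"
      using I finite_coords n by (intro sum.mono_neutral_right) (auto simp: F_def unit_wt_apply zero_power)
    finally show ?thesis
      using I finite_coords h0 by (simp add: F_def unit_wt_apply)
  qed
  show False using *[of 2] *[of 4] UV by simp
qed

text \<open>The restriction \<open>G\<close> of \<open>F\<close> to the positive side of
  \<open>h\<close> satisfies \<open>G \<alpha> + G (- \<alpha>) = F \<alpha>\<close> wherever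
  \<open>\<alpha>\<close> does not vanish at \<open>h\<close>. Hence \<open>sum_roots\<close> for
  \<open>G\<close> shows the values of \<open>F\<close> on its right-hand side.\<close>

lemma sum_positive_roots:
  assumes P: "positive_roots X P" and F: "F 0 = 0" "\<And>\<alpha>. F (- \<alpha>) = F \<alpha>"
  shows "(\<Sum>\<alpha>\<in>P. root_mult X \<alpha> * F \<alpha>) =
     (\<Sum>I\<in>D. U I * F (unit_wt I) + V I * F (unit_wt I + unit_wt I))
     - k * (\<Sum>I\<in>D. \<Sum>J\<in>D - {I}. w I * w J *
           (F (unit_wt I - unit_wt J) + \<theta> * F (unit_wt I + unit_wt J)))"
proof -
  obtain h where h: "regular_pt X h" and Ph: "P = {\<alpha> \<in> restricted_roots X. 0 < lin D \<alpha> h}"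
    using P by (auto simp: positive_roots_def app_lin regular_pt_def)
  define G where "G \<alpha> = (if 0 < lin D \<alpha> h then F \<alpha> else 0)" for \<alpha>
  have F': "G \<alpha> + G (- \<alpha>) = F \<alpha>" if "lin D \<alpha> h \<noteq> 0" for \<alpha>
    using that F by (auto simp: G_def)
  have "(\<Sum>\<alpha>\<in>P. root_mult X \<alpha> * F \<alpha>) = (\<Sum>\<alpha>\<in>restricted_roots X. root_mult X \<alpha> * G \<alpha>)"
    unfolding Ph sum.inter_filter[OF finite_roots]
    by (rule sum.cong) (auto simp: G_def)
  also have "\<dots> = (\<Sum>I\<in>D. U I * F (unit_wt I) + V I * F (unit_wt I + unit_wt I))
     - k * (\<Sum>I\<in>D. \<Sum>J\<in>D - {I}. w I * w J *
           (F (unit_wt I - unit_wt J) + \<theta> * F (unit_wt I + unit_wt J)))"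
  proof (subst sum_roots[OF _ refl], goal_cases)
    case 1
    show ?case by (simp add: G_def)
  next
    case 2
    have 1: "U I * (G (unit_wt I) + G (- unit_wt I)) = U I * F (unit_wt I)"
      "V I * (G (unit_wt I + unit_wt I) + G (- (unit_wt I + unit_wt I))) = V I * F (unit_wt I + unit_wt I)"
      if "I \<in> D" for I
    proof -
      \<comment> \<open>A functional with coefficient zero need not be a root and may vanish at
        \<open>h\<close>; its term is then zero on both sides.\<close>
      have "U I = 0 \<or> lin D (unit_wt I) h \<noteq> 0" "V I = 0 \<or> lin D (unit_wt I + unit_wt I) h \<noteq> 0"
        using regular_unit[OF h that] that finite_coords by auto
      then show "U I * (G (unit_wt I) + G (- unit_wt I)) = U I * F (unit_wt I)"
        "V I * (G (unit_wt I + unit_wt I) + G (- (unit_wt I + unit_wt I))) = V I * F (unit_wt I + unit_wt I)"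
        by (metis (no_types, lifting) F' mult_zero_left)+
    qed
    have 2: "G (unit_wt I - unit_wt J) + G (- (unit_wt I - unit_wt J)) = F (unit_wt I - unit_wt J)"
      "\<theta> * (G (unit_wt I + unit_wt J) + G (- (unit_wt I + unit_wt J))) = \<theta> * F (unit_wt I + unit_wt J)"
      if "I \<in> D" "J \<in> D - {I}" for I J
    proof -
      show "G (unit_wt I - unit_wt J) + G (- (unit_wt I - unit_wt J)) = F (unit_wt I - unit_wt J)"
        using that finite_coords regular_diff[OF h, of I J] by (intro F') auto
      have "\<theta> = 0 \<or> lin D (unit_wt I + unit_wt J) h \<noteq> 0"
        using that finite_coords regular_add[OF h, of I J] by auto
      then show "\<theta> * (G (unit_wt I + unit_wt J) + G (- (unit_wt I + unit_wt J))) = \<theta> * F (unit_wt I + unit_wt J)"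
        by (metis (no_types, lifting) F' mult_zero_left)
    qed
    show ?case
      by (intro arg_cong2[where f = "(-)"] arg_cong2[where f = "(*)"] sum.cong refl) (simp_all only: 1 2)
  qed
  finally show ?thesis .
qed

section \<open>The potential as a sum of one-, two- and three-body terms\<close>

definition pair_coth :: "(ix \<Rightarrow> real) \<Rightarrow> ix \<Rightarrow> ix \<Rightarrow> real" where
  "pair_coth z I J = coth (z I - z J) + \<theta> * coth (z I + z J)"

definition pair_csch2 :: "(ix \<Rightarrow> real) \<Rightarrow> ix \<Rightarrow> ix \<Rightarrow> real" where
  "pair_csch2 z I J = 1 / (sinh (z I - z J))\<^sup>2 + \<theta> * (1 / (sinh (z I + z J))\<^sup>2)"

lemma pair_csch2_commute: "pair_csch2 z I J = pair_csch2 z J I"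
proof -
  have "(sinh (z I - z J))\<^sup>2 = (sinh (z J - z I))\<^sup>2"
    using sinh_minus[of "z I - z J"] by simp
  then show ?thesis by (simp add: pair_csch2_def add.commute)
qed

text \<open>The function \<open>\<alpha> c * coth (lin D \<alpha> z)\<close> of
  \<open>\<alpha>\<close> is even as a product of two odd ones, so \<open>sum_positive_roots\<close>
  applies and the result no longer depends on \<open>P\<close>. Each pair containing
  \<open>c\<close> is met in both orders, which absorbs the factor 1/2.\<close>

lemma log_weyl_pd_eq:
  assumes P: "positive_roots X P" and c: "c \<in> D"
  shows "log_weyl_pd D P (root_mult X) c z =
     U c / 2 * coth (z c) + V c * coth (2 * z c) - k * w c * (\<Sum>J\<in>D - {c}. w J * pair_coth z c J)"
proof -
  let ?F = "\<lambda>\<alpha>. \<alpha> c * coth (lin D \<alpha> z)"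
  have "2 * log_weyl_pd D P (root_mult X) c z = (\<Sum>\<alpha>\<in>P. root_mult X \<alpha> * ?F \<alpha>)"
    by (simp add: log_weyl_pd_def sum_distrib_left)
  also have "\<dots> = (\<Sum>I\<in>D. U I * ?F (unit_wt I) + V I * ?F (unit_wt I + unit_wt I))
     - k * (\<Sum>I\<in>D. \<Sum>J\<in>D - {I}. w I * w J *
           (?F (unit_wt I - unit_wt J) + \<theta> * ?F (unit_wt I + unit_wt J)))"
    by (rule sum_positive_roots[OF P]) auto
  also have "(\<Sum>I\<in>D. U I * ?F (unit_wt I) + V I * ?F (unit_wt I + unit_wt I)) =
      (\<Sum>I\<in>{c}. U I * ?F (unit_wt I) + V I * ?F (unit_wt I + unit_wt I))"
    using c finite_coords by (intro sum.mono_neutral_right) (auto simp: unit_wt_def)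
  also have "\<dots> = U c * coth (z c) + V c * (2 * coth (2 * z c))"
    using c finite_coords by (simp add: unit_wt_apply)
  also have "(\<Sum>I\<in>D. \<Sum>J\<in>D - {I}. w I * w J *
           (?F (unit_wt I - unit_wt J) + \<theta> * ?F (unit_wt I + unit_wt J))) =
      (\<Sum>J\<in>D - {c}. 2 * (w c * (w J * pair_coth z c J)))"
  proof (subst sum_off_diagonal_at[OF c], goal_cases)
    case 2
    have "coth (z J - z c) = - coth (z c - z J)" for J
      using coth_minus[of "z c - z J"] by simp
    then show ?case
      using c finite_coords
      by (intro sum.cong refl) (auto simp: unit_wt_apply pair_coth_def add.commute algebra_simps)
  qed (auto simp: unit_wt_def)
  also have "(\<Sum>J\<in>D - {c}. 2 * (w c * (w J * pair_coth z c J))) = 2 * (w c * (\<Sum>J\<in>D - {c}. w J * pair_coth z c J))"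
    by (simp only: sum_distrib_left)
  finally show ?thesis by (simp add: algebra_simps)
qed

lemma sum_csch2_eq:
  assumes P: "positive_roots X P" and c: "c \<in> D"
  shows "(\<Sum>\<alpha>\<in>P. root_mult X \<alpha> / 2 * ((\<alpha> c)\<^sup>2 / (sinh (lin D \<alpha> z))\<^sup>2)) =
     U c / 2 * (1 / (sinh (z c))\<^sup>2) + 2 * V c * (1 / (sinh (2 * z c))\<^sup>2)
      - k * w c * (\<Sum>J\<in>D - {c}. w J * pair_csch2 z c J)"
proof -
  have half: "2 * l = u * a + v * (4 * b) - k * (2 * (x * s)) \<Longrightarrow> l = u / 2 * a + 2 * v * b - k * x * s"
    for l u a v b x s :: real by (simp add: algebra_simps)
  let ?F = "\<lambda>\<alpha>. (\<alpha> c)\<^sup>2 * (1 / (sinh (lin D \<alpha> z))\<^sup>2)"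
  have "2 * (\<Sum>\<alpha>\<in>P. root_mult X \<alpha> / 2 * ((\<alpha> c)\<^sup>2 / (sinh (lin D \<alpha> z))\<^sup>2)) = (\<Sum>\<alpha>\<in>P. root_mult X \<alpha> * ?F \<alpha>)"
    by (simp add: sum_distrib_left)
  also have "\<dots> = (\<Sum>I\<in>D. U I * ?F (unit_wt I) + V I * ?F (unit_wt I + unit_wt I))
     - k * (\<Sum>I\<in>D. \<Sum>J\<in>D - {I}. w I * w J *
           (?F (unit_wt I - unit_wt J) + \<theta> * ?F (unit_wt I + unit_wt J)))"
    by (rule sum_positive_roots[OF P]) auto
  also have "(\<Sum>I\<in>D. U I * ?F (unit_wt I) + V I * ?F (unit_wt I + unit_wt I)) =
      (\<Sum>I\<in>{c}. U I * ?F (unit_wt I) + V I * ?F (unit_wt I + unit_wt I))"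
    using c finite_coords by (intro sum.mono_neutral_right) (auto simp: unit_wt_def)
  also have "\<dots> = U c * (1 / (sinh (z c))\<^sup>2) + V c * (4 * (1 / (sinh (2 * z c))\<^sup>2))"
    using c finite_coords by (simp add: unit_wt_apply)
  also have "(\<Sum>I\<in>D. \<Sum>J\<in>D - {I}. w I * w J *
           (?F (unit_wt I - unit_wt J) + \<theta> * ?F (unit_wt I + unit_wt J))) =
      (\<Sum>J\<in>D - {c}. 2 * (w c * (w J * pair_csch2 z c J)))"
  proof (subst sum_off_diagonal_at[OF c], goal_cases)
    case 2
    have "(sinh (z J - z c))\<^sup>2 = (sinh (z c - z J))\<^sup>2" for J
      using sinh_minus[of "z c - z J"] by simp
    then show ?case
      using c finite_coords
      by (intro sum.cong refl) (auto simp: unit_wt_apply pair_csch2_def add.commute algebra_simps)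
  qed (auto simp: unit_wt_def)
  also have "(\<Sum>J\<in>D - {c}. 2 * (w c * (w J * pair_csch2 z c J))) = 2 * (w c * (\<Sum>J\<in>D - {c}. w J * pair_csch2 z c J))"
    by (simp only: sum_distrib_left)
  finally show ?thesis
    by (rule half)
qed

text \<open>The square of the expression in \<open>log_weyl_pd_eq\<close> is expanded. As
  \<open>g c * w c = 1\<close>, one of its two factors \<open>w c\<close> cancels, which leaves the
  coefficient \<open>w I * w J * w K\<close> in the three-body terms: it is invariant under cyclic
  permutations, as the cyclic identity requires.\<close>

lemma potential_expand:
  assumes P: "positive_roots X P" and g: "\<And>c. c \<in> D \<Longrightarrow> g c = 1 / w c"
  defines "a z c \<equiv> U c / 2 * coth (z c) + V c * coth (2 * z c)"
  shows "(\<Sum>c\<in>D. g c * ((log_weyl_pd D P (root_mult X) c z)\<^sup>2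
        - (\<Sum>\<alpha>\<in>P. root_mult X \<alpha> / 2 * ((\<alpha> c)\<^sup>2 / (sinh (lin D \<alpha> z))\<^sup>2)))) =
     (\<Sum>I\<in>D. g I * ((a z I)\<^sup>2 - U I / 2 * (1 / (sinh (z I))\<^sup>2) - 2 * V I * (1 / (sinh (2 * z I))\<^sup>2)))
   + (\<Sum>I\<in>D. \<Sum>J\<in>D - {I}. k\<^sup>2 * w I * (w J)\<^sup>2 * (pair_coth z I J)\<^sup>2 + k * w J * pair_csch2 z I J
        - 2 * k * w J * a z I * pair_coth z I J)
   + k\<^sup>2 * (\<Sum>I\<in>D. \<Sum>J\<in>D - {I}. \<Sum>K\<in>D - {I} - {J}. w I * w J * w K * (pair_coth z I J * pair_coth z I K))"
proof -
  have "g c * ((log_weyl_pd D P (root_mult X) c z)\<^sup>2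
        - (\<Sum>\<alpha>\<in>P. root_mult X \<alpha> / 2 * ((\<alpha> c)\<^sup>2 / (sinh (lin D \<alpha> z))\<^sup>2))) =
     g c * ((a z c)\<^sup>2 - U c / 2 * (1 / (sinh (z c))\<^sup>2) - 2 * V c * (1 / (sinh (2 * z c))\<^sup>2))
   + (\<Sum>J\<in>D - {c}. k\<^sup>2 * w c * (w J)\<^sup>2 * (pair_coth z c J)\<^sup>2 + k * w J * pair_csch2 z c J
        - 2 * k * w J * a z c * pair_coth z c J)
   + k\<^sup>2 * (\<Sum>J\<in>D - {c}. \<Sum>K\<in>D - {c} - {J}. w c * w J * w K * (pair_coth z c J * pair_coth z c K))"
    if c: "c \<in> D" for c
  proof -
    let ?s = "\<Sum>J\<in>D - {c}. w J * pair_coth z c J" and ?q = "\<Sum>J\<in>D - {c}. w J * pair_csch2 z c J"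
    have "?s\<^sup>2 = (\<Sum>J\<in>D - {c}. \<Sum>K\<in>D - {c}. (w J * pair_coth z c J) * (w K * pair_coth z c K))"
      by (simp add: power2_eq_square sum_product)
    also have "\<dots> = (\<Sum>J\<in>D - {c}. (w J)\<^sup>2 * (pair_coth z c J)\<^sup>2
        + (\<Sum>K\<in>D - {c} - {J}. w J * w K * (pair_coth z c J * pair_coth z c K)))"
    proof (intro sum.cong refl)
      fix J assume "J \<in> D - {c}"
      with finite_coords show "(\<Sum>K\<in>D - {c}. (w J * pair_coth z c J) * (w K * pair_coth z c K)) =
        (w J)\<^sup>2 * (pair_coth z c J)\<^sup>2
        + (\<Sum>K\<in>D - {c} - {J}. w J * w K * (pair_coth z c J * pair_coth z c K))"
        by (subst sum.remove[of _ J]) (auto simp: power2_eq_square ac_simps)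
    qed
    finally have s2: "?s\<^sup>2 = (\<Sum>J\<in>D - {c}. (w J)\<^sup>2 * (pair_coth z c J)\<^sup>2)
        + (\<Sum>J\<in>D - {c}. \<Sum>K\<in>D - {c} - {J}. w J * w K * (pair_coth z c J * pair_coth z c K))"
      by (simp add: sum.distrib)
    have gw: "g c * w c = 1" using g[OF c] w_nz by simp
    have "g c * ((a z c - k * w c * ?s)\<^sup>2 - (y - k * w c * ?q)) =
       g c * ((a z c)\<^sup>2 - y) + (k\<^sup>2 * (g c * w c) * w c * ?s\<^sup>2 + k * (g c * w c) * ?q - 2 * k * (g c * w c) * a z c * ?s)"
      for y by (simp add: power2_eq_square algebra_simps)
    then show ?thesis
      unfolding log_weyl_pd_eq[OF P c] sum_csch2_eq[OF P c] a_def[symmetric] gw s2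
      by (simp add: sum.distrib sum_subtractf sum_distrib_left algebra_simps)
  qed
  then show ?thesis
    by (simp add: sum.distrib flip: sum_distrib_left)
qed

end

section \<open>Reduction of the potential\<close>

lemma cosh_double_diff: "cosh (2 * a) - cosh (2 * b) = 2 * sinh (a + b) * sinh (a - b)" for a b :: real
  using cosh_add[of "a + b" "a - b"] cosh_diff[of "a + b" "a - b"] by simp

lemma cosh_double_mult: "(sinh (a + b))\<^sup>2 + (sinh (a - b))\<^sup>2 = cosh (2 * a) * cosh (2 * b) - 1" for a b :: real
  using cosh_add[of "2 * a" "2 * b"] cosh_diff[of "2 * a" "2 * b"]
    cosh_double[of "a + b"] cosh_double[of "a - b"] cosh_square_eq[of "a + b"] cosh_square_eq[of "a - b"]
  by (simp add: algebra_simps)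

context
  fixes a b :: real
  assumes ab: "a \<noteq> b" "a + b \<noteq> 0"
begin

lemma cosh_double_neq: "cosh (2 * a) - cosh (2 * b) \<noteq> 0"
  using ab by (simp add: cosh_double_diff)

text \<open>The denominator involves only \<open>cosh (2 * a)\<close> and
  \<open>cosh (2 * b)\<close>, and the square of the numerator is a polynomial in
  \<open>cosh (2 * a)\<close>. This makes the quadratic terms of type BC rational in the variables
  \<open>cosh (2 * z I)\<close>.\<close>

lemma coth_sum_eq: "coth (a - b) + coth (a + b) = 2 * sinh (2 * a) / (cosh (2 * a) - cosh (2 * b))"
proof -
  have "sinh (2 * a) = sinh (a + b) * cosh (a - b) + cosh (a + b) * sinh (a - b)"
    using sinh_add[of "a + b" "a - b"] by simp
  with ab show ?thesis
    unfolding cosh_double_diff by (simp add: coth_def field_simps)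
qed

lemma csch2_sum_eq:
  "1 / (sinh (a - b))\<^sup>2 + 1 / (sinh (a + b))\<^sup>2 =
     4 * (cosh (2 * a) * cosh (2 * b) - 1) / (cosh (2 * a) - cosh (2 * b))\<^sup>2"
  unfolding cosh_double_diff cosh_double_mult[symmetric]
  using ab by (simp add: field_simps power_mult_distrib)

end

text \<open>This is the addition theorem
  \<open>coth (u + v) * (coth u + coth v) = 1 + coth u * coth v\<close> for \<open>u = a - b\<close>
  and \<open>v = b - c\<close>.\<close>

lemma coth_diff_cyclic:
  assumes "a \<noteq> b" "a \<noteq> c" "b \<noteq> c"
  shows "coth (a - b) * coth (a - c) + coth (b - c) * coth (b - a) + coth (c - a) * coth (c - b) = 1"
proof -
  define u v where "u = a - b" and "v = b - c"
  have nz: "sinh u \<noteq> 0" "sinh v \<noteq> 0" "sinh (u + v) \<noteq> 0" using assms by (auto simp: u_def v_def)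
  have "coth u * coth (u + v) + coth v * coth (- u) + coth (- (u + v)) * coth (- v) = 1"
    using nz cosh_square_eq[of u] cosh_square_eq[of v]
    unfolding coth_minus by (simp add: coth_def field_simps) (simp add: sinh_add cosh_add algebra_simps power2_eq_square)
  moreover have "b - a = - u" "a - c = u + v" "c - a = - (u + v)" "c - b = - v" "a - b = u" "b - c = v"
    by (simp_all add: u_def v_def)
  ultimately show ?thesis by (simp only:)
qed

text \<open>The second divided difference of \<open>t\<^sup>2 - 1\<close> at three nodes is its
  leading coefficient.\<close>

lemma lagrange_cyclic:
  fixes x y z :: real
  assumes "x \<noteq> y" "x \<noteq> z" "y \<noteq> z"
  shows "(x\<^sup>2 - 1) / ((x - y) * (x - z)) + (y\<^sup>2 - 1) / ((y - z) * (y - x)) + (z\<^sup>2 - 1) / ((z - x) * (z - y)) = 1"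
  using assms by (simp add: divide_simps) (simp add: algebra_simps power2_eq_square)

text \<open>The two-body terms, written in \<open>x = cosh (2 a)\<close> and \<open>y = cosh (2 b)\<close>.\<close>

lemma pair_same_type:
  fixes x y k w v :: real
  assumes "x - y \<noteq> 0"
  shows "k\<^sup>2 * w^3 * (4 * (x\<^sup>2 - 1) / (x - y)\<^sup>2) + k\<^sup>2 * w^3 * (4 * (y\<^sup>2 - 1) / (y - x)\<^sup>2)
     + 2 * (k * w * (4 * (x * y - 1) / (x - y)\<^sup>2))
     - 2 * k * w * (v * (2 * x) / (x - y)) - 2 * k * w * (v * (2 * y) / (y - x))
     = k * (w + w) * (k * (w * w) + 1) * (4 * (x * y - 1) / (x - y)\<^sup>2) + (4 * k\<^sup>2 * w^3 - 4 * k * w * v)"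
proof -
  have yx: "(y - x)\<^sup>2 = (x - y)\<^sup>2" "y - x = - (x - y)" by (simp_all add: power2_commute)
  have "(x - y)\<^sup>2 \<noteq> 0" using assms by simp
  then show ?thesis using assms unfolding yx
    by (simp add: divide_simps) (simp add: algebra_simps power2_eq_square power3_eq_cube)
qed

text \<open>The values are \<open>w = 1\<close>, \<open>V = - 2 * q\<close> at \<open>x\<close> and
  \<open>w = 1 / k\<close>, \<open>V = - 2 * s\<close> at \<open>y\<close>. After subtraction of the
  term on the right, the double poles combine to \<open>4 * (x - k * y) / (x - y)\<close>. Together
  with the simple poles the numerator is \<open>4 * ((2 * q + 1) * x - k * (2 * s + 1) * y)\<close>,
  which the relation between \<open>q\<close> and \<open>s\<close> makes a multiple of
  \<open>x - y\<close>.\<close>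

lemma pair_mixed_type:
  fixes x y k q s :: real
  assumes "x - y \<noteq> 0" "k \<noteq> 0" "2 * q + 1 = k * (2 * s + 1)"
  shows "4 * (x\<^sup>2 - 1) / (x - y)\<^sup>2 + k * (4 * (y\<^sup>2 - 1) / (y - x)\<^sup>2)
     + (1 + k) * (4 * (x * y - 1) / (x - y)\<^sup>2)
     - 2 * (- 2 * q * (2 * x) / (x - y)) - 2 * k * (- 2 * s * (2 * y) / (y - x))
     = 2 * (k + 1) * (4 * (x * y - 1) / (x - y)\<^sup>2) + (4 * k + 8 * k * s)"
proof -
  have yx: "(y - x)\<^sup>2 = (x - y)\<^sup>2" "y - x = - (x - y)" by (simp_all add: power2_commute)
  have q: "q = (k * (2 * s + 1) - 1) / 2" using assms(3) by simp
  have "(x - y)\<^sup>2 \<noteq> 0" using assms by simp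
  then show ?thesis using assms(1) unfolding yx q
    by (simp add: divide_simps) (simp add: algebra_simps power2_eq_square)
qed

lemma single_term:
  fixes p q t :: real
  assumes "p = 0 \<and> q = 0 \<or> t \<noteq> 0"
  shows "(- p * coth t - 2 * q * coth (2 * t))\<^sup>2 + p * (1 / (sinh t)\<^sup>2) + 4 * q * (1 / (sinh (2 * t))\<^sup>2)
    = p * (p + 2 * q + 1) / (sinh t)\<^sup>2 + 4 * q * (q + 1) / (sinh (2 * t))\<^sup>2 + (p + 2 * q)\<^sup>2"
proof (cases "t = 0")
  case True
  with assms show ?thesis by simp
next
  case False
  have "coth t * coth (2 * t) = 1 + 1 / (2 * (sinh t)\<^sup>2)"
    using False
    by (simp add: coth_def cosh_double sinh_double cosh_square_eq) (simp add: field_simps power2_eq_square)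
  moreover have "(- p * coth t - 2 * q * coth (2 * t))\<^sup>2 =
      p\<^sup>2 * (coth t)\<^sup>2 + 4 * q\<^sup>2 * (coth (2 * t))\<^sup>2 + 4 * p * q * (coth t * coth (2 * t))"
    by (simp add: power2_eq_square algebra_simps)
  ultimately show ?thesis
    using False by (simp add: coth_squared) (simp add: field_simps power2_eq_square)
qed

section \<open>The potentials of types A and BC\<close>

context root_data
begin

lemma regular_set_regular_pt: "z \<in> regular_set X \<Longrightarrow> regular_pt X z"
  by (auto simp: regular_set_def regular_pt_def app_lin)

lemma pair_coth_eq:
  assumes "\<theta> = 1" "regular_pt X z" "I \<in> D" "J \<in> D" "I \<noteq> J"
  shows "pair_coth z I J = 2 * sinh (2 * z I) / (cosh (2 * z I) - cosh (2 * z J))"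
  using coth_sum_eq[of "z I" "z J"] regular_diff[OF assms(2-5)] regular_add[OF assms(2-5)]
  unfolding pair_coth_def unfolding assms(1) by simp

lemma triple_A:
  assumes "\<theta> = 0" "regular_pt X z" "I \<in> D" "J \<in> D" "K \<in> D" "I \<noteq> J" "I \<noteq> K" "J \<noteq> K"
  shows "pair_coth z I J * pair_coth z I K + pair_coth z J K * pair_coth z J I
     + pair_coth z K I * pair_coth z K J = 1"
  using coth_diff_cyclic[of "z I" "z J" "z K"] regular_diff[OF assms(2)] assms(3-)
  unfolding pair_coth_def unfolding assms(1) by simp

text \<open>In terms of \<open>x = cosh (2 * z I)\<close> and its analogues each product has the
  form \<open>4 * (x\<^sup>2 - 1) / ((x - y) * (x - z))\<close>, so \<open>lagrange_cyclic\<close>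
  gives the value 4.\<close>

lemma triple_BC:
  assumes "\<theta> = 1" "regular_pt X z" "I \<in> D" "J \<in> D" "K \<in> D" "I \<noteq> J" "I \<noteq> K" "J \<noteq> K"
  shows "pair_coth z I J * pair_coth z I K + pair_coth z J K * pair_coth z J I
     + pair_coth z K I * pair_coth z K J = 4"
proof -
  have ne: "cosh (2 * z I) \<noteq> cosh (2 * z J)" "cosh (2 * z I) \<noteq> cosh (2 * z K)" "cosh (2 * z J) \<noteq> cosh (2 * z K)"
    using cosh_double_neq[of "z I" "z J"] cosh_double_neq[of "z I" "z K"] cosh_double_neq[of "z J" "z K"]
      regular_diff[OF assms(2)] regular_add[OF assms(2)] assms(1,3-) by auto
  have *: "2 * sinh a / d * (2 * sinh a / e) = 4 * (((cosh a)\<^sup>2 - 1) / (d * e))" for a d e :: real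
    by (simp add: cosh_square_eq) (simp add: power2_eq_square)
  show ?thesis
    using lagrange_cyclic[OF ne] unfolding pair_coth_eq[OF assms(1-4,6)] pair_coth_eq[OF assms(1-3,5,7)]
      pair_coth_eq[OF assms(1,2,4,5,8)] pair_coth_eq[OF assms(1,2,4,3) assms(6)[symmetric]]
      pair_coth_eq[OF assms(1,2,5,3) assms(7)[symmetric]] pair_coth_eq[OF assms(1,2,5,4) assms(8)[symmetric]] *
    by linarith
qed

lemma triple_sum:
  assumes "\<And>I J K. I \<in> D \<Longrightarrow> J \<in> D \<Longrightarrow> K \<in> D \<Longrightarrow> I \<noteq> J \<Longrightarrow> I \<noteq> K \<Longrightarrow> J \<noteq> K \<Longrightarrow>
     pair_coth z I J * pair_coth z I K + pair_coth z J K * pair_coth z J I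
     + pair_coth z K I * pair_coth z K J = c"
  shows "(\<Sum>I\<in>D. \<Sum>J\<in>D - {I}. \<Sum>K\<in>D - {I} - {J}. w I * w J * w K * (pair_coth z I J * pair_coth z I K)) =
    (\<Sum>I\<in>D. \<Sum>J\<in>D - {I}. \<Sum>K\<in>D - {I} - {J}. w I * w J * w K * c / 3)"
proof (rule sum_cyclic_distinct_triples[OF finite_coords])
  fix I J K assume *: "I \<in> D" "J \<in> D" "K \<in> D" "I \<noteq> J" "I \<noteq> K" "J \<noteq> K"
  show "w I * w J * w K * (pair_coth z I J * pair_coth z I K) + w J * w K * w I * (pair_coth z J K * pair_coth z J I)
     + w K * w I * w J * (pair_coth z K I * pair_coth z K J) = w I * w J * w K * c"
    unfolding assms[OF *, symmetric] by (simp add: algebra_simps)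
qed

lemma A_conjugated:
  assumes \<theta>: "\<theta> = 0" and D: "coords X = ixs n m" and k: "k \<noteq> 0"
    and w: "\<And>I. w I = (if isl I then 1 else 1 / k)"
    and g: "\<And>c. c \<in> coords X \<Longrightarrow> dual_norm X c = 1 / w c"
    and UV: "\<And>I. U I = 0" "\<And>I. V I = 0"
  shows "radial_part_conjugated X (deformed_CMS_A n m k)"
proof -
  \<comment> \<open>One coefficient serves all pairs: with \<open>w\<close> equal to 1 on x and to
    \<open>1 / k\<close> on y, its double is \<open>2 * k * (k + 1)\<close>,
    \<open>2 * (1 / k + 1)\<close> or \<open>2 * (k + 1)\<close>, according to the types of the two
    coordinates.\<close>
  let ?Q = "\<lambda>z I J. k * (w I + w J) * (k * (w I * w J) + 1) / 2 * pair_csch2 z I J"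
  define W where "W z = (\<Sum>I\<in>D. \<Sum>J\<in>D - {I}. ?Q z I J)" for z
  show ?thesis
  proof (rule radial_part_conjugatedI[OF finite_coords finite_roots, of _ W])
    fix f z
    have "W z = (\<Sum>j<n. \<Sum>i<j. 2 * k * (k + 1) / (sinh (z (Inl i) - z (Inl j)))\<^sup>2) +
      (\<Sum>j<m. \<Sum>i<j. 2 * (1 / k + 1) / (sinh (z (Inr i) - z (Inr j)))\<^sup>2) +
      (\<Sum>i<n. \<Sum>j<m. 2 * (k + 1) / (sinh (z (Inl i) - z (Inr j)))\<^sup>2)"
    proof -
      have cs: "pair_csch2 z I J = 1 / (sinh (z I - z J))\<^sup>2" for I J
        unfolding pair_csch2_def unfolding \<theta> by simp
      have "2 * ?Q z (Inl i) (Inl j) = 2 * k * (k + 1) / (sinh (z (Inl i) - z (Inl j)))\<^sup>2"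
        "2 * ?Q z (Inr i) (Inr j) = 2 * (1 / k + 1) / (sinh (z (Inr i) - z (Inr j)))\<^sup>2"
        "2 * ?Q z (Inl i) (Inr j) = 2 * (k + 1) / (sinh (z (Inl i) - z (Inr j)))\<^sup>2"
        for i j unfolding cs using k by (simp_all add: w add_divide_distrib algebra_simps)
      note two = this
      have sym: "?Q z I J = ?Q z J I" for I J
        by (simp add: pair_csch2_commute[of z I J] algebra_simps)
      show ?thesis
        unfolding W_def D sum_ixs_off_diagonal[of "?Q z", OF sym] two ..
    qed
    moreover have "(\<Sum>c\<in>coords X. dual_norm X c * pd c (pd c f) z) =
      (\<Sum>i<n. pd (Inl i) (pd (Inl i) f) z) + k * (\<Sum>j<m. pd (Inr j) (pd (Inr j) f) z)"
    proof -
      have "(\<Sum>c\<in>coords X. dual_norm X c * pd c (pd c f) z) = (\<Sum>c\<in>coords X. (1 / w c) * pd c (pd c f) z)"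
        by (intro sum.cong) (simp_all add: g)
      then show ?thesis by (simp add: D sum_ixs w sum_distrib_left mult.commute)
    qed
    ultimately show "deformed_CMS_A n m k f z = - (\<Sum>c\<in>coords X. dual_norm X c * pd c (pd c f) z) + W z * f z"
      by (simp add: deformed_CMS_A_def)
  next
    fix P assume P: "positive_roots X P"
    show "\<exists>C. \<forall>z\<in>regular_set X.
      (\<Sum>c\<in>D. dual_norm X c * ((log_weyl_pd D P (root_mult X) c z)\<^sup>2
        - (\<Sum>\<alpha>\<in>P. root_mult X \<alpha> / 2 * ((\<alpha> c)\<^sup>2 / (sinh (lin D \<alpha> z))\<^sup>2)))) = W z + C"
    proof (intro exI ballI)
      fix z assume "z \<in> regular_set X"
      then have z: "regular_pt X z" by (rule regular_set_regular_pt)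
      have triple: "(\<Sum>I\<in>D. \<Sum>J\<in>D - {I}. \<Sum>K\<in>D - {I} - {J}. w I * w J * w K * (pair_coth z I J * pair_coth z I K)) =
        (\<Sum>I\<in>D. \<Sum>J\<in>D - {I}. \<Sum>K\<in>D - {I} - {J}. w I * w J * w K * 1 / 3)"
        by (rule triple_sum, rule triple_A[OF \<theta> z])
      \<comment> \<open>By \<open>coth\<^sup>2 = 1 + 1 / sinh\<^sup>2\<close> each term is a
        multiple of \<open>pair_csch2\<close> plus a constant. Averaging over the two orders of a
        pair produces the symmetric coefficient of \<open>?Q\<close>.\<close>
      have "(\<Sum>I\<in>D. \<Sum>J\<in>D - {I}. k\<^sup>2 * w I * (w J)\<^sup>2 * (pair_coth z I J)\<^sup>2 + k * w J * pair_csch2 z I J) =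
        (\<Sum>I\<in>D. \<Sum>J\<in>D - {I}. ?Q z I J + k\<^sup>2 * w I * (w J)\<^sup>2)"
      proof (subst (1 2) sum_symmetrize_off_diagonal[OF finite_coords], intro sum.cong refl)
        fix I J assume IJ: "I \<in> D" "J \<in> D - {I}"
        have "(pair_coth z I J)\<^sup>2 = 1 + pair_csch2 z I J" "(pair_coth z J I)\<^sup>2 = 1 + pair_csch2 z J I"
          using regular_diff[OF z, of I J] regular_diff[OF z, of J I] IJ unfolding pair_coth_def pair_csch2_def unfolding \<theta> by (auto simp: coth_squared)
        then show "(k\<^sup>2 * w I * (w J)\<^sup>2 * (pair_coth z I J)\<^sup>2 + k * w J * pair_csch2 z I J
            + (k\<^sup>2 * w J * (w I)\<^sup>2 * (pair_coth z J I)\<^sup>2 + k * w I * pair_csch2 z J I)) / 2 =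
          (?Q z I J + k\<^sup>2 * w I * (w J)\<^sup>2 + (?Q z J I + k\<^sup>2 * w J * (w I)\<^sup>2)) / 2"
          by (simp only: pair_csch2_commute[of z J I]) (simp add: field_simps power2_eq_square)
      qed
      note pair = this
      show "(\<Sum>c\<in>D. dual_norm X c * ((log_weyl_pd D P (root_mult X) c z)\<^sup>2
        - (\<Sum>\<alpha>\<in>P. root_mult X \<alpha> / 2 * ((\<alpha> c)\<^sup>2 / (sinh (lin D \<alpha> z))\<^sup>2)))) = W z +
        ((\<Sum>I\<in>D. \<Sum>J\<in>D - {I}. k\<^sup>2 * w I * (w J)\<^sup>2)
         + k\<^sup>2 * (\<Sum>I\<in>D. \<Sum>J\<in>D - {I}. \<Sum>K\<in>D - {I} - {J}. w I * w J * w K * 1 / 3))"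
      proof (subst potential_expand[OF P], goal_cases)
        case (1 c)
        then show ?case by (rule g)
      next
        case 2
        show ?case
          using pair unfolding triple
          by (simp add: UV W_def sum.distrib)
      qed
    qed
  qed
qed

lemma BC_conjugated:
  assumes \<theta>: "\<theta> = 1" and D: "coords X = ixs n m" and k: "k \<noteq> 0"
    and w: "\<And>I. w I = (if isl I then 1 else 1 / k)"
    and g: "\<And>c. c \<in> coords X \<Longrightarrow> dual_norm X c = 1 / w c"
    and par: "BC_parameters k p q r s"
    and U: "\<And>I. U I = (if isl I then - 2 * p else - 2 * r)"
    and V: "\<And>I. V I = (if isl I then - 2 * q else - 2 * s)"
  shows "radial_part_conjugated X (deformed_CMS_BC n m k p q r s)"
proof -
  let ?Q = "\<lambda>z I J. k * (w I + w J) * (k * (w I * w J) + 1) / 2 * pair_csch2 z I J"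
  define p' where "p' I = (if isl I then p else r)" for I :: ix
  define q' where "q' I = (if isl I then q else s)" for I :: ix
  let ?S = "\<lambda>z I. 1 / w I * (p' I * (p' I + 2 * q' I + 1) / (sinh (z I))\<^sup>2 + 4 * q' I * (q' I + 1) / (sinh (2 * z I))\<^sup>2)"
  define W where "W z = (\<Sum>I\<in>D. ?S z I) + (\<Sum>I\<in>D. \<Sum>J\<in>D - {I}. ?Q z I J)" for z
  have p: "p = k * r" and q: "2 * q + 1 = k * (2 * s + 1)" using par by (simp_all add: BC_parameters_def)
  show ?thesis
  proof (rule radial_part_conjugatedI[OF finite_coords finite_roots, of _ W])
    fix f z
    have "(\<Sum>I\<in>D. \<Sum>J\<in>D - {I}. ?Q z I J) =
      (\<Sum>j<n. \<Sum>i<j. 2 * k * (k + 1) / (sinh (z (Inl i) - z (Inl j)))\<^sup>2 + 2 * k * (k + 1) / (sinh (z (Inl i) + z (Inl j)))\<^sup>2) +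
      (\<Sum>j<m. \<Sum>i<j. 2 * (1 / k + 1) / (sinh (z (Inr i) - z (Inr j)))\<^sup>2 + 2 * (1 / k + 1) / (sinh (z (Inr i) + z (Inr j)))\<^sup>2) +
      (\<Sum>i<n. \<Sum>j<m. 2 * (k + 1) / (sinh (z (Inl i) - z (Inr j)))\<^sup>2 + 2 * (k + 1) / (sinh (z (Inl i) + z (Inr j)))\<^sup>2)"
    proof -
      have "2 * ?Q z (Inl i) (Inl j) = 2 * k * (k + 1) / (sinh (z (Inl i) - z (Inl j)))\<^sup>2 + 2 * k * (k + 1) / (sinh (z (Inl i) + z (Inl j)))\<^sup>2"
        "2 * ?Q z (Inr i) (Inr j) = 2 * (1 / k + 1) / (sinh (z (Inr i) - z (Inr j)))\<^sup>2 + 2 * (1 / k + 1) / (sinh (z (Inr i) + z (Inr j)))\<^sup>2"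
        "2 * ?Q z (Inl i) (Inr j) = 2 * (k + 1) / (sinh (z (Inl i) - z (Inr j)))\<^sup>2 + 2 * (k + 1) / (sinh (z (Inl i) + z (Inr j)))\<^sup>2"
        for i j unfolding pair_csch2_def unfolding \<theta> using k by (simp_all add: w add_divide_distrib algebra_simps)
      note two = this
      have sym: "?Q z I J = ?Q z J I" for I J
        by (simp add: pair_csch2_commute[of z I J] algebra_simps)
      show ?thesis
        unfolding D sum_ixs_off_diagonal[of "?Q z", OF sym] two ..
    qed
    moreover have "(\<Sum>I\<in>D. ?S z I) = (\<Sum>i<n. p * (p + 2 * q + 1) / (sinh (z (Inl i)))\<^sup>2) +
      (\<Sum>i<n. 4 * q * (q + 1) / (sinh (2 * z (Inl i)))\<^sup>2) +
      (\<Sum>j<m. k * r * (r + 2 * s + 1) / (sinh (z (Inr j)))\<^sup>2) +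
      (\<Sum>j<m. 4 * k * s * (s + 1) / (sinh (2 * z (Inr j)))\<^sup>2)"
      by (simp add: D sum_ixs w p'_def q'_def sum.distrib algebra_simps)
    moreover have "(\<Sum>c\<in>coords X. dual_norm X c * pd c (pd c f) z) =
      (\<Sum>i<n. pd (Inl i) (pd (Inl i) f) z) + k * (\<Sum>j<m. pd (Inr j) (pd (Inr j) f) z)"
    proof -
      have "(\<Sum>c\<in>coords X. dual_norm X c * pd c (pd c f) z) = (\<Sum>c\<in>coords X. (1 / w c) * pd c (pd c f) z)"
        by (intro sum.cong) (simp_all add: g)
      then show ?thesis by (simp add: D sum_ixs w sum_distrib_left mult.commute)
    qed
    ultimately show "deformed_CMS_BC n m k p q r s f z =
        - (\<Sum>c\<in>coords X. dual_norm X c * pd c (pd c f) z) + W z * f z"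
      unfolding W_def deformed_CMS_BC_def Let_def by (simp add: add.assoc add.left_commute)
  next
    fix P assume P: "positive_roots X P"
    \<comment> \<open>The constants left by the two-body terms: the case distinction comes from the
      squares and from the roots \<open>2 * unit_wt I\<close>, the last summand from the roots
      \<open>unit_wt I\<close>.\<close>
    define pc where "pc I J = (if isl I = isl J then 4 * k\<^sup>2 * w I ^ 3 - 4 * k * w I * V I else 4 * k + 8 * k * s)
      + 4 * k\<^sup>2 * r * w I * w J" for I J
    let ?a = "\<lambda>z I. U I / 2 * coth (z I) + V I * coth (2 * z I)"
    show "\<exists>C. \<forall>z\<in>regular_set X.
      (\<Sum>c\<in>D. dual_norm X c * ((log_weyl_pd D P (root_mult X) c z)\<^sup>2
        - (\<Sum>\<alpha>\<in>P. root_mult X \<alpha> / 2 * ((\<alpha> c)\<^sup>2 / (sinh (lin D \<alpha> z))\<^sup>2)))) = W z + C"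
    proof (intro exI ballI)
      fix z assume "z \<in> regular_set X"
      then have z: "regular_pt X z" by (rule regular_set_regular_pt)
      have triple: "(\<Sum>I\<in>D. \<Sum>J\<in>D - {I}. \<Sum>K\<in>D - {I} - {J}. w I * w J * w K * (pair_coth z I J * pair_coth z I K)) =
        (\<Sum>I\<in>D. \<Sum>J\<in>D - {I}. \<Sum>K\<in>D - {I} - {J}. w I * w J * w K * 4 / 3)"
        by (rule triple_sum, rule triple_BC[OF \<theta> z])
      have single: "(?a z I)\<^sup>2 - U I / 2 * (1 / (sinh (z I))\<^sup>2) - 2 * V I * (1 / (sinh (2 * z I))\<^sup>2) =
        p' I * (p' I + 2 * q' I + 1) / (sinh (z I))\<^sup>2 + 4 * q' I * (q' I + 1) / (sinh (2 * z I))\<^sup>2 + (p' I + 2 * q' I)\<^sup>2"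
        if "I \<in> D" for I
      proof -
        have UV: "U I / 2 = - p' I" "V I = - 2 * q' I" by (simp_all add: U V p'_def q'_def)
        then have "p' I = 0 \<and> q' I = 0 \<or> z I \<noteq> 0" using regular_unit[OF z that] by auto
        from single_term[OF this] show ?thesis unfolding UV by simp
      qed
      have pair: "(\<Sum>I\<in>D. \<Sum>J\<in>D - {I}. k\<^sup>2 * w I * (w J)\<^sup>2 * (pair_coth z I J)\<^sup>2 + k * w J * pair_csch2 z I J
        - 2 * k * w J * ?a z I * pair_coth z I J) =
        (\<Sum>I\<in>D. \<Sum>J\<in>D - {I}. ?Q z I J + pc I J / 2)"
      proof (subst (1 2) sum_symmetrize_off_diagonal[OF finite_coords], intro sum.cong refl)
        fix I J assume IJ: "I \<in> D" "J \<in> D - {I}"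
        let ?x = "cosh (2 * z I)" and ?y = "cosh (2 * z J)"
        have IJ': "z I \<noteq> z J" "z I + z J \<noteq> 0"
          using regular_diff[OF z] regular_add[OF z] IJ \<theta> by auto
        note ne = cosh_double_neq[OF IJ']
        have cs: "pair_csch2 z I J = 4 * (?x * ?y - 1) / (?x - ?y)\<^sup>2"
          using csch2_sum_eq[OF IJ'] unfolding pair_csch2_def unfolding \<theta> by simp
        have c2: "(pair_coth z I' J')\<^sup>2 = 4 * ((cosh (2 * z I'))\<^sup>2 - 1) / (cosh (2 * z I') - cosh (2 * z J'))\<^sup>2"
          and ca: "?a z I' * pair_coth z I' J' =
             (U I' / 2) * (2 * (cosh (2 * z I') + 1) / (cosh (2 * z I') - cosh (2 * z J')))
             + V I' * (2 * cosh (2 * z I')) / (cosh (2 * z I') - cosh (2 * z J'))"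
          if "I' \<in> D" "J' \<in> D" "I' \<noteq> J'" for I' J'
        proof -
          show "(pair_coth z I' J')\<^sup>2 = 4 * ((cosh (2 * z I'))\<^sup>2 - 1) / (cosh (2 * z I') - cosh (2 * z J'))\<^sup>2"
            by (simp add: pair_coth_eq[OF \<theta> z that] power_divide power_mult_distrib cosh_square_eq)
          \<comment> \<open>The identity is \<open>coth t * sinh (2 * t) = cosh (2 * t) + 1\<close>.
            If \<open>z I'\<close> is zero, then \<open>U I'\<close> is zero by
            \<open>regular_unit\<close>.\<close>
          have u: "U I' / 2 * (coth (z I') * sinh (2 * z I')) = U I' / 2 * (cosh (2 * z I') + 1)"
            using regular_unit[OF z that(1)]
            by (cases "U I' = 0") (auto simp: coth_def sinh_double cosh_double cosh_square_eq simp flip: power2_eq_square)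
          have v: "V I' * (coth (2 * z I') * sinh (2 * z I')) = V I' * cosh (2 * z I')"
            using regular_unit[OF z that(1)] by (cases "V I' = 0") (auto simp: coth_def)
          have "?a z I' * pair_coth z I' J' = (U I' / 2 * (coth (z I') * sinh (2 * z I'))
             + V I' * (coth (2 * z I') * sinh (2 * z I'))) * (2 / (cosh (2 * z I') - cosh (2 * z J')))"
            unfolding pair_coth_eq[OF \<theta> z that] by (simp add: algebra_simps add_divide_distrib)
          also have "\<dots> = (U I' / 2) * (2 * (cosh (2 * z I') + 1) / (cosh (2 * z I') - cosh (2 * z J')))
             + V I' * (2 * cosh (2 * z I')) / (cosh (2 * z I') - cosh (2 * z J'))"
            unfolding u v by (simp add: algebra_simps add_divide_distrib)
          finally show "?a z I' * pair_coth z I' J' =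
             (U I' / 2) * (2 * (cosh (2 * z I') + 1) / (cosh (2 * z I') - cosh (2 * z J')))
             + V I' * (2 * cosh (2 * z I')) / (cosh (2 * z I') - cosh (2 * z J'))" .
        qed
        \<comment> \<open>Here \<open>p = k * r\<close> enters: it makes \<open>U / 2\<close>
          proportional to \<open>w\<close> across both types, so the fractions with numerators
          \<open>?x + 1\<close> and \<open>?y + 1\<close> get equal coefficients and their poles
          cancel.\<close>
        have Uw: "U I' / 2 = - k * r * w I'" for I' using k p by (simp add: U w)
        have linear: "- 2 * k * w J * ((- k * r * w I) * (2 * (?x + 1) / (?x - ?y)))
           - 2 * k * w I * ((- k * r * w J) * (2 * (?y + 1) / (?y - ?x))) = 4 * k\<^sup>2 * r * w I * w J"
        proof -
          have "2 * (?x + 1) / (?x - ?y) + 2 * (?y + 1) / (?y - ?x) = 2"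
            using ne by (simp add: divide_simps) (simp add: algebra_simps)
          then have "2 * k\<^sup>2 * r * w I * w J * (2 * (?x + 1) / (?x - ?y) + 2 * (?y + 1) / (?y - ?x)) = 4 * k\<^sup>2 * r * w I * w J"
            by simp
          moreover have "- 2 * k * w J * ((- k * r * w I) * A) - 2 * k * w I * ((- k * r * w J) * B)
            = 2 * k\<^sup>2 * r * w I * w J * (A + B)" for A B
            by (simp add: algebra_simps power2_eq_square)
          ultimately show ?thesis by (simp only:)
        qed
        have core: "k\<^sup>2 * w I * (w J)\<^sup>2 * (4 * (?x\<^sup>2 - 1) / (?x - ?y)\<^sup>2) + k\<^sup>2 * w J * (w I)\<^sup>2 * (4 * (?y\<^sup>2 - 1) / (?y - ?x)\<^sup>2)
          + k * (w I + w J) * (4 * (?x * ?y - 1) / (?x - ?y)\<^sup>2)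
          - 2 * k * w J * (V I * (2 * ?x) / (?x - ?y)) - 2 * k * w I * (V J * (2 * ?y) / (?y - ?x))
          = k * (w I + w J) * (k * (w I * w J) + 1) * (4 * (?x * ?y - 1) / (?x - ?y)\<^sup>2)
            + (if isl I = isl J then 4 * k\<^sup>2 * w I ^ 3 - 4 * k * w I * V I else 4 * k + 8 * k * s)"
        proof -
          consider "isl I = isl J" | "isl I" "\<not> isl J" | "\<not> isl I" "isl J" by blast
          then show ?thesis
          proof cases
            case 1
            then have "w J = w I" "V J = V I" by (simp_all add: w V)
            then show ?thesis using pair_same_type[OF ne, of k "w I" "V I"] 1
              by (simp add: power3_eq_cube power2_eq_square algebra_simps)
          next
            case 2
            then show ?thesis using pair_mixed_type[OF ne k q] k
              by (simp add: w V power2_eq_square)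
                 (simp add: algebra_simps)
          next
            case 3
            have "?y - ?x \<noteq> 0" using ne by simp
            from pair_mixed_type[OF this k q] 3 k show ?thesis
              by (simp add: w V power2_commute[of ?y ?x] mult.commute[of ?y ?x] power2_eq_square)
                 (simp add: algebra_simps)
          qed
        qed
        have pcs: "pc I J + pc J I = 2 * ((if isl I = isl J then 4 * k\<^sup>2 * w I ^ 3 - 4 * k * w I * V I else 4 * k + 8 * k * s)
            + 4 * k\<^sup>2 * r * w I * w J)"
          by (simp add: pc_def w V)
        have "J \<in> D" "I \<noteq> J" "J \<noteq> I" using IJ by auto
        note c2s = c2[OF IJ(1) this(1,2)] c2[OF this(1) IJ(1) this(3)]
          and cas = ca[OF IJ(1) this(1,2)] ca[OF this(1) IJ(1) this(3)]
        show "(k\<^sup>2 * w I * (w J)\<^sup>2 * (pair_coth z I J)\<^sup>2 + k * w J * pair_csch2 z I J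
              - 2 * k * w J * ?a z I * pair_coth z I J
            + (k\<^sup>2 * w J * (w I)\<^sup>2 * (pair_coth z J I)\<^sup>2 + k * w I * pair_csch2 z J I
              - 2 * k * w I * ?a z J * pair_coth z J I)) / 2 =
          (?Q z I J + pc I J / 2 + (?Q z J I + pc J I / 2)) / 2" (is "?lhs / 2 = ?rhs / 2")
        proof -
          have "?lhs = k\<^sup>2 * w I * (w J)\<^sup>2 * (pair_coth z I J)\<^sup>2 + k\<^sup>2 * w J * (w I)\<^sup>2 * (pair_coth z J I)\<^sup>2
              + k * (w I + w J) * pair_csch2 z I J
              - 2 * k * w J * (?a z I * pair_coth z I J) - 2 * k * w I * (?a z J * pair_coth z J I)"
            by (simp only: pair_csch2_commute[of z J I]) (simp add: ring_distribs mult.assoc)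
          also have "\<dots> = k * (w I + w J) * (k * (w I * w J) + 1) * (4 * (?x * ?y - 1) / (?x - ?y)\<^sup>2)
            + (if isl I = isl J then 4 * k\<^sup>2 * w I ^ 3 - 4 * k * w I * V I else 4 * k + 8 * k * s)
            + 4 * k\<^sup>2 * r * w I * w J"
            unfolding c2s cas cs unfolding Uw using core linear by (simp only: distrib_left)
          also have "\<dots> = ?rhs"
            using pcs unfolding cs[symmetric] pair_csch2_commute[of z J I] by (simp add: algebra_simps)
          finally show ?thesis by simp
        qed
      qed
      show "(\<Sum>c\<in>D. dual_norm X c * ((log_weyl_pd D P (root_mult X) c z)\<^sup>2
        - (\<Sum>\<alpha>\<in>P. root_mult X \<alpha> / 2 * ((\<alpha> c)\<^sup>2 / (sinh (lin D \<alpha> z))\<^sup>2)))) = W z +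
        ((\<Sum>I\<in>D. 1 / w I * (p' I + 2 * q' I)\<^sup>2) + (\<Sum>I\<in>D. \<Sum>J\<in>D - {I}. pc I J / 2)
         + k\<^sup>2 * (\<Sum>I\<in>D. \<Sum>J\<in>D - {I}. \<Sum>K\<in>D - {I} - {J}. w I * w J * w K * 4 / 3))"
      proof -
        have s: "(\<Sum>I\<in>D. dual_norm X I * ((?a z I)\<^sup>2 - U I / 2 * (1 / (sinh (z I))\<^sup>2) - 2 * V I * (1 / (sinh (2 * z I))\<^sup>2))) =
          (\<Sum>I\<in>D. ?S z I + 1 / w I * (p' I + 2 * q' I)\<^sup>2)"
          by (intro sum.cong refl) (simp only: g single distrib_left)
        show ?thesis
        proof (subst potential_expand[OF P], goal_cases)
          case (1 c)
          then show ?case by (rule g)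
        next
          case 2
          show ?case
            unfolding triple s pair W_def
            by (simp only: sum.distrib add.assoc add.left_commute)
        qed
      qed
    qed
  qed
qed

end

section \<open>Weight bases of the Lie superalgebras\<close>

text \<open>Biorthogonality of \<open>lam\<close> and \<open>e\<close> gives independence. For
  spanning, \<open>A\<close> minus its expansion with the coefficients \<open>lam s A\<close> is
  annihilated by all the functionals, hence zero.\<close>

lemma smat_dim_eq_card:
  fixes lam :: "'s \<Rightarrow> smat \<Rightarrow> complex"
  assumes S: "finite S" and W: "smat.subspace W"
    and add: "\<And>s A B. s \<in> S \<Longrightarrow> lam s (A + B) = lam s A + lam s B"
    and scale: "\<And>s x A. s \<in> S \<Longrightarrow> lam s (mscale x A) = x * lam s A"
    and e: "\<And>s. s \<in> S \<Longrightarrow> e s \<in> W"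
    and dual: "\<And>s t. s \<in> S \<Longrightarrow> t \<in> S \<Longrightarrow> lam s (e t) = (if s = t then 1 else 0)"
    and inj: "\<And>A. A \<in> W \<Longrightarrow> (\<And>s. s \<in> S \<Longrightarrow> lam s A = 0) \<Longrightarrow> A = 0"
  shows "smat.dim W = card S"
proof -
  have zero: "lam s 0 = 0" if "s \<in> S" for s
    using scale[OF that, of 0 0] by simp
  have sum: "lam s (\<Sum>t\<in>T. mscale (x t) (B t)) = (\<Sum>t\<in>T. x t * lam s (B t))"
    if "finite T" "s \<in> S" for s x B and T :: "'t set"
    using that by (induction T rule: finite_induct) (auto simp: zero add scale)
  have coeff: "lam s (\<Sum>t\<in>S. mscale (x t) (e t)) = x s" if "s \<in> S" for s x
    using that S by (simp add: sum dual if_distrib[where f = "\<lambda>y. _ * y"] cong: if_cong)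
  have inj_e: "inj_on e S"
    using dual by (intro inj_onI) (metis zero_neq_one)
  have "smat.independent (e ` S)"
  proof
    assume "smat.dependent (e ` S)"
    then obtain u v where uv: "v \<in> e ` S" "u v \<noteq> 0" "(\<Sum>v\<in>e ` S. mscale (u v) v) = 0"
      using S by (auto simp: smat.dependent_finite)
    then obtain s where s: "s \<in> S" "v = e s" by blast
    have "(\<Sum>t\<in>S. mscale (u (e t)) (e t)) = 0"
      using uv(3) by (simp add: sum.reindex[OF inj_e])
    with coeff[OF s(1), of "\<lambda>t. u (e t)"] zero[OF s(1)] uv(2) s(2) show False by simp
  qed
  moreover have "W \<subseteq> smat.span (e ` S)"
  proof
    fix A assume A: "A \<in> W"
    let ?B = "\<Sum>s\<in>S. mscale (lam s A) (e s)"
    have "?B \<in> W" by (intro smat.subspace_sum W smat.subspace_scale e)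
    then have "A - ?B \<in> W" using A W by (intro smat.subspace_diff)
    moreover have "lam s (A - ?B) = 0" if "s \<in> S" for s
      using add[OF that, of "A - ?B" ?B] coeff[OF that, of "\<lambda>s. lam s A"] by simp
    ultimately have "A = ?B" using inj by fastforce
    moreover have "?B \<in> smat.span (e ` S)"
      by (intro smat.span_sum smat.span_scale smat.span_base) auto
    ultimately show "A \<in> smat.span (e ` S)" by simp
  qed
  ultimately show ?thesis
    using smat.dim_unique[of "e ` S" W "card S"] e card_image[OF inj_e] by blast
qed

section \<open>Matrix products, parity and the superbracket\<close>

lemma mmul_add_left: "mmul I (A + B) C = mmul I A C + mmul I B C"
  and mmul_add_right: "mmul I C (A + B) = mmul I C A + mmul I C B"
  and mmul_diff_left: "mmul I (A - B) C = mmul I A C - mmul I B C"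
  and mmul_diff_right: "mmul I C (A - B) = mmul I C A - mmul I C B"
  and mmul_scale_left: "mmul I (mscale x A) C = mscale x (mmul I A C)"
  and mmul_scale_right: "mmul I C (mscale x A) = mscale x (mmul I C A)"
  and mmul_zero_left [simp]: "mmul I 0 C = 0"
  and mmul_zero_right [simp]: "mmul I C 0 = 0"
  by (auto simp: mmul_def mscale_def fun_eq_iff sum.distrib sum_subtractf algebra_simps sum_distrib_left)

lemma mmul_assoc: "mmul I (mmul I A B) C = mmul I A (mmul I B C)"
proof (intro ext)
  fix i j
  show "mmul I (mmul I A B) C i j = mmul I A (mmul I B C) i j"
    unfolding mmul_def sum_distrib_left sum_distrib_right
    by (subst sum.swap) (simp add: mult.assoc)
qed

lemma even_odd_parts: "even_part A + odd_part A = A"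
  by (auto simp: even_part_def odd_part_def fun_eq_iff)

lemma odd_part_eq_0_iff: "odd_part A = 0 \<longleftrightarrow> (\<forall>i j. isl i \<noteq> isl j \<longrightarrow> A i j = 0)"
  and even_part_eq_0_iff: "even_part A = 0 \<longleftrightarrow> (\<forall>i j. isl i = isl j \<longrightarrow> A i j = 0)"
  by (auto simp: odd_part_def even_part_def fun_eq_iff)

lemma even_part_add: "even_part (A + B) = even_part A + even_part B"
  and odd_part_add: "odd_part (A + B) = odd_part A + odd_part B"
  and even_part_scale: "even_part (mscale x A) = mscale x (even_part A)"
  and odd_part_scale: "odd_part (mscale x A) = mscale x (odd_part A)"
  by (auto simp: even_part_def odd_part_def mscale_def fun_eq_iff)

lemma sbracket_add: "sbracket I H (A + B) = sbracket I H A + sbracket I H B"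
  by (simp add: sbracket_def even_part_add odd_part_add mmul_add_left mmul_add_right)

lemma sbracket_scale: "sbracket I H (mscale x A) = mscale x (sbracket I H A)"
  by (simp add: sbracket_def even_part_scale odd_part_scale mmul_scale_left mmul_scale_right
      smat.scale_right_diff_distrib smat.scale_right_distrib)

lemma sbracket_even:
  assumes "odd_part H = 0"
  shows "sbracket I H A = mmul I H A - mmul I A H"
proof -
  have H: "even_part H = H" using even_odd_parts[of H] assms by simp
  have "mmul I A H = mmul I (even_part A) H + mmul I (odd_part A) H"
    by (simp add: even_odd_parts flip: mmul_add_left)
  then show ?thesis by (simp add: sbracket_def assms H)
qed

lemma subspace_weight_space:
  assumes "smat.subspace (alg X)"
  shows "smat.subspace (weight_space X \<alpha>)"
  using assms unfolding weight_space_def smat.subspace_def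
  by (auto simp: sbracket_add sbracket_scale smat.scale_right_distrib smat.scale_left_commute)
     (simp add: sbracket_scale[of _ _ 0, simplified])

text \<open>A homogeneous basis \<open>e\<close> of weight vectors, with its dual basis \<open>lam\<close>.\<close>

locale weight_basis =
  fixes X :: sym_pair and S :: "'s set" and wt :: "'s \<Rightarrow> ix \<Rightarrow> real" and par :: "'s \<Rightarrow> bool"
    and lam :: "'s \<Rightarrow> smat \<Rightarrow> complex" and e :: "'s \<Rightarrow> smat"
  assumes finS: "finite S" and subspace_alg: "smat.subspace (alg X)"
    and lam_add: "\<And>s A B. s \<in> S \<Longrightarrow> lam s (A + B) = lam s A + lam s B"
    and lam_scale: "\<And>s x A. s \<in> S \<Longrightarrow> lam s (mscale x A) = x * lam s A"
    and wt_supp: "\<And>s c. s \<in> S \<Longrightarrow> c \<notin> coords X \<Longrightarrow> wt s c = 0"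
    and e_weight: "\<And>s. s \<in> S \<Longrightarrow> e s \<in> weight_space X (wt s)"
    and e_par: "\<And>s. s \<in> S \<Longrightarrow> if par s then odd_part (e s) = 0 else even_part (e s) = 0"
    and lam_e: "\<And>s t. s \<in> S \<Longrightarrow> t \<in> S \<Longrightarrow> lam s (e t) = (if s = t then 1 else 0)"
    and lam_weight: "\<And>s A \<alpha> c. s \<in> S \<Longrightarrow> A \<in> weight_space X \<alpha> \<Longrightarrow> lam s A \<noteq> 0 \<Longrightarrow> c \<in> coords X \<Longrightarrow> wt s c = \<alpha> c"
    and lam_even: "\<And>s A. s \<in> S \<Longrightarrow> odd_part A = 0 \<Longrightarrow> \<not> par s \<Longrightarrow> lam s A = 0"
    and lam_odd: "\<And>s A. s \<in> S \<Longrightarrow> even_part A = 0 \<Longrightarrow> par s \<Longrightarrow> lam s A = 0"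
    and lam_inj: "\<And>A. A \<in> alg X \<Longrightarrow> (\<And>s. s \<in> S \<Longrightarrow> lam s A = 0) \<Longrightarrow> A = 0"
begin

lemma lam_weight_eq:
  assumes "\<forall>c. c \<notin> coords X \<longrightarrow> \<alpha> c = 0" "s \<in> S" "A \<in> weight_space X \<alpha>" "lam s A \<noteq> 0"
  shows "wt s = \<alpha>"
  using lam_weight[OF assms(2-4)] wt_supp[OF assms(2)] assms(1) by (intro ext) metis

lemma restricted_roots_eq: "restricted_roots X = wt ` S - {0}"
proof (intro equalityI subsetI)
  fix \<alpha> assume \<alpha>: "\<alpha> \<in> restricted_roots X"
  have "0 \<in> weight_space X \<alpha>"
    using subspace_weight_space[OF subspace_alg] by (simp add: smat.subspace_0)
  with \<alpha> obtain A where A: "A \<in> weight_space X \<alpha>" "A \<noteq> 0"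
    by (auto simp: restricted_roots_def)
  then obtain s where "s \<in> S" "lam s A \<noteq> 0"
    using lam_inj[of A] by (auto simp: weight_space_def)
  with lam_weight_eq[of \<alpha> s A] \<alpha> A show "\<alpha> \<in> wt ` S - {0}"
    by (auto simp: restricted_roots_def)
next
  fix \<alpha> assume "\<alpha> \<in> wt ` S - {0}"
  then obtain s where s: "s \<in> S" "\<alpha> = wt s" "wt s \<noteq> 0" by blast
  have "e s \<noteq> 0"
  proof
    assume "e s = 0"
    with lam_e[OF s(1,1)] lam_scale[OF s(1), of 0 0] show False by simp
  qed
  with e_weight[OF s(1)] have "weight_space X (wt s) \<noteq> {0}" by blast
  moreover have "\<exists>c\<in>coords X. wt s c \<noteq> 0"
    using s(3) wt_supp[OF s(1)] by (metis ext zero_fun_def)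
  ultimately show "\<alpha> \<in> restricted_roots X"
    using s(2) wt_supp[OF s(1)] unfolding restricted_roots_def by auto
qed

text \<open>On a weight space only the functionals of that weight can be nonzero, and on its even or
  odd part only those of that parity. The basis vectors of given weight and parity therefore form a
  basis of the corresponding piece.\<close>

lemma superdim_weight_space:
  assumes \<alpha>: "\<forall>c. c \<notin> coords X \<longrightarrow> \<alpha> c = 0"
  shows "superdim (weight_space X \<alpha>) = (\<Sum>s\<in>{s \<in> S. wt s = \<alpha>}. if par s then 1 else - 1)"
proof -
  let ?S = "{s \<in> S. wt s = \<alpha>}"
  note sub = subspace_weight_space[OF subspace_alg, of \<alpha>]
  have inj: "A = 0" if "A \<in> weight_space X \<alpha>" "\<And>s. s \<in> ?S \<Longrightarrow> lam s A = 0" for A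
  proof (rule lam_inj)
    show "A \<in> alg X" using that(1) by (simp add: weight_space_def)
    show "lam s A = 0" if "s \<in> S" for s
      using lam_weight_eq[OF \<alpha> that \<open>A \<in> weight_space X \<alpha>\<close>] \<open>\<And>s. s \<in> ?S \<Longrightarrow> lam s A = 0\<close> that by blast
  qed
  have "smat.dim {A \<in> weight_space X \<alpha>. odd_part A = 0} = card {s \<in> ?S. par s}"
  proof (rule smat_dim_eq_card[where lam = lam and e = e])
    show "smat.subspace {A \<in> weight_space X \<alpha>. odd_part A = 0}"
      using sub by (auto simp: smat.subspace_def odd_part_add odd_part_scale)
        (auto simp: odd_part_def fun_eq_iff)
    fix s t assume "s \<in> {s \<in> ?S. par s}"
    then show "e s \<in> {A \<in> weight_space X \<alpha>. odd_part A = 0}"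
      using e_weight[of s] e_par[of s] by auto
  next
    fix A assume "A \<in> {A \<in> weight_space X \<alpha>. odd_part A = 0}" "\<And>s. s \<in> {s \<in> ?S. par s} \<Longrightarrow> lam s A = 0"
    then show "A = 0" using inj[of A] lam_even[of _ A] by blast
  qed (auto simp: finS lam_add lam_scale lam_e)
  moreover have "smat.dim {A \<in> weight_space X \<alpha>. even_part A = 0} = card {s \<in> ?S. \<not> par s}"
  proof (rule smat_dim_eq_card[where lam = lam and e = e])
    show "smat.subspace {A \<in> weight_space X \<alpha>. even_part A = 0}"
      using sub by (auto simp: smat.subspace_def even_part_add even_part_scale)
        (auto simp: even_part_def fun_eq_iff)
    fix s t assume "s \<in> {s \<in> ?S. \<not> par s}"
    then show "e s \<in> {A \<in> weight_space X \<alpha>. even_part A = 0}"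
      using e_weight[of s] e_par[of s] by auto
  next
    fix A assume "A \<in> {A \<in> weight_space X \<alpha>. even_part A = 0}" "\<And>s. s \<in> {s \<in> ?S. \<not> par s} \<Longrightarrow> lam s A = 0"
    then show "A = 0" using inj[of A] lam_odd[of _ A] by blast
  qed (auto simp: finS lam_add lam_scale lam_e)
  moreover have "(\<Sum>s\<in>?S. if par s then 1 else - 1 :: int) = int (card {s \<in> ?S. par s}) - int (card {s \<in> ?S. \<not> par s})"
    using finS by (simp add: sum.If_cases Int_def)
  ultimately show ?thesis by (simp add: superdim_def)
qed

text \<open>Each multiplicity is a sum of signs over the basis vectors of that weight, so the sum is
  regrouped by weights. The vectors of weight 0, which belong to no root, may be included because
  \<open>F 0 = 0\<close>.\<close>

lemma sum_restricted_roots: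
  fixes F :: "(ix \<Rightarrow> real) \<Rightarrow> real"
  assumes "F 0 = 0"
  shows "(\<Sum>\<alpha>\<in>restricted_roots X. root_mult X \<alpha> * F \<alpha>) =
         (\<Sum>s\<in>S. (if par s then 1 else - 1) * F (wt s))"
proof -
  let ?sg = "\<lambda>s. if par s then 1 else - 1 :: real"
  let ?S = "{s \<in> S. wt s \<noteq> 0}"
  have "(\<Sum>\<alpha>\<in>restricted_roots X. root_mult X \<alpha> * F \<alpha>) =
      (\<Sum>\<alpha>\<in>restricted_roots X. \<Sum>s\<in>{s \<in> ?S. wt s = \<alpha>}. ?sg s * F (wt s))"
  proof (rule sum.cong[OF refl])
    fix \<alpha> assume \<alpha>: "\<alpha> \<in> restricted_roots X"
    then have "{s \<in> ?S. wt s = \<alpha>} = {s \<in> S. wt s = \<alpha>}"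
      by (auto simp: restricted_roots_eq)
    moreover have "root_mult X \<alpha> = (\<Sum>s\<in>{s \<in> S. wt s = \<alpha>}. ?sg s)"
      using \<alpha> by (simp add: root_mult_def superdim_weight_space restricted_roots_def if_distrib cong: if_cong)
    ultimately show "root_mult X \<alpha> * F \<alpha> = (\<Sum>s\<in>{s \<in> ?S. wt s = \<alpha>}. ?sg s * F (wt s))"
      by (simp add: sum_distrib_right)
  qed
  also have "\<dots> = (\<Sum>s\<in>?S. ?sg s * F (wt s))"
    using finS by (intro sum.group) (auto simp: restricted_roots_eq)
  also have "\<dots> = (\<Sum>s\<in>S. ?sg s * F (wt s))"
    using finS assms by (intro sum.mono_neutral_left) auto
  finally show ?thesis .
qed

lemma finite_restricted_roots: "finite (restricted_roots X)"
  using finS by (simp add: restricted_roots_eq)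

end

section \<open>Coordinates in which the vectors \<open>base c\<close> act diagonally\<close>

definition one_on :: "ix set \<Rightarrow> smat" where
  "one_on I = (\<lambda>i j. if i = j \<and> i \<in> I then 1 else 0)"

definition gl_on :: "ix set \<Rightarrow> smat set" where
  "gl_on I = {A. \<forall>i j. i \<notin> I \<or> j \<notin> I \<longrightarrow> A i j = 0}"

lemma gl_alg_gl_on: "gl_alg N M = gl_on (ixs N M)"
  by (simp add: gl_alg_def gl_on_def)

lemma mmul_one_left: "finite I \<Longrightarrow> A \<in> gl_on I \<Longrightarrow> mmul I (one_on I) A = A"
  and mmul_one_right: "finite I \<Longrightarrow> A \<in> gl_on I \<Longrightarrow> mmul I A (one_on I) = A"
proof -
  have "(\<Sum>l\<in>I. one_on I i l * A l j) = (\<Sum>l\<in>I. if i = l then A l j else 0)"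
    "(\<Sum>l\<in>I. A i l * one_on I l j) = (\<Sum>l\<in>I. if l = j then A i l else 0)" for i j
    by (auto simp: one_on_def intro!: sum.cong)
  then show "finite I \<Longrightarrow> A \<in> gl_on I \<Longrightarrow> mmul I (one_on I) A = A"
    "finite I \<Longrightarrow> A \<in> gl_on I \<Longrightarrow> mmul I A (one_on I) = A"
    by (auto simp: mmul_def gl_on_def fun_eq_iff)
qed

lemma mmul_gl_on: "A \<in> gl_on I \<Longrightarrow> B \<in> gl_on I \<Longrightarrow> mmul I A B \<in> gl_on I"
  by (auto simp: gl_on_def mmul_def)

lemma subspace_gl_on: "smat.subspace (gl_on I)"
  by (auto simp: smat.subspace_def gl_on_def mscale_def)

definition transp :: "smat \<Rightarrow> smat" where
  "transp A = (\<lambda>i j. A j i)"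

lemma transp_mmul: "transp (mmul I A B) = mmul I (transp B) (transp A)"
  by (simp add: transp_def mmul_def mult.commute)

lemma transp_simps [simp]: "transp (transp A) = A" "transp (one_on I) = one_on I"
  by (auto simp: transp_def one_on_def fun_eq_iff)

lemma transp_gl_on: "A \<in> gl_on I \<Longrightarrow> transp A \<in> gl_on I"
  by (auto simp: transp_def gl_on_def)

text \<open>
  \<open>B = p A g\<close> is \<open>A\<close> in coordinates in which every \<open>ad (base c)\<close> is diagonal.
\<close>

locale frame =
  fixes X :: sym_pair and p p' g g' :: smat and \<rho> \<epsilon> :: "ix \<Rightarrow> ix \<Rightarrow> real"
  assumes fin: "finite (idx X)"
    and alg_sub: "alg X \<subseteq> gl_on (idx X)" "smat.subspace (alg X)"
    and supp: "p \<in> gl_on (idx X)" "p' \<in> gl_on (idx X)" "g \<in> gl_on (idx X)" "g' \<in> gl_on (idx X)"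
    and even: "\<And>i j. isl i \<noteq> isl j \<Longrightarrow> p i j = 0" "\<And>i j. isl i \<noteq> isl j \<Longrightarrow> p' i j = 0"
      "\<And>i j. isl i \<noteq> isl j \<Longrightarrow> g i j = 0" "\<And>i j. isl i \<noteq> isl j \<Longrightarrow> g' i j = 0"
    and inv: "mmul (idx X) p p' = one_on (idx X)" "mmul (idx X) p' p = one_on (idx X)"
      "mmul (idx X) g g' = one_on (idx X)" "mmul (idx X) g' g = one_on (idx X)"
    and base_even: "\<And>c i j. c \<in> coords X \<Longrightarrow> isl i \<noteq> isl j \<Longrightarrow> base X c i j = 0"
    and base_supp: "\<And>c. c \<in> coords X \<Longrightarrow> base X c \<in> gl_on (idx X)"
    and base_left: "\<And>c i j. c \<in> coords X \<Longrightarrow> i \<in> idx X \<Longrightarrow> j \<in> idx X \<Longrightarrow>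
      mmul (idx X) p (base X c) i j = of_real (\<rho> i c) * p i j"
    and base_right: "\<And>c i j. c \<in> coords X \<Longrightarrow> i \<in> idx X \<Longrightarrow> j \<in> idx X \<Longrightarrow>
      mmul (idx X) (base X c) g i j = g i j * of_real (\<epsilon> j c)"
    and wt_supp: "\<And>i c. c \<notin> coords X \<Longrightarrow> \<rho> i c = 0" "\<And>i c. c \<notin> coords X \<Longrightarrow> \<epsilon> i c = 0"
begin

abbreviation "I \<equiv> idx X"

definition L :: "smat \<Rightarrow> smat" where "L A = mmul I (mmul I p A) g"

definition L' :: "smat \<Rightarrow> smat" where "L' B = mmul I (mmul I p' B) g'"

lemma L_linear: "L (A + B) = L A + L B" "L (mscale x A) = mscale x (L A)"
  by (simp_all add: L_def mmul_add_left mmul_add_right mmul_scale_left mmul_scale_right)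

lemma L'_L: "A \<in> gl_on I \<Longrightarrow> L' (L A) = A"
  and L_L': "A \<in> gl_on I \<Longrightarrow> L (L' A) = A"
proof -
  have "L' (L A) = mmul I (mmul I (mmul I p' p) A) (mmul I g g')"
    by (simp only: L_def L'_def mmul_assoc)
  then show "A \<in> gl_on I \<Longrightarrow> L' (L A) = A"
    by (simp add: inv mmul_one_left mmul_one_right fin)
  have "L (L' A) = mmul I (mmul I (mmul I p p') A) (mmul I g' g)"
    by (simp only: L_def L'_def mmul_assoc)
  then show "A \<in> gl_on I \<Longrightarrow> L (L' A) = A"
    by (simp add: inv mmul_one_left mmul_one_right fin)
qed

lemma L_gl_on: "A \<in> gl_on I \<Longrightarrow> L A \<in> gl_on I" "A \<in> gl_on I \<Longrightarrow> L' A \<in> gl_on I"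
  by (auto simp: L_def L'_def intro!: mmul_gl_on supp)

lemma mmul_parity:
  assumes "\<And>i j. isl i \<noteq> isl j \<Longrightarrow> q i j = 0" "\<And>i j. isl i \<noteq> isl j \<Longrightarrow> h i j = 0"
    and "\<And>i j. (isl i = isl j) = \<pi> \<Longrightarrow> A i j = 0" "(isl i = isl j) = \<pi>"
  shows "mmul I (mmul I q A) h i j = 0"
proof -
  have "q i a * A a b * h b j = 0" for a b
    using assms(1)[of i a] assms(2)[of b j] assms(3)[of a b] assms(4) by (cases "isl i = isl a"; cases "isl b = isl j") auto
  then show ?thesis unfolding mmul_def sum_distrib_right by (intro sum.neutral ballI)
qed

lemma L_parity:
  assumes "(isl i = isl j) = \<pi>" "\<And>i j. (isl i = isl j) = \<pi> \<Longrightarrow> A i j = 0"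
  shows "L A i j = 0" "L' A i j = 0"
  unfolding L_def L'_def
  by (rule mmul_parity[OF even(1,3) assms(2,1)], assumption+)
     (rule mmul_parity[OF even(2,4) assms(2,1)], assumption+)

lemma sbracket_base: "c \<in> coords X \<Longrightarrow> sbracket I (base X c) A = mmul I (base X c) A - mmul I A (base X c)"
  by (rule sbracket_even) (simp add: odd_part_eq_0_iff base_even)

text \<open>With \<open>H = base X c\<close>, the rows of \<open>p\<close> are left eigenvectors of
  \<open>H\<close> and the columns of \<open>g\<close> right ones, so \<open>p (H A - A H) g\<close>
  is \<open>L A\<close> with the entry at \<open>i\<close>, \<open>j\<close> scaled by the
  difference of the two eigenvalues.\<close>

lemma L_sbracket:
  assumes "c \<in> coords X" "i \<in> I" "j \<in> I"
  shows "L (sbracket I (base X c) A) i j = of_real (\<rho> i c - \<epsilon> j c) * L A i j"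
proof -
  let ?H = "base X c"
  have "L (sbracket I ?H A) i j = mmul I (mmul I p ?H) (mmul I A g) i j - mmul I (mmul I p A) (mmul I ?H g) i j"
    by (simp add: L_def sbracket_base assms mmul_diff_left mmul_diff_right mmul_assoc)
  also have "mmul I (mmul I p ?H) (mmul I A g) i j = of_real (\<rho> i c) * mmul I p (mmul I A g) i j"
    unfolding mmul_def[of I "mmul I p ?H"] mmul_def[of I p "mmul I A g"]
    using base_left assms by (simp add: sum_distrib_left mult.assoc)
  also have "mmul I (mmul I p A) (mmul I ?H g) i j = of_real (\<epsilon> j c) * mmul I (mmul I p A) g i j"
    unfolding mmul_def[of I _ "mmul I ?H g"] mmul_def[of I "mmul I p A" g]
    using base_right assms by (simp add: sum_distrib_left ac_simps)
  finally show ?thesis by (simp add: L_def mmul_assoc algebra_simps)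
qed

lemma weight_space_L:
  assumes A: "A \<in> alg X"
  shows "A \<in> weight_space X \<alpha> \<longleftrightarrow>
     (\<forall>c\<in>coords X. \<forall>i\<in>I. \<forall>j\<in>I. L A i j \<noteq> 0 \<longrightarrow> \<rho> i c - \<epsilon> j c = \<alpha> c)"
proof -
  have Ag: "A \<in> gl_on I" using A alg_sub by blast
  have "sbracket I (base X c) A = mscale (of_real (\<alpha> c)) A \<longleftrightarrow>
     (\<forall>i\<in>I. \<forall>j\<in>I. L A i j \<noteq> 0 \<longrightarrow> \<rho> i c - \<epsilon> j c = \<alpha> c)" if c: "c \<in> coords X" for c
  proof -
    have g1: "sbracket I (base X c) A \<in> gl_on I" "mscale (of_real (\<alpha> c)) A \<in> gl_on I"
      using Ag base_supp[OF c] subspace_gl_on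
      by (auto simp: sbracket_base c intro!: smat.subspace_diff smat.subspace_scale mmul_gl_on)
    have "sbracket I (base X c) A = mscale (of_real (\<alpha> c)) A \<longleftrightarrow>
        L (sbracket I (base X c) A) = L (mscale (of_real (\<alpha> c)) A)"
      using L'_L g1 by metis
    also have "\<dots> \<longleftrightarrow> (\<forall>i\<in>I. \<forall>j\<in>I. L (sbracket I (base X c) A) i j = L (mscale (of_real (\<alpha> c)) A) i j)"
      using g1[THEN L_gl_on(1)] by (auto simp: fun_eq_iff gl_on_def) metis
    also have "\<dots> \<longleftrightarrow> (\<forall>i\<in>I. \<forall>j\<in>I. L A i j \<noteq> 0 \<longrightarrow> \<rho> i c - \<epsilon> j c = \<alpha> c)"
      unfolding L_linear using c
      by (intro ball_cong refl) (auto simp: L_sbracket mscale_def simp del: of_real_diff)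
    finally show ?thesis .
  qed
  with A show ?thesis by (auto simp: weight_space_def)
qed

text \<open>The entries of \<open>L A\<close> at the positions in \<open>S\<close> serve as
  coordinates on \<open>alg X\<close>, and \<open>E\<close> is the dual basis written in the
  diagonalising frame. For gl all positions are free; for osp a symmetry condition determines the
  entries outside \<open>S\<close>.\<close>

lemma weight_basisI:
  assumes S: "S \<subseteq> I \<times> I"
    and E_alg: "\<And>a b. (a, b) \<in> S \<Longrightarrow> E (a, b) \<in> gl_on I \<and> L' (E (a, b)) \<in> alg X"
    and E_wt: "\<And>a b i j. (a, b) \<in> S \<Longrightarrow> E (a, b) i j \<noteq> 0 \<Longrightarrow>
      \<rho> i - \<epsilon> j = \<rho> a - \<epsilon> b \<and> (isl i = isl j \<longleftrightarrow> isl a = isl b)"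
    and E_dual: "\<And>a b i j. (a, b) \<in> S \<Longrightarrow> (i, j) \<in> S \<Longrightarrow> E (i, j) a b = (if (a, b) = (i, j) then 1 else 0)"
    and S_inj: "\<And>A. A \<in> alg X \<Longrightarrow> (\<And>a b. (a, b) \<in> S \<Longrightarrow> L A a b = 0) \<Longrightarrow> L A = 0"
  shows "weight_basis X S (\<lambda>(a, b). \<rho> a - \<epsilon> b) (\<lambda>(a, b). isl a = isl b) (\<lambda>(a, b) A. L A a b) (\<lambda>s. L' (E s))"
proof
  show "finite S" using S fin finite_subset by blast
  show "smat.subspace (alg X)" by (rule alg_sub)
  show "(case s of (a, b) \<Rightarrow> \<lambda>A. L A a b) (A + B) = (case s of (a, b) \<Rightarrow> \<lambda>A. L A a b) A + (case s of (a, b) \<Rightarrow> \<lambda>A. L A a b) B"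
    for s A B by (cases s) (simp add: L_linear)
  show "(case s of (a, b) \<Rightarrow> \<lambda>A. L A a b) (mscale x A) = x * (case s of (a, b) \<Rightarrow> \<lambda>A. L A a b) A"
    for s A x by (cases s) (simp add: L_linear(2), simp add: mscale_def)
  show "(case s of (a, b) \<Rightarrow> \<rho> a - \<epsilon> b) c = 0" if "c \<notin> coords X" for s c
    using wt_supp that by (cases s) simp
  show "L' (E s) \<in> weight_space X (case s of (a, b) \<Rightarrow> \<rho> a - \<epsilon> b)" if s: "s \<in> S" for s
  proof (cases s)
    case (Pair a b)
    have e: "E (a, b) \<in> gl_on I" "L' (E (a, b)) \<in> alg X" using E_alg s Pair by auto
    show ?thesis
      unfolding Pair using E_wt[of a b] s Pair
      by (auto simp: weight_space_L[OF e(2)] L_L'[OF e(1)] fun_eq_iff)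
  qed
  show "if case s of (a, b) \<Rightarrow> isl a = isl b then odd_part (L' (E s)) = 0 else even_part (L' (E s)) = 0"
    if "s \<in> S" for s
  proof (cases s)
    case (Pair a b)
    have "L' (E (a, b)) i j = 0" if "(isl i = isl j) \<noteq> (isl a = isl b)" for i j
      using L_parity(2)[of i j "\<not> (isl a = isl b)" "E (a, b)"] that E_wt[of a b] \<open>s \<in> S\<close> Pair by blast
    then show ?thesis unfolding Pair by (auto simp: odd_part_eq_0_iff even_part_eq_0_iff)
  qed
  show "(case s of (a, b) \<Rightarrow> \<lambda>A. L A a b) (L' (E t)) = (if s = t then 1 else 0)" if "s \<in> S" "t \<in> S" for s t
    using that E_alg[of "fst t" "snd t"] E_dual[of "fst s" "snd s" "fst t" "snd t"]
    by (auto simp: L_L' case_prod_unfold prod_eq_iff)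
  show "(case s of (a, b) \<Rightarrow> \<rho> a - \<epsilon> b) c = \<alpha> c"
    if "s \<in> S" "A \<in> weight_space X \<alpha>" "(case s of (a, b) \<Rightarrow> \<lambda>A. L A a b) A \<noteq> 0" "c \<in> coords X" for s A \<alpha> c
  proof -
    have "A \<in> alg X" using that by (simp add: weight_space_def)
    from weight_space_L[OF this, of \<alpha>] that S show ?thesis by (cases s) auto
  qed
  show "(case s of (a, b) \<Rightarrow> \<lambda>A. L A a b) A = 0"
    if "odd_part A = 0" "\<not> (case s of (a, b) \<Rightarrow> isl a = isl b)" for s A
    using that L_parity(1)[of "fst s" "snd s" False A] by (auto simp: odd_part_eq_0_iff case_prod_unfold)
  show "(case s of (a, b) \<Rightarrow> \<lambda>A. L A a b) A = 0"
    if "even_part A = 0" "case s of (a, b) \<Rightarrow> isl a = isl b" for s A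
    using that L_parity(1)[of "fst s" "snd s" True A] by (auto simp: even_part_eq_0_iff case_prod_unfold)
  show "A = 0" if "A \<in> alg X" "\<And>s. s \<in> S \<Longrightarrow> (case s of (a, b) \<Rightarrow> \<lambda>A. L A a b) A = 0" for A
  proof -
    have "L A = 0" using S_inj[OF that(1)] that(2) by fastforce
    then have "L' (L A) = 0" by (simp add: L'_def)
    then show ?thesis using L'_L that(1) alg_sub by auto
  qed
qed

lemma gl_weight_basis:
  assumes "alg X = gl_on I"
  shows "weight_basis X (I \<times> I) (\<lambda>(a, b). \<rho> a - \<epsilon> b) (\<lambda>(a, b). isl a = isl b)
    (\<lambda>(a, b) A. L A a b) (\<lambda>(a, b). L' (munit a b))"
proof -
  have "weight_basis X (I \<times> I) (\<lambda>(a, b). \<rho> a - \<epsilon> b) (\<lambda>(a, b). isl a = isl b)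
    (\<lambda>(a, b) A. L A a b) (\<lambda>s. L' ((\<lambda>(a, b). munit a b) s))"
  proof (rule weight_basisI)
    fix A assume "A \<in> alg X" and 0: "\<And>a b. (a, b) \<in> I \<times> I \<Longrightarrow> L A a b = 0"
    then have "L A \<in> gl_on I" using assms L_gl_on by blast
    with 0 show "L A = 0" by (auto simp: gl_on_def fun_eq_iff)
  next
    fix a b assume "(a, b) \<in> I \<times> I"
    then have "munit a b \<in> gl_on I" by (auto simp: munit_def gl_on_def)
    then show "(case (a, b) of (a, b) \<Rightarrow> munit a b) \<in> gl_on I \<and> L' (case (a, b) of (a, b) \<Rightarrow> munit a b) \<in> alg X"
      using L_gl_on assms by simp
  qed (auto simp: munit_def split: if_splits)
  then show ?thesis by (simp add: case_prod_unfold)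
qed

end

section \<open>The super exterior square and the orthosymplectic algebras\<close>

definition ix_sgn :: "ix \<Rightarrow> real" where
  "ix_sgn a = (if isl a then 1 else - 1)"

lemma ix_sgn_square [simp]: "ix_sgn a * ix_sgn a = 1"
  by (simp add: ix_sgn_def)

lemma par_sgn: "(if isl a = isl b then 1 else - 1) = ix_sgn a * ix_sgn b"
  by (auto simp: ix_sgn_def)

definition ix_less :: "ix \<Rightarrow> ix \<Rightarrow> bool" where
  "ix_less a b \<longleftrightarrow> (case (a, b) of (Inl i, Inl j) \<Rightarrow> i < j | (Inl i, Inr j) \<Rightarrow> True
     | (Inr i, Inl j) \<Rightarrow> False | (Inr i, Inr j) \<Rightarrow> i < j)"

lemma ix_less_irrefl [simp]: "\<not> ix_less a a"
  by (cases a) (auto simp: ix_less_def)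

lemma ix_less_linear: "a \<noteq> b \<Longrightarrow> ix_less a b \<or> ix_less b a"
  by (cases a; cases b) (auto simp: ix_less_def)

lemma ix_less_asym: "ix_less a b \<Longrightarrow> \<not> ix_less b a"
  by (cases a; cases b) (auto simp: ix_less_def)

text \<open>The diagonal pairs occur for odd indices only: the super exterior square of an odd line is its
  symmetric square.\<close>

definition ext_pairs :: "ix set \<Rightarrow> (ix \<times> ix) set" where
  "ext_pairs I = {(a, b) \<in> I \<times> I. ix_less a b \<or> a = b \<and> \<not> isl a}"

text \<open>Half of all ordered pairs, with a diagonal correction by sign, since diagonal pairs are
  missing for even and present for odd indices. For \<open>h\<close> carrying the parity signs this
  is the super version of the character formula for the exterior square, the diagonal sum being the
  second Adams operation.\<close>

lemma sum_ext_pairs: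
  fixes h :: "ix \<Rightarrow> ix \<Rightarrow> real"
  assumes I: "finite I" and sym: "\<And>a b. h a b = h b a"
  shows "(\<Sum>(a, b)\<in>ext_pairs I. h a b) = ((\<Sum>a\<in>I. \<Sum>b\<in>I. h a b) - (\<Sum>a\<in>I. ix_sgn a * h a a)) / 2"
proof -
  let ?l = "{(a, b) \<in> I \<times> I. ix_less a b}" and ?g = "{(a, b) \<in> I \<times> I. ix_less b a}"
    and ?d = "{(a, b) \<in> I \<times> I. a = b}" and ?o = "{(a, b) \<in> I \<times> I. a = b \<and> \<not> isl a}"
  have fin: "finite ?l" "finite ?g" "finite ?d" "finite ?o"
    by (rule finite_subset[of _ "I \<times> I"]; use I in auto)+
  have lg: "(\<Sum>(a, b)\<in>?g. h a b) = (\<Sum>(a, b)\<in>?l. h a b)"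
    by (rule sum.reindex_bij_witness[of _ prod.swap prod.swap]) (auto simp: sym)
  have d: "(\<Sum>(a, b)\<in>?d. h a b) = (\<Sum>a\<in>I. h a a)"
    by (rule sum.reindex_bij_witness[of _ "\<lambda>a. (a, a)" fst]) auto
  have o: "(\<Sum>(a, b)\<in>?o. h a b) = (\<Sum>a\<in>I. if isl a then 0 else h a a)"
  proof -
    have "(\<Sum>(a, b)\<in>?o. h a b) = (\<Sum>a\<in>{a \<in> I. \<not> isl a}. h a a)"
      by (rule sum.reindex_bij_witness[of _ "\<lambda>a. (a, a)" fst]) auto
    also have "\<dots> = (\<Sum>a\<in>I. if \<not> isl a then h a a else 0)"
      by (rule sum.inter_filter[OF I])
    finally show ?thesis by (simp add: if_distrib cong: if_cong) (rule sum.cong, auto)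
  qed
  have "ext_pairs I = ?l \<union> ?o" by (auto simp: ext_pairs_def)
  then have 1: "(\<Sum>(a, b)\<in>ext_pairs I. h a b) = (\<Sum>(a, b)\<in>?l. h a b) + (\<Sum>(a, b)\<in>?o. h a b)"
    using fin by (simp only:) (rule sum.union_disjoint, auto)
  have "sum f (A \<union> (B \<union> C)) = sum f A + (sum f B + sum f C)"
    if "finite A" "finite B" "finite C" "A \<inter> (B \<union> C) = {}" "B \<inter> C = {}"
    for A B C and f :: "ix \<times> ix \<Rightarrow> real"
    using that by (simp add: sum.union_disjoint)
  note un = this[OF fin(1,2,3)]
  have split: "I \<times> I = ?l \<union> (?g \<union> ?d)" using ix_less_linear by auto
  have dis: "?l \<inter> (?g \<union> ?d) = {}" "?g \<inter> ?d = {}"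
    using ix_less_asym by auto
  have "(\<Sum>(a, b)\<in>I \<times> I. h a b) = (\<Sum>(a, b)\<in>?l. h a b) + ((\<Sum>(a, b)\<in>?g. h a b) + (\<Sum>(a, b)\<in>?d. h a b))"
    by (subst split) (rule un[OF dis])
  then have 2: "(\<Sum>a\<in>I. \<Sum>b\<in>I. h a b) = 2 * (\<Sum>(a, b)\<in>?l. h a b) + (\<Sum>a\<in>I. h a a)"
    using lg d by (simp add: sum.cartesian_product)
  have "(\<Sum>a\<in>I. h a a) - (\<Sum>a\<in>I. ix_sgn a * h a a) = 2 * (\<Sum>a\<in>I. if isl a then 0 else h a a)"
    unfolding sum_distrib_left sum_subtractf[symmetric] by (rule sum.cong) (auto simp: ix_sgn_def)
  with 1 2 o show ?thesis by simp
qed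

text \<open>The osp condition on \<open>A\<close>, read on the bilinear form with matrix
  \<open>G A\<close>: skew on the even-even block, symmetric on the odd-odd and the mixed
  blocks.\<close>

definition ext_sgn :: "ix \<Rightarrow> ix \<Rightarrow> complex" where
  "ext_sgn i j = (if isl i \<and> isl j then - 1 else 1)"

definition ext_sym :: "ix set \<Rightarrow> smat \<Rightarrow> bool" where
  "ext_sym I B \<longleftrightarrow> (\<forall>i\<in>I. \<forall>j\<in>I. B j i = ext_sgn i j * B i j)"

text \<open>An even \<open>h\<close> connects only indices of equal parity, so
  \<open>ext_sgn\<close> does not change along the congruence.\<close>

lemma ext_sym_congruence:
  assumes "ext_sym I B" and h: "\<And>i j. isl i \<noteq> isl j \<Longrightarrow> h i j = 0"
  shows "ext_sym I (mmul I (mmul I (transp h) B) h)"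
  unfolding ext_sym_def
proof (intro ballI)
  fix i j assume "i \<in> I" "j \<in> I"
  have e: "mmul I (mmul I (transp h) B) h i j = (\<Sum>b\<in>I. \<Sum>a\<in>I. h a i * B a b * h b j)" for i j
    by (simp add: mmul_def transp_def sum_distrib_right)
  have "mmul I (mmul I (transp h) B) h j i = (\<Sum>a\<in>I. \<Sum>b\<in>I. h a j * B a b * h b i)"
    unfolding e by (rule sum.swap)
  also have "\<dots> = (\<Sum>a\<in>I. \<Sum>b\<in>I. ext_sgn i j * (h b i * B b a * h a j))"
  proof (intro sum.cong refl)
    fix a b assume ab: "a \<in> I" "b \<in> I"
    show "h a j * B a b * h b i = ext_sgn i j * (h b i * B b a * h a j)"
    proof (cases "h a j = 0 \<or> h b i = 0")
      case False
      then have "isl a = isl j" "isl b = isl i" using h by blast+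
      then have "ext_sgn b a = ext_sgn i j" by (simp add: ext_sgn_def)
      moreover have "B a b = ext_sgn b a * B b a" using assms(1) ab unfolding ext_sym_def by blast
      ultimately show ?thesis by simp
    qed auto
  qed
  also have "\<dots> = ext_sgn i j * mmul I (mmul I (transp h) B) h i j"
    by (simp add: e sum_distrib_left)
  finally show "mmul I (mmul I (transp h) B) h j i = ext_sgn i j * mmul I (mmul I (transp h) B) h i j" .
qed

text \<open>For osp only the right weight vectors, the columns of \<open>g\<close>, are supplied;
  the invariant form transports them to left ones. \<open>G_orth\<close> says that the inverse of
  \<open>G\<close> is its transpose, which makes the inverse of the left frame explicit.\<close>

locale form_frame =
  fixes X :: sym_pair and N M :: nat and G g g' :: smat and \<epsilon> :: "ix \<Rightarrow> ix \<Rightarrow> real"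
  assumes idx: "idx X = ixs N M" and alg: "alg X = osp_alg N M G"
    and G_even: "\<And>i j. isl i \<noteq> isl j \<Longrightarrow> G i j = 0"
    and G_sym: "\<And>i j. i \<in> idx X \<Longrightarrow> j \<in> idx X \<Longrightarrow> G i j = (if isl j then 1 else - 1) * G j i"
    and G_orth: "\<And>i j. i \<in> idx X \<Longrightarrow> j \<in> idx X \<Longrightarrow> (\<Sum>l\<in>idx X. G l i * G l j) = (if i = j then 1 else 0)"
      "\<And>i j. i \<in> idx X \<Longrightarrow> j \<in> idx X \<Longrightarrow> (\<Sum>l\<in>idx X. G i l * G j l) = (if i = j then 1 else 0)"
    and g_supp: "g \<in> gl_on (idx X)" "g' \<in> gl_on (idx X)"
    and g_even: "\<And>i j. isl i \<noteq> isl j \<Longrightarrow> g i j = 0" "\<And>i j. isl i \<noteq> isl j \<Longrightarrow> g' i j = 0"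
    and g_inv: "mmul (idx X) g g' = one_on (idx X)" "mmul (idx X) g' g = one_on (idx X)"
    and H_even: "\<And>c i j. c \<in> coords X \<Longrightarrow> isl i \<noteq> isl j \<Longrightarrow> base X c i j = 0"
    and H_supp: "\<And>c. c \<in> coords X \<Longrightarrow> base X c \<in> gl_on (idx X)"
    and H_osp: "\<And>c i j. c \<in> coords X \<Longrightarrow> i \<in> idx X \<Longrightarrow> j \<in> idx X \<Longrightarrow>
      (\<Sum>l\<in>idx X. base X c l i * G l j) = - (\<Sum>l\<in>idx X. G i l * base X c l j)"
    and H_g: "\<And>c i j. c \<in> coords X \<Longrightarrow> i \<in> idx X \<Longrightarrow> j \<in> idx X \<Longrightarrow>
      mmul (idx X) (base X c) g i j = g i j * of_real (\<epsilon> j c)"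
    and \<epsilon>_supp: "\<And>i c. c \<notin> coords X \<Longrightarrow> \<epsilon> i c = 0"
begin

text \<open>The form is cut off at the index set, because the concrete forms have nonzero entries
  beyond it and would not lie in \<open>gl_on\<close>.\<close>

definition Gr :: smat where "Gr i j = (if i \<in> idx X \<and> j \<in> idx X then G i j else 0)"

lemma Gr_gl_on: "Gr \<in> gl_on (idx X)"
  by (auto simp: gl_on_def Gr_def)

lemma Gr_inv: "mmul (idx X) Gr (transp Gr) = one_on (idx X)" "mmul (idx X) (transp Gr) Gr = one_on (idx X)"
proof -
  have "mmul (idx X) Gr (transp Gr) i j = (if i \<in> idx X \<and> j \<in> idx X then \<Sum>l\<in>idx X. G i l * G j l else 0)"
    "mmul (idx X) (transp Gr) Gr i j = (if i \<in> idx X \<and> j \<in> idx X then \<Sum>l\<in>idx X. G l i * G l j else 0)" for i j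
    by (auto simp: mmul_def transp_def Gr_def)
  then show "mmul (idx X) Gr (transp Gr) = one_on (idx X)" "mmul (idx X) (transp Gr) Gr = one_on (idx X)"
    by (auto simp: fun_eq_iff one_on_def G_orth)
qed

lemma fin_idx: "finite (idx X)"
  by (simp add: idx)

lemma subspace_osp_alg: "smat.subspace (osp_alg N M G)"
proof -
  have "(\<Sum>l\<in>J. (A l + B l) * C l) = (\<Sum>l\<in>J. A l * C l) + (\<Sum>l\<in>J. B l * C l)"
    "(\<Sum>l\<in>J. C l * (A l + B l)) = (\<Sum>l\<in>J. C l * A l) + (\<Sum>l\<in>J. C l * B l)"
    "(\<Sum>l\<in>J. (x * A l) * C l) = x * (\<Sum>l\<in>J. A l * C l)"
    "(\<Sum>l\<in>J. C l * (x * A l)) = x * (\<Sum>l\<in>J. C l * A l)"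
    for A B C :: "ix \<Rightarrow> complex" and x and J :: "ix set"
    by (simp_all add: sum.distrib algebra_simps sum_distrib_left)
  note d = this
  have e: "(a + b) + s * (c + e) = (a + s * c) + (b + s * e)"
    "x * a + s * (x * c) = x * (a + s * c)" for a b c e s x :: complex
    by (simp_all add: algebra_simps)
  show ?thesis
    unfolding smat.subspace_def osp_alg_def gl_alg_def mscale_def
    by (auto simp: d e)
qed

lemma osp_alg_iff:
  "A \<in> alg X \<longleftrightarrow> A \<in> gl_on (idx X) \<and> ext_sym (idx X) (mmul (idx X) Gr A)"
proof -
  have *: "(\<Sum>l\<in>idx X. A l i * G l j) + ksign i j * (\<Sum>l\<in>idx X. G i l * A l j) = 0 \<longleftrightarrow>
      mmul (idx X) Gr A j i = ext_sgn i j * mmul (idx X) Gr A i j" if "i \<in> idx X" "j \<in> idx X" for i j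
  proof -
    have 1: "mmul (idx X) Gr A i' j' = (\<Sum>l\<in>idx X. G i' l * A l j')" if "i' \<in> idx X" for i' j'
      using that by (simp add: mmul_def Gr_def)
    have "(\<Sum>l\<in>idx X. A l i * G l j) = (\<Sum>l\<in>idx X. (if isl j then 1 else - 1) * (G j l * A l i))"
    proof (rule sum.cong[OF refl])
      fix l assume "l \<in> idx X"
      then show "A l i * G l j = (if isl j then 1 else - 1) * (G j l * A l i)"
        using G_sym[of l j] that by simp
    qed
    then have "(\<Sum>l\<in>idx X. A l i * G l j) = (if isl j then 1 else - 1) * mmul (idx X) Gr A j i"
      using that by (simp add: 1 sum_distrib_left)
    moreover have "(\<Sum>l\<in>idx X. G i l * A l j) = mmul (idx X) Gr A i j"
      using that by (simp add: 1)
    moreover have "(if isl j then 1 else - 1) * x + ksign i j * y = 0 \<longleftrightarrow> x = ext_sgn i j * y" for x y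
      by (cases "isl i"; cases "isl j") (auto simp: ksign_def ext_sgn_def add_eq_0_iff)
    ultimately show ?thesis by (simp only:)
  qed
  show ?thesis
    unfolding alg osp_alg_def gl_alg_gl_on ext_sym_def idx[symmetric] using * by auto
qed

text \<open>Invariance of the form reads \<open>Gr H = - H\<^sup>T Gr\<close> on the index set for
  \<open>H = base X c\<close>. Hence \<open>g\<^sup>T Gr H = - (H g)\<^sup>T Gr\<close>, and the
  rows of \<open>g\<^sup>T Gr\<close> are left weight vectors with the weights
  \<open>- \<epsilon> i\<close>.\<close>

sublocale frame X "mmul (idx X) (transp g) Gr" "mmul (idx X) (transp Gr) (transp g')" g g' "\<lambda>i. - \<epsilon> i" \<epsilon>
proof
  show "finite (idx X)" by (rule fin_idx)
  show "alg X \<subseteq> gl_on (idx X)" using osp_alg_iff by blast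
  show "smat.subspace (alg X)" unfolding alg by (rule subspace_osp_alg)
  show "mmul (idx X) (transp g) Gr \<in> gl_on (idx X)" "mmul (idx X) (transp Gr) (transp g') \<in> gl_on (idx X)"
    by (intro mmul_gl_on transp_gl_on g_supp Gr_gl_on)+
  show "g \<in> gl_on (idx X)" "g' \<in> gl_on (idx X)" by (rule g_supp)+
  show "mmul (idx X) (transp g) Gr i j = 0" "mmul (idx X) (transp Gr) (transp g') i j = 0" "g i j = 0" "g' i j = 0"
    if "isl i \<noteq> isl j" for i j
  proof -
    have "g a b * Gr a c = 0" "Gr a b * g' c a = 0" if "isl b \<noteq> isl c" for a b c
      using G_even[of a b] G_even[of a c] g_even[of a b] g_even[of c a] that by (auto simp: Gr_def)
    with that show "mmul (idx X) (transp g) Gr i j = 0" "mmul (idx X) (transp Gr) (transp g') i j = 0"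
      by (auto simp: mmul_def transp_def intro!: sum.neutral)
    show "g i j = 0" "g' i j = 0" using g_even that by blast+
  qed
  have "mmul (idx X) (mmul (idx X) (transp g) Gr) (mmul (idx X) (transp Gr) (transp g')) =
      mmul (idx X) (mmul (idx X) (transp g) (mmul (idx X) Gr (transp Gr))) (transp g')"
    by (simp add: mmul_assoc)
  also have "\<dots> = one_on (idx X)"
    by (simp add: Gr_inv mmul_one_right fin_idx transp_gl_on g_supp g_inv flip: transp_mmul)
  finally show "mmul (idx X) (mmul (idx X) (transp g) Gr) (mmul (idx X) (transp Gr) (transp g')) = one_on (idx X)" .
  have "mmul (idx X) (mmul (idx X) (transp Gr) (transp g')) (mmul (idx X) (transp g) Gr) =
      mmul (idx X) (mmul (idx X) (transp Gr) (transp (mmul (idx X) g g'))) Gr"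
    by (simp add: mmul_assoc transp_mmul)
  also have "\<dots> = one_on (idx X)"
    by (simp add: g_inv mmul_one_right fin_idx transp_gl_on Gr_gl_on Gr_inv)
  finally show "mmul (idx X) (mmul (idx X) (transp Gr) (transp g')) (mmul (idx X) (transp g) Gr) = one_on (idx X)" .
  show "mmul (idx X) g g' = one_on (idx X)" "mmul (idx X) g' g = one_on (idx X)" by (rule g_inv)+
  show "base X c i j = 0" if "c \<in> coords X" "isl i \<noteq> isl j" for c i j using H_even that by blast
  show "base X c \<in> gl_on (idx X)" if "c \<in> coords X" for c using H_supp that by blast
  show "mmul (idx X) (mmul (idx X) (transp g) Gr) (base X c) i j = complex_of_real ((- \<epsilon> i) c) * mmul (idx X) (transp g) Gr i j"
    if c: "c \<in> coords X" and ij: "i \<in> idx X" "j \<in> idx X" for c i j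
  proof -
    have "mmul (idx X) Gr (base X c) a j = - mmul (idx X) (transp (base X c)) Gr a j" if "a \<in> idx X" for a
      using H_osp[OF c that ij(2)] that ij by (simp add: mmul_def transp_def Gr_def)
    then have "mmul (idx X) (transp g) (mmul (idx X) Gr (base X c)) i j =
        - mmul (idx X) (transp g) (mmul (idx X) (transp (base X c)) Gr) i j"
      by (simp add: mmul_def[of _ "transp g"] sum_negf)
    also have "mmul (idx X) (transp g) (mmul (idx X) (transp (base X c)) Gr) i j =
        mmul (idx X) (transp (mmul (idx X) (base X c) g)) Gr i j"
      by (simp add: transp_mmul mmul_assoc)
    also have "\<dots> = (\<Sum>l\<in>idx X. transp (mmul (idx X) (base X c) g) i l * Gr l j)"
      by (simp only: mmul_def[of "idx X" "transp (mmul (idx X) (base X c) g)"])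
    also have "\<dots> = (\<Sum>l\<in>idx X. g l i * of_real (\<epsilon> i c) * Gr l j)"
      by (intro sum.cong refl) (simp add: transp_def H_g c ij)
    also have "\<dots> = of_real (\<epsilon> i c) * mmul (idx X) (transp g) Gr i j"
      by (simp add: mmul_def transp_def sum_distrib_left ac_simps)
    finally show ?thesis by (simp add: mmul_assoc)
  qed
  show "mmul (idx X) (base X c) g i j = g i j * complex_of_real (\<epsilon> j c)"
    if "c \<in> coords X" "i \<in> idx X" "j \<in> idx X" for c i j
    using H_g that by blast
  show "(- \<epsilon> i) c = 0" "\<epsilon> i c = 0" if "c \<notin> coords X" for i c using \<epsilon>_supp that by simp_all
qed

text \<open>\<open>L A\<close> is the congruent form \<open>g\<^sup>T (Gr A) g\<close> with
  \<open>g\<close> even and invertible, so \<open>ext_sym_congruence\<close> applies in both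
  directions.\<close>

lemma alg_iff_L:
  assumes A: "A \<in> gl_on (idx X)"
  shows "A \<in> alg X \<longleftrightarrow> ext_sym (idx X) (L A)"
proof -
  let ?B = "mmul (idx X) Gr A"
  have L: "L A = mmul (idx X) (mmul (idx X) (transp g) ?B) g"
    by (simp add: L_def mmul_assoc)
  have "mmul (idx X) (mmul (idx X) (transp g') (L A)) g' =
     mmul (idx X) (mmul (idx X) (transp (mmul (idx X) g g')) ?B) (mmul (idx X) g g')"
    unfolding L by (simp add: mmul_assoc transp_mmul)
  also have "\<dots> = ?B"
    using A by (simp add: g_inv mmul_one_left mmul_one_right fin_idx mmul_gl_on Gr_gl_on)
  finally have B: "?B = mmul (idx X) (mmul (idx X) (transp g') (L A)) g'" ..
  show ?thesis
    using A osp_alg_iff ext_sym_congruence[of "idx X" ?B g] ext_sym_congruence[of "idx X" "L A" g'] g_even B L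
    by metis
qed

lemma osp_weight_basis:
  "\<exists>e. weight_basis X (ext_pairs I) (\<lambda>(a, b). - \<epsilon> a - \<epsilon> b) (\<lambda>(a, b). isl a = isl b)
    (\<lambda>(a, b) A. L A a b) e"
proof -
  \<comment> \<open>The order of the two tests matters: for \<open>a = b\<close> the diagonal entry
    is 1 and not the sum of two contributions.\<close>
  define E where "E = (\<lambda>(a, b) i j. if i = a \<and> j = b then 1 else if i = b \<and> j = a then ext_sgn a b else 0)"
  have S: "ext_pairs I \<subseteq> I \<times> I" by (auto simp: ext_pairs_def)
  have "weight_basis X (ext_pairs I) (\<lambda>(a, b). - \<epsilon> a - \<epsilon> b) (\<lambda>(a, b). isl a = isl b)
    (\<lambda>(a, b) A. L A a b) (\<lambda>s. L' (E s))"
  proof (rule weight_basisI[OF S])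
    fix a b assume ab: "(a, b) \<in> ext_pairs I"
    then have "a \<in> I" "b \<in> I" by (auto simp: ext_pairs_def)
    then have E: "E (a, b) \<in> gl_on I" by (auto simp: E_def gl_on_def)
    have "E (a, b) j i = ext_sgn i j * E (a, b) i j" for i j
    proof (cases "a = b")
      case True
      then have "ext_sgn a a = 1" using ab by (auto simp: ext_pairs_def ext_sgn_def)
      with True show ?thesis by (auto simp: E_def)
    next
      case False
      have E1: "E (a, b) a b = 1" by (simp add: E_def)
      have E2: "E (a, b) b a = ext_sgn a b" using False unfolding E_def by auto
      have c: "ext_sgn b a * ext_sgn a b = 1" by (simp add: ext_sgn_def)
      consider "i = a" "j = b" | "i = b" "j = a" | "\<not> (i = a \<and> j = b)" "\<not> (i = b \<and> j = a)" by blast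
      then show ?thesis
      proof cases
        case 3
        then have "E (a, b) i j = 0" "E (a, b) j i = 0" unfolding E_def by auto
        then show ?thesis by simp
      qed (simp_all only: E1 E2 c mult_1_right)
    qed
    then have "ext_sym I (E (a, b))" unfolding ext_sym_def by blast
    then show "E (a, b) \<in> gl_on I \<and> L' (E (a, b)) \<in> alg X"
      using E alg_iff_L[OF L_gl_on(2)[OF E]] by (simp add: L_L')
    show "- \<epsilon> i - \<epsilon> j = - \<epsilon> a - \<epsilon> b \<and> (isl i \<longleftrightarrow> isl j) = (isl a \<longleftrightarrow> isl b)"
      if "E (a, b) i j \<noteq> 0" for i j
      using that by (auto simp: E_def fun_eq_iff split: if_splits)
    show "E (i, j) a b = (if (a, b) = (i, j) then 1 else 0)" if "(i, j) \<in> ext_pairs I" for i j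
      using that ab ix_less_asym[of a b] by (auto simp: E_def ext_pairs_def)
  next
    fix A assume A: "A \<in> alg X" and 0: "\<And>a b. (a, b) \<in> ext_pairs I \<Longrightarrow> L A a b = 0"
    have Ag: "A \<in> gl_on I" using A alg_sub by blast
    have sym: "L A j i = ext_sgn i j * L A i j" if "i \<in> I" "j \<in> I" for i j
      using alg_iff_L[OF Ag] A that unfolding ext_sym_def by blast
    have "L A i j = 0" if ij: "i \<in> I" "j \<in> I" for i j
    proof -
      consider "(i, j) \<in> ext_pairs I" | "(j, i) \<in> ext_pairs I" | "i = j" "isl i"
        using ij ix_less_linear[of i j] by (auto simp: ext_pairs_def)
      then show ?thesis
      proof cases
        case 2
        then show ?thesis using sym[OF ij(2,1)] 0 by simp
      next
        \<comment> \<open>At an even diagonal position \<open>ext_sgn\<close> is \<open>- 1\<close>,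
          so the entry is its own negative.\<close>
        case 3
        then show ?thesis using sym[OF ij] by (simp add: ext_sgn_def)
      qed (rule 0)
    qed
    moreover have "L A \<in> gl_on I" by (rule L_gl_on(1)[OF Ag])
    ultimately show "L A = 0" by (auto simp: gl_on_def fun_eq_iff)
  qed
  then show ?thesis by blast
qed

end

text \<open>
  The hypothesis \<open>sgn_sum\<close> says that the weights of the representation \<open>V\<close>, counted with sign, are
  \<open>0\<close> with multiplicity \<open>m0\<close> and \<open>\<plusminus> unit_wt J\<close> with multiplicity \<open>d (w J)\<close>.
\<close>

lemma double_sgn_sum:
  fixes \<epsilon> :: "ix \<Rightarrow> ix \<Rightarrow> real" and F :: "(ix \<Rightarrow> real) \<Rightarrow> real"
  assumes D: "finite D" and sgn_sum: "\<And>f. (\<Sum>a\<in>I. ix_sgn a * f (\<epsilon> a)) =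
      m0 * f 0 + d * (\<Sum>J\<in>D. w J * (f (unit_wt J) + f (- unit_wt J)))"
    and F: "F 0 = 0" "\<And>\<alpha>. F' \<alpha> = F \<alpha> + F (- \<alpha>)" and \<tau>: "\<tau> = (\<lambda>\<alpha>. \<alpha>) \<or> \<tau> = uminus"
  shows "(\<Sum>a\<in>I. \<Sum>b\<in>I. ix_sgn a * ix_sgn b * F (\<tau> (\<epsilon> a) - \<epsilon> b)) =
     (\<Sum>J\<in>D. 2 * m0 * d * w J * F' (unit_wt J) + d\<^sup>2 * (w J)\<^sup>2 * F' (unit_wt J + unit_wt J))
     + d\<^sup>2 * (\<Sum>J\<in>D. \<Sum>K\<in>D - {J}. w J * w K * (F' (unit_wt J - unit_wt K) + F' (unit_wt J + unit_wt K)))"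
proof -
  let ?u = unit_wt
  define f where "f \<alpha> = m0 * F \<alpha> + d * (\<Sum>K\<in>D. w K * (F (\<alpha> - ?u K) + F (\<alpha> + ?u K)))" for \<alpha>
  have "(\<Sum>a\<in>I. \<Sum>b\<in>I. ix_sgn a * ix_sgn b * F (\<tau> (\<epsilon> a) - \<epsilon> b)) =
      (\<Sum>a\<in>I. ix_sgn a * (\<Sum>b\<in>I. ix_sgn b * F (\<tau> (\<epsilon> a) - \<epsilon> b)))"
    by (simp add: sum_distrib_left mult.assoc)
  also have "\<dots> = (\<Sum>a\<in>I. ix_sgn a * f (\<tau> (\<epsilon> a)))"
    by (intro sum.cong refl) (simp only: f_def sgn_sum[of "\<lambda>\<beta>. F (\<tau> (\<epsilon> _) - \<beta>)"] diff_0_right diff_minus_eq_add)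
  also have "\<dots> = m0 * f (\<tau> 0) + d * (\<Sum>J\<in>D. w J * (f (\<tau> (?u J)) + f (\<tau> (- ?u J))))"
    by (rule sgn_sum[of "\<lambda>\<alpha>. f (\<tau> \<alpha>)"])
  also have "\<dots> = m0 * f 0 + d * (\<Sum>J\<in>D. w J * (f (?u J) + f (- ?u J)))"
    using \<tau> by (auto simp: add.commute)
  also have "f 0 = d * (\<Sum>K\<in>D. w K * F' (?u K))"
    by (simp add: f_def F add.commute)
  also have "(\<Sum>J\<in>D. w J * (f (?u J) + f (- ?u J))) =
     (\<Sum>J\<in>D. m0 * w J * F' (?u J)) + d * (\<Sum>J\<in>D. \<Sum>K\<in>D. w J * w K * (F' (?u J - ?u K) + F' (?u J + ?u K)))"
  proof -
    have "w J * (f (?u J) + f (- ?u J)) =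
      m0 * w J * F' (?u J) + d * (\<Sum>K\<in>D. w J * w K * (F' (?u J - ?u K) + F' (?u J + ?u K)))" for J
    proof -
      have "f (?u J) + f (- ?u J) = m0 * F' (?u J) + d * (\<Sum>K\<in>D. w K *
          (F (?u J - ?u K) + F (?u J + ?u K) + (F (- ?u J - ?u K) + F (- ?u J + ?u K))))"
        by (simp add: f_def F(2) sum.distrib algebra_simps)
      also have "\<dots> = m0 * F' (?u J) + d * (\<Sum>K\<in>D. w K * (F' (?u J - ?u K) + F' (?u J + ?u K)))"
      proof -
        have "- (?u J + ?u K) = - ?u J - ?u K" "- (?u J - ?u K) = - ?u J + ?u K" for K by simp_all
        then have "F' (?u J - ?u K) + F' (?u J + ?u K) =
            F (?u J - ?u K) + F (?u J + ?u K) + (F (- ?u J - ?u K) + F (- ?u J + ?u K))" for K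
          by (simp only: F(2))
        then show ?thesis by (simp only:)
      qed
      finally show ?thesis by (simp add: distrib_left sum_distrib_left mult_ac)
    qed
    then show ?thesis by (simp add: sum.distrib sum_distrib_left)
  qed
  also have "(\<Sum>J\<in>D. \<Sum>K\<in>D. w J * w K * (F' (?u J - ?u K) + F' (?u J + ?u K))) =
     (\<Sum>J\<in>D. (w J)\<^sup>2 * F' (?u J + ?u J) + (\<Sum>K\<in>D - {J}. w J * w K * (F' (?u J - ?u K) + F' (?u J + ?u K))))"
  proof (rule sum.cong[OF refl])
    fix J assume "J \<in> D"
    then show "(\<Sum>K\<in>D. w J * w K * (F' (?u J - ?u K) + F' (?u J + ?u K))) =
      (w J)\<^sup>2 * F' (?u J + ?u J) + (\<Sum>K\<in>D - {J}. w J * w K * (F' (?u J - ?u K) + F' (?u J + ?u K)))"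
    proof (subst sum.remove[OF D])
      have "F' (?u J - ?u J) = 0" by (simp add: F)
      then show "w J * w J * (F' (?u J - ?u J) + F' (?u J + ?u J))
          + (\<Sum>K\<in>D - {J}. w J * w K * (F' (?u J - ?u K) + F' (?u J + ?u K))) =
        (w J)\<^sup>2 * F' (?u J + ?u J) + (\<Sum>K\<in>D - {J}. w J * w K * (F' (?u J - ?u K) + F' (?u J + ?u K)))"
        by (simp only: add_0 power2_eq_square)
    qed
  qed
  also have "m0 * (d * (\<Sum>K\<in>D. w K * F' (?u K))) + d * ((\<Sum>J\<in>D. m0 * w J * F' (?u J))
        + d * (\<Sum>J\<in>D. (w J)\<^sup>2 * F' (?u J + ?u J)
           + (\<Sum>K\<in>D - {J}. w J * w K * (F' (?u J - ?u K) + F' (?u J + ?u K))))) =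
     (\<Sum>J\<in>D. 2 * m0 * d * w J * F' (?u J) + d\<^sup>2 * (w J)\<^sup>2 * F' (?u J + ?u J))
     + d\<^sup>2 * (\<Sum>J\<in>D. \<Sum>K\<in>D - {J}. w J * w K * (F' (?u J - ?u K) + F' (?u J + ?u K)))"
  proof -
    have "m0 * (d * (\<Sum>K\<in>D. w K * a K)) + d * ((\<Sum>J\<in>D. m0 * w J * a J)
        + d * (\<Sum>J\<in>D. (w J)\<^sup>2 * b J + (\<Sum>K\<in>D - {J}. w J * w K * c J K))) =
      (\<Sum>J\<in>D. 2 * m0 * d * w J * a J + d\<^sup>2 * (w J)\<^sup>2 * b J) + d\<^sup>2 * (\<Sum>J\<in>D. \<Sum>K\<in>D - {J}. w J * w K * c J K)"
      for a b :: "ix \<Rightarrow> real" and c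
      by (simp add: sum.distrib distrib_left power2_eq_square sum_distrib_left mult_ac)
    then show ?thesis .
  qed
  finally show ?thesis .
qed

text \<open>In V tensor its dual, the weight \<open>unit_wt J\<close> arises from
  \<open>unit_wt J\<close> and 0 in two ways, hence \<open>2 * m0 * d * w J\<close>, and its double
  from \<open>unit_wt J\<close> and \<open>- unit_wt J\<close> in one way, hence
  \<open>d\<^sup>2 * (w J)\<^sup>2\<close>. The pair terms give
  \<open>k = - d\<^sup>2\<close>.\<close>

lemma gl_root_data_BC:
  assumes "frame X p p' g g' \<epsilon> \<epsilon>" "alg X = gl_on (idx X)" "finite (coords X)" "\<And>J. w J \<noteq> 0" "d \<noteq> 0" "k = - d\<^sup>2"
    and sgn_sum: "\<And>f. (\<Sum>a\<in>idx X. ix_sgn a * f (\<epsilon> a)) =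
      m0 * f 0 + d * (\<Sum>J\<in>coords X. w J * (f (unit_wt J) + f (- unit_wt J)))"
  shows "root_data X k w 1 (\<lambda>J. 2 * m0 * d * w J) (\<lambda>J. d\<^sup>2 * (w J)\<^sup>2)"
proof -
  interpret frame X p p' g g' \<epsilon> \<epsilon> by fact
  interpret weight_basis X "I \<times> I" "\<lambda>(a, b). \<epsilon> a - \<epsilon> b" "\<lambda>(a, b). isl a = isl b" "\<lambda>(a, b) A. L A a b"
      "\<lambda>(a, b). L' (munit a b)"
    by (rule gl_weight_basis[OF assms(2)])
  show ?thesis
  proof
    fix F F' :: "(ix \<Rightarrow> real) \<Rightarrow> real" assume F: "F 0 = 0" "\<And>\<alpha>. F' \<alpha> = F \<alpha> + F (- \<alpha>)"
    have "(\<Sum>\<alpha>\<in>restricted_roots X. root_mult X \<alpha> * F \<alpha>) = (\<Sum>a\<in>I. \<Sum>b\<in>I. ix_sgn a * ix_sgn b * F (\<epsilon> a - \<epsilon> b))"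
      by (simp add: sum_restricted_roots[of F, OF F(1)] case_prod_unfold par_sgn sum.cartesian_product)
    also note double_sgn_sum[OF assms(3) sgn_sum F, of "\<lambda>\<alpha>. \<alpha>", OF disjI1[OF refl]]
    finally show "(\<Sum>\<alpha>\<in>restricted_roots X. root_mult X \<alpha> * F \<alpha>) =
       (\<Sum>J\<in>coords X. 2 * m0 * d * w J * F' (unit_wt J) + d\<^sup>2 * (w J)\<^sup>2 * F' (unit_wt J + unit_wt J))
       - k * (\<Sum>J\<in>coords X. \<Sum>K\<in>coords X - {J}. w J * w K *
           (F' (unit_wt J - unit_wt K) + 1 * F' (unit_wt J + unit_wt K)))"
      by (simp only: assms(6) mult_1 mult_minus_left diff_minus_eq_add)
  qed (use assms finite_restricted_roots in auto)
qed

text \<open>Here V has only the weights \<open>unit_wt J\<close>, so the roots are differences, with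
  multiplicity \<open>w J * w K\<close>. Matching this with \<open>- 2 * k * w J * w K\<close>
  forces \<open>k = - 1 / 2\<close>.\<close>

lemma gl_root_data_A:
  assumes "frame X p p' g g' \<epsilon> \<epsilon>" "alg X = gl_on (idx X)" "finite (coords X)" "\<And>J. w J \<noteq> 0"
    and sgn_sum: "\<And>f. (\<Sum>a\<in>idx X. ix_sgn a * f (\<epsilon> a)) = (\<Sum>J\<in>coords X. w J * f (unit_wt J))"
  shows "root_data X (- 1 / 2) w 0 (\<lambda>_. 0) (\<lambda>_. 0)"
proof -
  interpret frame X p p' g g' \<epsilon> \<epsilon> by fact
  interpret weight_basis X "I \<times> I" "\<lambda>(a, b). \<epsilon> a - \<epsilon> b" "\<lambda>(a, b). isl a = isl b" "\<lambda>(a, b) A. L A a b"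
      "\<lambda>(a, b). L' (munit a b)"
    by (rule gl_weight_basis[OF assms(2)])
  let ?D = "coords X"
  show ?thesis
  proof
    fix F F' :: "(ix \<Rightarrow> real) \<Rightarrow> real" assume F: "F 0 = 0" "\<And>\<alpha>. F' \<alpha> = F \<alpha> + F (- \<alpha>)"
    let ?h = "\<lambda>J K. w J * w K * F (unit_wt J - unit_wt K)"
    have "(\<Sum>\<alpha>\<in>restricted_roots X. root_mult X \<alpha> * F \<alpha>) = (\<Sum>a\<in>I. ix_sgn a * (\<Sum>b\<in>I. ix_sgn b * F (\<epsilon> a - \<epsilon> b)))"
      by (simp add: sum_restricted_roots[of F, OF F(1)] case_prod_unfold par_sgn sum.cartesian_product
          sum_distrib_left mult.assoc)
    also have "\<dots> = (\<Sum>J\<in>?D. \<Sum>K\<in>?D. ?h J K)"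
    proof -
      have "(\<Sum>b\<in>I. ix_sgn b * F (\<alpha> - \<epsilon> b)) = (\<Sum>K\<in>?D. w K * F (\<alpha> - unit_wt K))" for \<alpha>
        by (rule sgn_sum[of "\<lambda>\<beta>. F (\<alpha> - \<beta>)"])
      then have "(\<Sum>a\<in>I. ix_sgn a * (\<Sum>b\<in>I. ix_sgn b * F (\<epsilon> a - \<epsilon> b))) =
          (\<Sum>J\<in>?D. w J * (\<Sum>K\<in>?D. w K * F (unit_wt J - unit_wt K)))"
        by (simp only: sgn_sum[of "\<lambda>\<alpha>. \<Sum>K\<in>?D. w K * F (\<alpha> - unit_wt K)"])
      then show ?thesis by (simp only: sum_distrib_left mult.assoc)
    qed
    also have "\<dots> = (\<Sum>J\<in>?D. \<Sum>K\<in>?D - {J}. ?h J K)"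
      by (intro sum.cong refl sum.mono_neutral_right) (use assms(3) F in auto)
    also have "\<dots> = (\<Sum>J\<in>?D. \<Sum>K\<in>?D - {J}. (?h J K + ?h K J) / 2)"
      by (rule sum_symmetrize_off_diagonal[OF assms(3)])
    also have "\<dots> = (\<Sum>J\<in>?D. \<Sum>K\<in>?D - {J}. 1 / 2 * (w J * w K * F' (unit_wt J - unit_wt K)))"
      by (intro sum.cong refl) (simp add: F(2) algebra_simps)
    finally show "(\<Sum>\<alpha>\<in>restricted_roots X. root_mult X \<alpha> * F \<alpha>) =
       (\<Sum>J\<in>?D. 0 * F' (unit_wt J) + 0 * F' (unit_wt J + unit_wt J))
       - (- 1 / 2) * (\<Sum>J\<in>?D. \<Sum>K\<in>?D - {J}. w J * w K *
           (F' (unit_wt J - unit_wt K) + 0 * F' (unit_wt J + unit_wt K)))"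
      by (simp only: sum_distrib_left) (simp add: sum_negf)
  qed (use assms finite_restricted_roots in auto)
qed

text \<open>Half of the double sum over the weights of V, whence \<open>k = - d\<^sup>2 / 2\<close>,
  minus half of the sum over the doubled weights. The latter affects only the multiplicity of
  \<open>unit_wt J + unit_wt J\<close>, by \<open>- d * w J / 2\<close>.\<close>

lemma osp_root_data:
  assumes "form_frame X N M G g g' \<epsilon>" "finite (coords X)" "\<And>J. w J \<noteq> 0" "d \<noteq> 0" "k = - d\<^sup>2 / 2"
    and sgn_sum: "\<And>f. (\<Sum>a\<in>idx X. ix_sgn a * f (\<epsilon> a)) =
      m0 * f 0 + d * (\<Sum>J\<in>coords X. w J * (f (unit_wt J) + f (- unit_wt J)))"
  shows "root_data X k w 1 (\<lambda>J. m0 * d * w J) (\<lambda>J. (d\<^sup>2 * (w J)\<^sup>2 - d * w J) / 2)"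
proof -
  interpret form_frame X N M G g g' \<epsilon> by fact
  obtain e where "weight_basis X (ext_pairs I) (\<lambda>(a, b). - \<epsilon> a - \<epsilon> b) (\<lambda>(a, b). isl a = isl b)
    (\<lambda>(a, b) A. L A a b) e"
    using osp_weight_basis by blast
  then interpret weight_basis X "ext_pairs I" "\<lambda>(a, b). - \<epsilon> a - \<epsilon> b" "\<lambda>(a, b). isl a = isl b"
    "\<lambda>(a, b) A. L A a b" e .
  let ?D = "coords X"
  show ?thesis
  proof
    fix F F' :: "(ix \<Rightarrow> real) \<Rightarrow> real" assume F: "F 0 = 0" "\<And>\<alpha>. F' \<alpha> = F \<alpha> + F (- \<alpha>)"
    let ?h = "\<lambda>a b. ix_sgn a * ix_sgn b * F (- \<epsilon> a - \<epsilon> b)"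
    have "(\<Sum>\<alpha>\<in>restricted_roots X. root_mult X \<alpha> * F \<alpha>) = (\<Sum>(a, b)\<in>ext_pairs I. ?h a b)"
      by (simp add: sum_restricted_roots[of F, OF F(1)] case_prod_unfold par_sgn)
    also have "\<dots> = ((\<Sum>a\<in>I. \<Sum>b\<in>I. ?h a b) - (\<Sum>a\<in>I. ix_sgn a * ?h a a)) / 2"
    proof (rule sum_ext_pairs[OF fin])
      fix a b
      have "- \<epsilon> a - \<epsilon> b = - \<epsilon> b - \<epsilon> a" by simp
      then show "?h a b = ?h b a" by (metis mult.commute)
    qed
    also have "(\<Sum>a\<in>I. ix_sgn a * ?h a a) = (\<Sum>a\<in>I. ix_sgn a * F (- (\<epsilon> a + \<epsilon> a)))"
    proof -
      have "- \<epsilon> a - \<epsilon> a = - (\<epsilon> a + \<epsilon> a)" for a by simp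
      then show ?thesis by (simp only: ix_sgn_square mult_1)
    qed
    also have "\<dots> = d * (\<Sum>J\<in>?D. w J * F' (unit_wt J + unit_wt J))"
      by (subst sgn_sum) (simp add: F add.commute)
    also have "(\<Sum>a\<in>I. \<Sum>b\<in>I. ?h a b) =
     (\<Sum>J\<in>?D. 2 * m0 * d * w J * F' (unit_wt J) + d\<^sup>2 * (w J)\<^sup>2 * F' (unit_wt J + unit_wt J))
     + d\<^sup>2 * (\<Sum>J\<in>?D. \<Sum>K\<in>?D - {J}. w J * w K * (F' (unit_wt J - unit_wt K) + F' (unit_wt J + unit_wt K)))"
      by (rule double_sgn_sum[OF assms(2) sgn_sum F, of uminus, OF disjI2[OF refl]])
    also have "((\<Sum>J\<in>?D. 2 * m0 * d * w J * F' (unit_wt J) + d\<^sup>2 * (w J)\<^sup>2 * F' (unit_wt J + unit_wt J))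
       + d\<^sup>2 * (\<Sum>J\<in>?D. \<Sum>K\<in>?D - {J}. w J * w K * (F' (unit_wt J - unit_wt K) + F' (unit_wt J + unit_wt K)))
       - d * (\<Sum>J\<in>?D. w J * F' (unit_wt J + unit_wt J))) / 2 =
       (\<Sum>J\<in>?D. m0 * d * w J * F' (unit_wt J) + (d\<^sup>2 * (w J)\<^sup>2 - d * w J) / 2 * F' (unit_wt J + unit_wt J))
       - k * (\<Sum>J\<in>?D. \<Sum>K\<in>?D - {J}. w J * w K *
           (F' (unit_wt J - unit_wt K) + 1 * F' (unit_wt J + unit_wt K)))"
    proof -
      have "((\<Sum>J\<in>?D. 2 * m0 * d * w J * a J + d\<^sup>2 * (w J)\<^sup>2 * b J) + d\<^sup>2 * T - d * (\<Sum>J\<in>?D. w J * b J)) / 2 =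
        (\<Sum>J\<in>?D. m0 * d * w J * a J + (d\<^sup>2 * (w J)\<^sup>2 - d * w J) / 2 * b J) - (- d\<^sup>2 / 2) * T"
        for a b :: "ix \<Rightarrow> real" and T
      proof -
        have "(\<Sum>J\<in>?D. 2 * m0 * d * w J * a J + d\<^sup>2 * (w J)\<^sup>2 * b J) - d * (\<Sum>J\<in>?D. w J * b J) =
          2 * (\<Sum>J\<in>?D. m0 * d * w J * a J + (d\<^sup>2 * (w J)\<^sup>2 - d * w J) / 2 * b J)"
          unfolding sum_distrib_left sum_subtractf[symmetric] by (intro sum.cong refl) (simp add: field_simps)
        then show ?thesis by simp
      qed
      then show ?thesis by (simp only: mult_1 assms(5))
    qed
    finally show "(\<Sum>\<alpha>\<in>restricted_roots X. root_mult X \<alpha> * F \<alpha>) =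
       (\<Sum>J\<in>?D. m0 * d * w J * F' (unit_wt J) + (d\<^sup>2 * (w J)\<^sup>2 - d * w J) / 2 * F' (unit_wt J + unit_wt J))
       - k * (\<Sum>J\<in>?D. \<Sum>K\<in>?D - {J}. w J * w K *
           (F' (unit_wt J - unit_wt K) + 1 * F' (unit_wt J + unit_wt K)))" .
  qed (use assms finite_restricted_roots in auto)
qed

section \<open>The four series\<close>

text \<open>
  \<open>base c\<close> sends the basis vector \<open>a\<close> with \<open>\<kappa> a = c\<close> and \<open>\<sigma> a \<noteq> 0\<close> to \<open>\<eta> a\<close> times the basis
  vector \<open>\<tau> a\<close>; hence the vectors \<open>a + \<sigma> a \<eta> a (\<tau> a)\<close> have the weights \<open>\<sigma> a (unit_wt (\<kappa> a))\<close>.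
\<close>

locale pairing =
  fixes X :: sym_pair and N M :: nat and \<tau> :: "ix \<Rightarrow> ix" and \<sigma> :: "ix \<Rightarrow> real" and \<eta> :: "ix \<Rightarrow> complex"
    and \<kappa> :: "ix \<Rightarrow> ix"
  assumes idx: "idx X = ixs N M"
    and \<tau>: "\<And>a. a \<in> idx X \<Longrightarrow> \<tau> a \<in> idx X" "\<And>a. a \<in> idx X \<Longrightarrow> \<tau> (\<tau> a) = a" "\<And>a. isl (\<tau> a) = isl a"
    and \<sigma>: "\<And>a. \<sigma> a = 1 \<or> \<sigma> a = - 1 \<or> \<sigma> a = 0" "\<And>a. a \<in> idx X \<Longrightarrow> \<sigma> (\<tau> a) = - \<sigma> a"
    and \<tau>_fixed: "\<And>a. \<sigma> a = 0 \<Longrightarrow> \<tau> a = a"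
    and \<eta>: "\<And>a. a \<in> idx X \<Longrightarrow> \<sigma> a \<noteq> 0 \<Longrightarrow> \<eta> a * \<eta> (\<tau> a) = 1"
    and \<kappa>: "\<And>a. a \<in> idx X \<Longrightarrow> \<kappa> (\<tau> a) = \<kappa> a" "\<And>a. a \<in> idx X \<Longrightarrow> \<sigma> a \<noteq> 0 \<Longrightarrow> \<kappa> a \<in> coords X"
    and base: "\<And>c b a. c \<in> coords X \<Longrightarrow>
      base X c b a = (if a \<in> idx X \<and> b = \<tau> a \<and> \<kappa> a = c \<and> \<sigma> a \<noteq> 0 then \<eta> a else 0)"
begin

abbreviation "J \<equiv> idx X"

definition \<epsilon> :: "ix \<Rightarrow> ix \<Rightarrow> real" where
  "\<epsilon> a c = (if a \<in> J \<and> c = \<kappa> a then \<sigma> a else 0)"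

definition \<gamma> :: "ix \<Rightarrow> complex" where
  "\<gamma> a = of_real (\<sigma> a) * \<eta> a"

definition g :: smat where
  "g b a = (if a \<in> J then (if b = a then 1 else 0) + \<gamma> a * (if b = \<tau> a then 1 else 0) else 0)"

text \<open>On paired indices \<open>g\<close> is \<open>1 + N\<close> with
  \<open>N\<^sup>2 = - 1\<close>, because \<open>\<gamma> a * \<gamma> (\<tau> a) = - 1\<close>; so
  \<open>(1 + N) (1 - N) = 2\<close>, which explains the factor 1/2. On fixed indices
  \<open>\<gamma>\<close> is zero and both matrices are the identity.\<close>

definition g' :: smat where
  "g' b a = (if a \<in> J then (if \<sigma> a = 0 then 1 else 1 / 2) *
     ((if b = a then 1 else 0) - \<gamma> a * (if b = \<tau> a then 1 else 0)) else 0)"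

lemma fin_J: "finite J"
  by (simp add: idx)

lemma \<gamma>_\<tau>: "a \<in> J \<Longrightarrow> \<gamma> a * \<gamma> (\<tau> a) = (if \<sigma> a = 0 then 0 else - 1)"
  using \<sigma>(1)[of a] \<sigma>(2)[of a] \<eta>[of a] by (auto simp: \<gamma>_def)

lemma \<tau>_eq: "a \<in> J \<Longrightarrow> b \<in> J \<Longrightarrow> b = \<tau> a \<longleftrightarrow> \<tau> b = a"
  using \<tau>(2) by metis

lemma sum_g:
  assumes "a \<in> J"
  shows "(\<Sum>l\<in>J. f l * g l a) = f a + \<gamma> a * f (\<tau> a)"
    "(\<Sum>l\<in>J. f l * g' l a) = (if \<sigma> a = 0 then 1 else 1 / 2) * (f a - \<gamma> a * f (\<tau> a))"
proof -
  have *: "(\<Sum>l\<in>J. f l * (if l = x then 1 else 0)) = f x" if "x \<in> J" for x and f :: "ix \<Rightarrow> complex"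
    using that fin_J by (simp add: if_distrib[where f = "\<lambda>x. _ * x"] cong: if_cong)
  have "(\<Sum>l\<in>J. f l * g l a) = (\<Sum>l\<in>J. f l * (if l = a then 1 else 0)) + \<gamma> a * (\<Sum>l\<in>J. f l * (if l = \<tau> a then 1 else 0))"
    using assms by (simp only: g_def if_True distrib_left sum.distrib sum_distrib_left mult.left_commute)
  then show "(\<Sum>l\<in>J. f l * g l a) = f a + \<gamma> a * f (\<tau> a)"
    using assms \<tau>(1) by (simp only: *)
  have "(\<Sum>l\<in>J. f l * g' l a) = (if \<sigma> a = 0 then 1 else 1 / 2) *
     ((\<Sum>l\<in>J. f l * (if l = a then 1 else 0)) - \<gamma> a * (\<Sum>l\<in>J. f l * (if l = \<tau> a then 1 else 0)))"
    using assms by (simp only: g'_def if_True right_diff_distrib sum_subtractf sum_distrib_left mult.left_commute)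
  then show "(\<Sum>l\<in>J. f l * g' l a) = (if \<sigma> a = 0 then 1 else 1 / 2) * (f a - \<gamma> a * f (\<tau> a))"
    using assms \<tau>(1) by (simp only: *)
qed

lemma g_gl_on: "g \<in> gl_on J" "g' \<in> gl_on J"
  using \<tau>(1) by (auto simp: gl_on_def g_def g'_def)

lemma g_parity: "isl i \<noteq> isl j \<Longrightarrow> g i j = 0" "isl i \<noteq> isl j \<Longrightarrow> g' i j = 0"
  using \<tau>(3)[of j] by (auto simp: g_def g'_def)

lemma \<sigma>_\<tau>_0: "a \<in> J \<Longrightarrow> \<sigma> (\<tau> a) = 0 \<longleftrightarrow> \<sigma> a = 0"
  using \<sigma>(2) by simp

lemma g_inverse: "mmul J g g' = one_on J" "mmul J g' g = one_on J"
proof -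
  have "mmul J g g' b a = one_on J b a \<and> mmul J g' g b a = one_on J b a" for a b
  proof (cases "a \<in> J")
    case False
    then show ?thesis by (auto simp: mmul_def one_on_def g_def g'_def)
  next
    case True
    let ?e = "\<lambda>x. if b = x then 1 else 0 :: complex"
    have t: "\<tau> a \<in> J" "\<tau> (\<tau> a) = a" using True \<tau> by auto
    have *: "mmul J g g' b a = (if \<sigma> a = 0 then 1 else 1 / 2) * (?e a + \<gamma> a * ?e (\<tau> a) - \<gamma> a * (?e (\<tau> a) + \<gamma> (\<tau> a) * ?e a))"
      unfolding mmul_def sum_g[OF True] using True t by (simp add: g_def)
    have **: "mmul J g' g b a = (if \<sigma> a = 0 then 1 else 1 / 2) * (?e a - \<gamma> a * ?e (\<tau> a) + \<gamma> a * (?e (\<tau> a) - \<gamma> (\<tau> a) * ?e a))"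
      unfolding mmul_def sum_g[OF True] using True t \<sigma>_\<tau>_0[OF True] by (simp add: g'_def algebra_simps)
    have "?e a + \<gamma> a * ?e (\<tau> a) - \<gamma> a * (?e (\<tau> a) + \<gamma> (\<tau> a) * ?e a) = (1 - \<gamma> a * \<gamma> (\<tau> a)) * ?e a"
      "?e a - \<gamma> a * ?e (\<tau> a) + \<gamma> a * (?e (\<tau> a) - \<gamma> (\<tau> a) * ?e a) = (1 - \<gamma> a * \<gamma> (\<tau> a)) * ?e a"
      by (simp_all add: algebra_simps)
    then show ?thesis unfolding * ** using True by (auto simp: \<gamma>_\<tau> one_on_def)
  qed
  then show "mmul J g g' = one_on J" "mmul J g' g = one_on J" by (auto simp: fun_eq_iff)
qed

lemma base_gl_on: "c \<in> coords X \<Longrightarrow> base X c \<in> gl_on J"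
  using \<tau>(1) by (auto simp: gl_on_def base)

lemma base_parity: "c \<in> coords X \<Longrightarrow> isl i \<noteq> isl j \<Longrightarrow> base X c i j = 0"
  using \<tau>(3)[of j] by (auto simp: base)

lemma base_g:
  assumes c: "c \<in> coords X" and ij: "i \<in> J" "j \<in> J"
  shows "mmul J (base X c) g i j = g i j * of_real (\<epsilon> j c)"
proof -
  have "mmul J (base X c) g i j = base X c i j + \<gamma> j * base X c i (\<tau> j)"
    unfolding mmul_def by (rule sum_g[OF ij(2)])
  also have "\<dots> = g i j * of_real (\<epsilon> j c)"
    using \<sigma>(1)[of j] \<sigma>(2)[OF ij(2)] \<eta>[OF ij(2)] \<kappa>(1)[OF ij(2)] ij \<tau>(1,2)[OF ij(2)]
    by (auto simp: base[OF c] g_def \<epsilon>_def \<gamma>_def)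
  finally show ?thesis .
qed

lemma sum_base:
  assumes "c \<in> coords X" "j \<in> J"
  shows "(\<Sum>l\<in>J. f l * base X c l j) = f (\<tau> j) * (if \<kappa> j = c \<and> \<sigma> j \<noteq> 0 then \<eta> j else 0)"
proof -
  have "(\<Sum>l\<in>J. f l * base X c l j) = (\<Sum>l\<in>{\<tau> j}. f l * base X c l j)"
    using \<tau>(1)[OF assms(2)] fin_J by (intro sum.mono_neutral_right) (auto simp: base[OF assms(1)])
  then show ?thesis using assms by (auto simp: base[OF assms(1)])
qed

lemma g'_base:
  assumes c: "c \<in> coords X" and ij: "i \<in> J" "j \<in> J"
  shows "mmul J g' (base X c) i j = of_real (\<epsilon> i c) * g' i j"
proof -
  have "mmul J g' (base X c) i j = g' i (\<tau> j) * (if \<kappa> j = c \<and> \<sigma> j \<noteq> 0 then \<eta> j else 0)"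
    unfolding mmul_def by (rule sum_base[OF c ij(2)])
  also have "\<dots> = of_real (\<epsilon> i c) * g' i j"
  proof -
    have "\<eta> (\<tau> j) * \<eta> j = 1" if "\<sigma> j \<noteq> 0"
      using \<eta>[OF ij(2) that] by (simp only: mult.commute)
    then show ?thesis
      using \<sigma>(1)[of j] \<sigma>(2)[OF ij(2)] \<kappa>(1)[OF ij(2)] ij \<tau>(1,2)[OF ij(2)]
      by (auto simp: g'_def \<epsilon>_def \<gamma>_def)
  qed
  finally show ?thesis .
qed

lemma \<epsilon>_supp: "c \<notin> coords X \<Longrightarrow> \<epsilon> i c = 0"
  using \<kappa>(2)[of i] by (auto simp: \<epsilon>_def)

lemma frame_gl:
  assumes "alg X = gl_on J"
  shows "frame X g' g g g' \<epsilon> \<epsilon>"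
  by unfold_locales
    (use assms g_gl_on g_parity g_inverse base_gl_on base_parity base_g g'_base \<epsilon>_supp fin_J subspace_gl_on in auto)

lemma form_frame_osp:
  assumes "alg X = osp_alg N M G"
    and "\<And>i j. isl i \<noteq> isl j \<Longrightarrow> G i j = 0"
    and "\<And>i j. i \<in> J \<Longrightarrow> j \<in> J \<Longrightarrow> G i j = (if isl j then 1 else - 1) * G j i"
    and "\<And>i j. i \<in> J \<Longrightarrow> j \<in> J \<Longrightarrow> (\<Sum>l\<in>J. G l i * G l j) = (if i = j then 1 else 0)"
    and "\<And>i j. i \<in> J \<Longrightarrow> j \<in> J \<Longrightarrow> (\<Sum>l\<in>J. G i l * G j l) = (if i = j then 1 else 0)"
    and G_\<tau>: "\<And>i j c. i \<in> J \<Longrightarrow> j \<in> J \<Longrightarrow> c \<in> coords X \<Longrightarrow>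
      G (\<tau> i) j * (if \<kappa> i = c \<and> \<sigma> i \<noteq> 0 then \<eta> i else 0) = - (G i (\<tau> j) * (if \<kappa> j = c \<and> \<sigma> j \<noteq> 0 then \<eta> j else 0))"
  shows "form_frame X N M G g g' \<epsilon>"
proof -
  have inv: "(\<Sum>l\<in>J. base X c l i * G l j) = - (\<Sum>l\<in>J. G i l * base X c l j)"
    if "c \<in> coords X" "i \<in> J" "j \<in> J" for c i j
    using G_\<tau>[OF that(2,3,1)] sum_base[OF that(1,2), of "\<lambda>l. G l j"] sum_base[OF that(1,3), of "G i"]
    by (simp add: mult.commute)
  show ?thesis
    by (rule form_frame.intro)
      (fact inv idx assms g_gl_on g_parity g_inverse base_gl_on base_parity base_g \<epsilon>_supp)+
qed

lemma supertrace_base: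
  assumes "c \<in> coords X"
  shows "Re (supertrace J (mmul J (base X c) (base X c))) = (\<Sum>a\<in>J. ix_sgn a * (\<epsilon> a c)\<^sup>2)"
proof -
  have "mmul J (base X c) (base X c) a a = of_real ((\<epsilon> a c)\<^sup>2)" if "a \<in> J" for a
  proof -
    have "mmul J (base X c) (base X c) a a = base X c a (\<tau> a) * (if \<kappa> a = c \<and> \<sigma> a \<noteq> 0 then \<eta> a else 0)"
      unfolding mmul_def by (rule sum_base[OF assms that])
    also have "\<dots> = of_real ((\<epsilon> a c)\<^sup>2)"
      using \<tau>(1,2)[OF that] \<sigma>(1)[of a] \<sigma>(2)[OF that] \<kappa>(1)[OF that] \<eta>[OF that] that
      by (auto simp: base[OF assms] \<epsilon>_def mult.commute)
    finally show ?thesis .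
  qed
  then have "supertrace J (mmul J (base X c) (base X c)) = of_real (\<Sum>a\<in>J. ix_sgn a * (\<epsilon> a c)\<^sup>2)"
    by (simp add: supertrace_def of_real_sum ix_sgn_def) (rule sum.cong, auto)
  then show ?thesis by simp
qed

text \<open>The supertrace of the square of \<open>base X c\<close> is the signed sum of
  \<open>(\<epsilon> a c)\<^sup>2\<close> over the weights of V. It is thus read off from
  \<open>sgn_sum\<close> at the test function \<open>(\<alpha> c)\<^sup>2\<close> and equals
  \<open>2 * d * w c\<close>; \<open>scal\<close> removes the factor \<open>2 * d\<close>.\<close>

lemma dual_norm_base:
  assumes "c \<in> coords X" "finite (coords X)" "d \<noteq> 0" "scal X = 2 * d"
    and sgn_sum: "\<And>f. (\<Sum>a\<in>J. ix_sgn a * f (\<epsilon> a)) =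
      m0 * f 0 + d * (\<Sum>K\<in>coords X. w K * (f (unit_wt K) + f (- unit_wt K)))"
  shows "dual_norm X c = 1 / w c"
proof -
  have "(\<Sum>a\<in>J. ix_sgn a * (\<epsilon> a c)\<^sup>2) = d * (\<Sum>K\<in>coords X. if c = K then 2 * w K else 0)"
    unfolding sgn_sum[of "\<lambda>\<alpha>. (\<alpha> c)\<^sup>2"] by (simp add: unit_wt_apply) (auto intro!: sum.cong)
  also have "\<dots> = 2 * d * w c" using assms by simp
  finally show ?thesis using assms by (simp add: dual_norm_def supertrace_base)
qed

end

section \<open>Block exchanges of the index set and the resulting signed weights\<close>

definition blk_sgn :: "nat \<Rightarrow> nat \<Rightarrow> nat \<Rightarrow> real" where
  "blk_sgn A v a = (if a < v then 1 else if A \<le> a \<and> a < A + v then - 1 else 0)"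

definition blk_pos :: "nat \<Rightarrow> nat \<Rightarrow> nat \<Rightarrow> nat" where
  "blk_pos A v a = (if a < v then a else a - A)"

text \<open>\<open>fl\<close> allows a twist inside a group of indices that carry the same
  coordinate. It is the identity except for the even indices of \<open>pair_osp_gl\<close>, where
  \<open>base\<close> links \<open>2 * i\<close> with \<open>l + 2 * i + 1\<close>.\<close>

definition blk_swap :: "(nat \<Rightarrow> nat) \<Rightarrow> nat \<Rightarrow> nat \<Rightarrow> nat \<Rightarrow> nat" where
  "blk_swap fl A v a = (if a < v then A + fl a else if A \<le> a \<and> a < A + v then fl (a - A) else a)"

lemma sum_div_blocks:
  fixes h :: "nat \<Rightarrow> real"
  assumes "q > 0"
  shows "(\<Sum>a<q * n. h (a div q)) = q * (\<Sum>i<n. h i)"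
proof (induction n)
  case (Suc n)
  have "(\<Sum>a<q * Suc n. h (a div q)) = (\<Sum>a<q * n. h (a div q)) + (\<Sum>a\<in>{q * n..<q * Suc n}. h (a div q))"
    by (subst sum.union_disjoint[symmetric]) (auto intro!: sum.cong)
  also have "(\<Sum>a\<in>{q * n..<q * Suc n}. h (a div q)) = (\<Sum>a\<in>{q * n..<q * Suc n}. h n)"
    using assms by (intro sum.cong refl arg_cong[where f = h]) (auto intro!: div_nat_eqI simp: mult.commute)
  finally show ?case using Suc by (simp add: algebra_simps)
qed simp

lemma sum_blk:
  fixes G :: "real \<Rightarrow> nat \<Rightarrow> real"
  assumes "q > 0" "q * n \<le> A" "A + q * n \<le> N" "\<And>i. G 0 i = z"
  shows "(\<Sum>a<N. G (blk_sgn A (q * n) a) (blk_pos A (q * n) a div q)) =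
     (real N - 2 * real (q * n)) * z + real q * (\<Sum>i<n. G 1 i + G (- 1) i)"
proof -
  let ?h = "\<lambda>a. G (blk_sgn A (q * n) a) (blk_pos A (q * n) a div q)" and ?v = "q * n"
  have "(\<Sum>a<N. ?h a) = (\<Sum>a<?v. ?h a) + (\<Sum>a=?v..<A. ?h a) + (\<Sum>a=A..<A + ?v. ?h a) + (\<Sum>a=A + ?v..<N. ?h a)"
    using assms by (simp add: sum.atLeastLessThan_concat flip: atLeast0LessThan)
  also have "(\<Sum>a<?v. ?h a) = (\<Sum>a<?v. G 1 (a div q))"
    by (intro sum.cong) (auto simp: blk_sgn_def blk_pos_def)
  also have "(\<Sum>a=?v..<A. ?h a) = (\<Sum>a=?v..<A. z)"
    by (intro sum.cong) (auto simp: blk_sgn_def assms)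
  also have "(\<Sum>a=A..<A + ?v. ?h a) = (\<Sum>a<?v. G (- 1) (a div q))"
    using assms
    by (intro sum.reindex_bij_witness[of _ "\<lambda>a. a + A" "\<lambda>a. a - A"]) (auto simp: blk_sgn_def blk_pos_def)
  also have "(\<Sum>a=A + ?v..<N. ?h a) = (\<Sum>a=A + ?v..<N. z)"
    using assms(2,3) by (intro sum.cong) (auto simp: blk_sgn_def assms(4))
  also have "(\<Sum>a=?v..<A. z) = (real A - real ?v) * z"
    using assms(2) by (simp add: of_nat_diff)
  also have "(\<Sum>a=A + ?v..<N. z) = (real N - (real A + real ?v)) * z"
    using assms(3) by (simp add: of_nat_diff)
  finally show ?thesis
    unfolding sum_div_blocks[OF assms(1)] sum.distrib by (simp add: algebra_simps)
qed

text \<open>Each x-coordinate is the weight of \<open>q\<close> basis vectors for either sign, each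
  y-coordinate of \<open>q'\<close> odd ones. Pulling out \<open>q\<close> leaves
  \<open>- q' / q\<close> as the value of \<open>w\<close> on y; the unpaired vectors, counted with
  parity, give the coefficient of \<open>f 0\<close>.\<close>

lemma sgn_sum_blk:
  fixes f :: "(ix \<Rightarrow> real) \<Rightarrow> real"
  assumes q: "q > 0" "q' > 0" and A: "q * n \<le> A" "A + q * n \<le> N" and B: "q' * m \<le> B" "B + q' * m \<le> M"
    and \<epsilon>: "\<And>a c. a < N \<Longrightarrow> \<epsilon> (Inl a) c = (if c = Inl (blk_pos A (q * n) a div q) then blk_sgn A (q * n) a else 0)"
      "\<And>b c. b < M \<Longrightarrow> \<epsilon> (Inr b) c = (if c = Inr (blk_pos B (q' * m) b div q') then blk_sgn B (q' * m) b else 0)"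
    and w: "\<And>K. w K = (if isl K then 1 else - real q' / real q)"
  shows "(\<Sum>a\<in>ixs N M. ix_sgn a * f (\<epsilon> a)) =
      ((real N - 2 * real (q * n)) - (real M - 2 * real (q' * m))) * f 0
      + real q * (\<Sum>K\<in>ixs n m. w K * (f (unit_wt K) + f (- unit_wt K)))"
proof -
  have u: "(\<lambda>c. if c = i then 1 else 0) = unit_wt i" "(\<lambda>c. if c = i then - 1 else 0) = - unit_wt i"
    "(\<lambda>c. if c = i then 0 else 0) = (0 :: ix \<Rightarrow> real)" for i
    by (auto simp: unit_wt_def fun_eq_iff)
  have e: "\<epsilon> (Inl a) = (\<lambda>c. if c = Inl (blk_pos A (q * n) a div q) then blk_sgn A (q * n) a else 0)" if "a < N" for a
    using \<epsilon>(1)[OF that] by (rule ext)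
  have e': "\<epsilon> (Inr b) = (\<lambda>c. if c = Inr (blk_pos B (q' * m) b div q') then blk_sgn B (q' * m) b else 0)" if "b < M" for b
    using \<epsilon>(2)[OF that] by (rule ext)
  have "(\<Sum>a<N. f (\<epsilon> (Inl a))) = (real N - 2 * real (q * n)) * f 0 + real q * (\<Sum>i<n. f (unit_wt (Inl i)) + f (- unit_wt (Inl i)))"
    using sum_blk[OF q(1) A, of "\<lambda>t i. f (\<lambda>c. if c = Inl i then t else 0)" "f 0"] e
    by (simp add: u zero_fun_def)
  moreover have "(\<Sum>a<M. f (\<epsilon> (Inr a))) = (real M - 2 * real (q' * m)) * f 0 + real q' * (\<Sum>i<m. f (unit_wt (Inr i)) + f (- unit_wt (Inr i)))"
    using sum_blk[OF q(2) B, of "\<lambda>t i. f (\<lambda>c. if c = Inr i then t else 0)" "f 0"] e'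
    by (simp add: u zero_fun_def)
  moreover have "real q * (\<Sum>K\<in>ixs n m. w K * (f (unit_wt K) + f (- unit_wt K))) =
     real q * (\<Sum>i<n. f (unit_wt (Inl i)) + f (- unit_wt (Inl i))) - real q' * (\<Sum>i<m. f (unit_wt (Inr i)) + f (- unit_wt (Inr i)))"
  proof -
    have "real q * (w (Inl i) * y) = real q * y" "real q * (w (Inr i) * y) = - (real q' * y)" for i y
      using q by (simp_all add: w)
    then show ?thesis
      unfolding sum_ixs distrib_left[of "real q"] sum_distrib_left
      by (simp only: sum_negf diff_conv_add_uminus) (simp only: distrib_left)
  qed
  ultimately show ?thesis
    by (simp add: sum_ixs ix_sgn_def sum_negf algebra_simps)
qed

locale blk =
  fixes q n A N :: nat and fl :: "nat \<Rightarrow> nat"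
  assumes q: "q > 0" and A: "q * n \<le> A" "A + q * n \<le> N"
    and fl: "\<And>a. fl (fl a) = a" "\<And>a. fl a div q = a div q"
begin

lemma fl_less: "fl a < q * n \<longleftrightarrow> a < q * n"
  using fl(2)[of a] div_less_iff_less_mult[OF q, of a n] div_less_iff_less_mult[OF q, of "fl a" n]
  by (simp add: mult.commute)

lemma swap:
  "a < N \<Longrightarrow> blk_swap fl A (q * n) a < N"
  "blk_swap fl A (q * n) (blk_swap fl A (q * n) a) = a"
  "blk_sgn A (q * n) (blk_swap fl A (q * n) a) = - blk_sgn A (q * n) a"
  "blk_sgn A (q * n) a = 0 \<Longrightarrow> blk_swap fl A (q * n) a = a"
  "blk_pos A (q * n) (blk_swap fl A (q * n) a) div q = blk_pos A (q * n) a div q"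
  using A fl_less[of a] fl_less[of "a - A"] fl
  by (auto simp: blk_swap_def blk_sgn_def blk_pos_def)

lemma pos_less: "blk_sgn A (q * n) a \<noteq> 0 \<Longrightarrow> blk_pos A (q * n) a div q < n"
  unfolding div_less_iff_less_mult[OF q] by (auto simp: blk_sgn_def blk_pos_def mult.commute split: if_splits)

end

lemma blk_first:
  assumes "a < v"
  shows "blk_swap fl A v a = A + fl a" "blk_sgn A v a = 1" "blk_pos A v a = a"
  using assms by (auto simp: blk_swap_def blk_sgn_def blk_pos_def)

lemma blk_second:
  assumes "v \<le> A" "x < v"
  shows "blk_swap fl A v (A + x) = fl x" "blk_sgn A v (A + x) = - 1" "blk_pos A v (A + x) = x"
  using assms by (auto simp: blk_swap_def blk_sgn_def blk_pos_def)

lemma blk_neither: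
  assumes "\<not> a < v" "\<not> (A \<le> a \<and> a < A + v)"
  shows "blk_swap fl A v a = a" "blk_sgn A v a = 0"
  using assms by (auto simp: blk_swap_def blk_sgn_def)

lemma blk_cases:
  fixes a A v :: nat
  obtains "a < v" | x where "a = A + x" "x < v" | "\<not> a < v" "\<not> (A \<le> a \<and> a < A + v)"
  by (metis le_add_diff_inverse less_diff_conv2 add.commute nat_add_left_cancel_less)

lemma pairing_blk:
  assumes "blk q n A N fx" "blk q' m B M fy" and X: "idx X = ixs N M" "coords X = ixs n m"
  defines "\<tau> \<equiv> map_sum (blk_swap fx A (q * n)) (blk_swap fy B (q' * m))"
    and "\<sigma> \<equiv> case_sum (blk_sgn A (q * n)) (blk_sgn B (q' * m))"
    and "\<kappa> \<equiv> map_sum (\<lambda>a. blk_pos A (q * n) a div q) (\<lambda>b. blk_pos B (q' * m) b div q')"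
  assumes \<eta>: "\<And>a. \<sigma> a \<noteq> 0 \<Longrightarrow> \<eta> a * \<eta> (\<tau> a) = 1"
    and base: "\<And>c b a. c \<in> coords X \<Longrightarrow>
      base X c b a = (if a \<in> idx X \<and> b = \<tau> a \<and> \<kappa> a = c \<and> \<sigma> a \<noteq> 0 then \<eta> a else 0)"
  shows "pairing X N M \<tau> \<sigma> \<eta> \<kappa>"
proof
  interpret x: blk q n A N fx by fact
  interpret y: blk q' m B M fy by fact
  fix a
  show "idx X = ixs N M" by (rule X)
  show "\<tau> a \<in> idx X" if "a \<in> idx X"
    using that x.swap(1) y.swap(1) by (cases a) (auto simp: X ixs_def \<tau>_def)
  show "\<tau> (\<tau> a) = a" using x.swap(2) y.swap(2) by (cases a) (auto simp: \<tau>_def)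
  show "isl (\<tau> a) = isl a" by (cases a) (auto simp: \<tau>_def)
  show "\<sigma> a = 1 \<or> \<sigma> a = - 1 \<or> \<sigma> a = 0" by (cases a) (auto simp: \<sigma>_def blk_sgn_def)
  show "\<sigma> (\<tau> a) = - \<sigma> a" using x.swap(3) y.swap(3) by (cases a) (auto simp: \<sigma>_def \<tau>_def)
  show "\<tau> a = a" if "\<sigma> a = 0" using that x.swap(4) y.swap(4) by (cases a) (auto simp: \<sigma>_def \<tau>_def)
  show "\<eta> a * \<eta> (\<tau> a) = 1" if "\<sigma> a \<noteq> 0" using that by (rule \<eta>)
  show "\<kappa> (\<tau> a) = \<kappa> a" using x.swap(5) y.swap(5) by (cases a) (auto simp: \<kappa>_def \<tau>_def)
  show "\<kappa> a \<in> coords X" if "\<sigma> a \<noteq> 0"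
    using that x.pos_less y.pos_less by (cases a) (auto simp: X ixs_def \<sigma>_def \<kappa>_def)
  show "base X c b a = (if a \<in> idx X \<and> b = \<tau> a \<and> \<kappa> a = c \<and> \<sigma> a \<noteq> 0 then \<eta> a else 0)" if "c \<in> coords X" for c b
    using that by (rule base)
qed

lemma pairing_sgn_sum:
  assumes P: "pairing X N M (map_sum (blk_swap fx A (q * n)) (blk_swap fy B (q' * m)))
      (case_sum (blk_sgn A (q * n)) (blk_sgn B (q' * m))) \<eta>
      (map_sum (\<lambda>a. blk_pos A (q * n) a div q) (\<lambda>b. blk_pos B (q' * m) b div q'))"
    and "blk q n A N fx" "blk q' m B M fy" "coords X = ixs n m"
    and w: "\<And>K. w K = (if isl K then 1 else - real q' / real q)"
  shows "(\<Sum>a\<in>idx X. ix_sgn a * f (pairing.\<epsilon> X (case_sum (blk_sgn A (q * n)) (blk_sgn B (q' * m)))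
        (map_sum (\<lambda>a. blk_pos A (q * n) a div q) (\<lambda>b. blk_pos B (q' * m) b div q')) a)) =
      ((real N - 2 * real (q * n)) - (real M - 2 * real (q' * m))) * f 0
      + real q * (\<Sum>K\<in>coords X. w K * (f (unit_wt K) + f (- unit_wt K)))"
proof -
  interpret pairing X N M "map_sum (blk_swap fx A (q * n)) (blk_swap fy B (q' * m))"
      "case_sum (blk_sgn A (q * n)) (blk_sgn B (q' * m))" \<eta>
      "map_sum (\<lambda>a. blk_pos A (q * n) a div q) (\<lambda>b. blk_pos B (q' * m) b div q')" by fact
  interpret x: blk q n A N fx by fact
  interpret y: blk q' m B M fy by fact
  show ?thesis
    unfolding idx assms(4)
    by (rule sgn_sum_blk[OF x.q y.q x.A y.A _ _ w]) (auto simp: \<epsilon>_def idx ixs_def)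
qed

section \<open>The general linear pairs with two general linear summands\<close>

lemma pair_gl_gl_conjugated:
  fixes n1 n2 m1 m2 :: nat
  defines "n \<equiv> min n1 n2" and "m \<equiv> min m1 m2"
    and "p \<equiv> \<bar>real m1 - real m2\<bar> - \<bar>real n1 - real n2\<bar>"
  shows "radial_part_conjugated (pair_gl_gl n1 n2 m1 m2) (deformed_CMS_BC n m (- 1) p (- 1 / 2) (- p) (- 1 / 2))"
proof -
  let ?X = "pair_gl_gl n1 n2 m1 m2"
  let ?w = "\<lambda>K :: ix. if isl K then 1 else - real 1 / real 1"
  have X: "idx ?X = ixs (n1 + n2) (m1 + m2)" "coords ?X = ixs n m" "alg ?X = gl_on (idx ?X)" "scal ?X = 2"
    by (simp_all add: pair_gl_gl_def n_def m_def gl_alg_gl_on)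
  have blk: "blk 1 n n1 (n1 + n2) id" "blk 1 m m1 (m1 + m2) id"
    by unfold_locales (auto simp: n_def m_def)
  have P: "pairing ?X (n1 + n2) (m1 + m2) (map_sum (blk_swap id n1 (1 * n)) (blk_swap id m1 (1 * m)))
      (case_sum (blk_sgn n1 (1 * n)) (blk_sgn m1 (1 * m))) (\<lambda>_. 1)
      (map_sum (\<lambda>a. blk_pos n1 (1 * n) a div 1) (\<lambda>b. blk_pos m1 (1 * m) b div 1))"
  proof (rule pairing_blk[OF blk X(1,2)])
    fix c b a assume "c \<in> coords ?X"
    then have c: "c \<in> ixs n m" by (simp add: X)
    have base: "base ?X (Inl i) = munit (Inl i) (Inl (n1 + i)) + munit (Inl (n1 + i)) (Inl i)"
      "base ?X (Inr i) = munit (Inr i) (Inr (m1 + i)) + munit (Inr (m1 + i)) (Inr i)" for i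
      by (simp_all add: pair_gl_gl_def)
    have le: "n \<le> n1" "n \<le> n2" "m \<le> m1" "m \<le> m2" by (auto simp: n_def m_def)
    show "base ?X c b a = (if a \<in> idx ?X \<and> b = map_sum (blk_swap id n1 (1 * n)) (blk_swap id m1 (1 * m)) a
        \<and> map_sum (\<lambda>a. blk_pos n1 (1 * n) a div 1) (\<lambda>b. blk_pos m1 (1 * m) b div 1) a = c
        \<and> case_sum (blk_sgn n1 (1 * n)) (blk_sgn m1 (1 * m)) a \<noteq> 0 then 1 else 0)"
    proof (cases a)
      case (Inl x)
      show ?thesis
        by (cases rule: blk_cases[where a = x and v = n and A = n1])
           (use c le in \<open>auto simp: Inl X ixs_def base munit_def blk_first blk_second blk_neither split: if_splits\<close>)
    next
      case (Inr x)
      show ?thesis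
        by (cases rule: blk_cases[where a = x and v = m and A = m1])
           (use c le in \<open>auto simp: Inr X ixs_def base munit_def blk_first blk_second blk_neither split: if_splits\<close>)
    qed
  qed simp
  interpret pairing ?X "n1 + n2" "m1 + m2" "map_sum (blk_swap id n1 (1 * n)) (blk_swap id m1 (1 * m))"
      "case_sum (blk_sgn n1 (1 * n)) (blk_sgn m1 (1 * m))" "\<lambda>_. 1"
      "map_sum (\<lambda>a. blk_pos n1 (1 * n) a div 1) (\<lambda>b. blk_pos m1 (1 * m) b div 1)" by fact
  define m0 where "m0 = (real (n1 + n2) - 2 * real (1 * n)) - (real (m1 + m2) - 2 * real (1 * m))"
  \<comment> \<open>As \<open>n1 + n2 - 2 * n\<close> is the absolute difference of
    \<open>n1\<close> and \<open>n2\<close>, and likewise for \<open>m\<close>, the parameter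
    \<open>p\<close> is minus the superdimension of the zero weight space of V.\<close>
  have m0: "m0 = - p" by (auto simp: m0_def p_def n_def m_def min_def)
  note sgn = pairing_sgn_sum[OF P blk X(2), of ?w, OF refl, folded m0_def]
  interpret root_data ?X "- 1" ?w 1 "\<lambda>K. 2 * m0 * real 1 * ?w K" "\<lambda>K. (real 1)\<^sup>2 * (?w K)\<^sup>2"
    by (rule gl_root_data_BC[OF frame_gl[OF X(3)] X(3) _ _ _ _ sgn]) (auto simp: X)
  show ?thesis
  proof (rule BC_conjugated[OF refl X(2)])
    show "dual_norm ?X c = 1 / ?w c" if "c \<in> coords ?X" for c
      by (rule dual_norm_base[OF that _ _ _ sgn]) (auto simp: X)
  qed (auto simp: BC_parameters_def m0)
qed

section \<open>The orthosymplectic pairs with two orthosymplectic summands\<close>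

lemma form_std_parity: "isl i \<noteq> isl j \<Longrightarrow> form_std i j = 0"
  by (cases i; cases j) auto

lemma form_std_sym: "form_std i j = (if isl j then 1 else - 1) * form_std j i"
  by (cases i; cases j) auto

text \<open>The partner of an odd basis vector under \<open>form_std\<close>; for the even indices
  of \<open>pair_osp_gl\<close> it is the twist inside the group of one coordinate.\<close>

definition flip :: "nat \<Rightarrow> nat" where
  "flip a = (if even a then a + 1 else a - 1)"

lemma flip_flip [simp]: "flip (flip a) = a"
  by (auto simp: flip_def elim!: oddE)

lemma flip_div2 [simp]: "flip a div 2 = a div 2"
  by (auto simp: flip_def elim!: oddE)

lemma even_flip [simp]: "even (flip a) = odd a"
  by (auto simp: flip_def elim!: oddE)

lemma flip_less: "even v \<Longrightarrow> flip a < v \<longleftrightarrow> a < v"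
  by (auto simp: flip_def elim!: evenE oddE)

lemma flip_add: "even A \<Longrightarrow> flip (A + a) = A + flip a"
  by (auto simp: flip_def elim!: oddE)

lemma blk_flip:
  assumes "even A" "even v" "v \<le> A"
  shows "blk_swap id A v (flip a) = flip (blk_swap id A v a)"
    "blk_sgn A v (flip a) = blk_sgn A v a"
    "blk_sgn A v a \<noteq> 0 \<Longrightarrow> blk_pos A v (flip a) = flip (blk_pos A v a)"
    "even (blk_swap id A v a) = even a"
proof -
  have "blk_swap id A v (flip a) = flip (blk_swap id A v a) \<and> blk_sgn A v (flip a) = blk_sgn A v a \<and>
    (blk_sgn A v a \<noteq> 0 \<longrightarrow> blk_pos A v (flip a) = flip (blk_pos A v a)) \<and> even (blk_swap id A v a) = even a"
  proof (cases rule: blk_cases[where a = a and v = v and A = A])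
    case 1
    then show ?thesis using assms by (simp add: blk_first flip_less flip_add)
  next
    case (2 x)
    then show ?thesis using assms by (simp add: blk_second flip_less flip_add)
  next
    case 3
    then have "\<not> flip a < v" "\<not> (A \<le> flip a \<and> flip a < A + v)"
      using assms flip_less[of v a] flip_less[of "A + v" a] flip_less[of A a] by auto
    with 3 show ?thesis by (simp add: blk_neither)
  qed
  then show "blk_swap id A v (flip a) = flip (blk_swap id A v a)"
    "blk_sgn A v (flip a) = blk_sgn A v a"
    "blk_sgn A v a \<noteq> 0 \<Longrightarrow> blk_pos A v (flip a) = flip (blk_pos A v a)"
    "even (blk_swap id A v a) = even a" by auto
qed

text \<open>\<open>s a\<close> is the partner of the basis vector \<open>a\<close> with respect to the form.\<close>

lemma (in pairing) monomial_form_invariant: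
  assumes G: "\<And>i j. i \<in> J \<Longrightarrow> j \<in> J \<Longrightarrow> G i j = (if j = s i then e i else 0)"
    and s: "\<And>i. i \<in> J \<Longrightarrow> s i \<in> J" "\<And>i. i \<in> J \<Longrightarrow> s (\<tau> i) = \<tau> (s i)"
      "\<And>i. i \<in> J \<Longrightarrow> \<sigma> (s i) = 0 \<longleftrightarrow> \<sigma> i = 0" "\<And>i. i \<in> J \<Longrightarrow> \<sigma> i \<noteq> 0 \<Longrightarrow> \<kappa> (s i) = \<kappa> i"
    and e: "\<And>i. i \<in> J \<Longrightarrow> \<sigma> i \<noteq> 0 \<Longrightarrow> e (\<tau> i) * \<eta> i = - (e i * \<eta> (\<tau> (s i)))"
    and ij: "i \<in> J" "j \<in> J"
  shows "G (\<tau> i) j * (if \<kappa> i = c \<and> \<sigma> i \<noteq> 0 then \<eta> i else 0) = - (G i (\<tau> j) * (if \<kappa> j = c \<and> \<sigma> j \<noteq> 0 then \<eta> j else 0))"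
proof (cases "j = \<tau> (s i)")
  case True
  have si: "s i \<in> J" using s(1) ij by blast
  have "\<tau> j = s i" "\<kappa> j = \<kappa> (s i)" "\<sigma> j = 0 \<longleftrightarrow> \<sigma> i = 0"
    using True \<tau>(2)[OF si] \<kappa>(1)[OF si] \<sigma>_\<tau>_0[OF si] s(3)[OF ij(1)] by auto
  moreover have "G (\<tau> i) j = e (\<tau> i)" "G i (s i) = e i"
    using G[of "\<tau> i" j] G[OF ij(1) si] \<tau>(1) ij True s(2) by auto
  ultimately show ?thesis
    using e[OF ij(1)] s(4)[OF ij(1)] True by auto
next
  case False
  moreover from False have "\<tau> j \<noteq> s i" using \<tau>(2)[OF ij(2)] by metis
  ultimately have "G (\<tau> i) j = 0" "G i (\<tau> j) = 0"
    using G[of "\<tau> i" j] G[of i "\<tau> j"] \<tau> ij s(2)[OF ij(1)] by auto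
  then show ?thesis by simp
qed

lemma pair_osp_osp_conjugated:
  fixes n1 n2 m1 m2 :: nat
  defines "n \<equiv> min n1 n2" and "m \<equiv> min m1 m2"
    and "p \<equiv> \<bar>real m1 - real m2\<bar> - 1 / 2 * \<bar>real n1 - real n2\<bar>"
  shows "radial_part_conjugated (pair_osp_osp n1 n2 m1 m2) (deformed_CMS_BC n m (- 1 / 2) p 0 (- 2 * p) (- 3 / 2))"
proof -
  let ?X = "pair_osp_osp n1 n2 m1 m2"
  let ?w = "\<lambda>K :: ix. if isl K then 1 else - real 2 / real 1"
  let ?\<sigma> = "case_sum (blk_sgn n1 (1 * n)) (blk_sgn (2 * m1) (2 * m))"
  let ?\<tau> = "map_sum (blk_swap id n1 (1 * n)) (blk_swap id (2 * m1) (2 * m))"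
  let ?\<kappa> = "map_sum (\<lambda>a. blk_pos n1 (1 * n) a div 1) (\<lambda>b. blk_pos (2 * m1) (2 * m) b div 2)"
  have X: "idx ?X = ixs (n1 + n2) (2 * m1 + 2 * m2)" "coords ?X = ixs n m"
    "alg ?X = osp_alg (n1 + n2) (2 * m1 + 2 * m2) form_std" "scal ?X = 2"
    by (simp_all add: pair_osp_osp_def n_def m_def)
  have blk: "blk 1 n n1 (n1 + n2) id" "blk 2 m (2 * m1) (2 * m1 + 2 * m2) id"
    by unfold_locales (auto simp: n_def m_def)
  \<comment> \<open>\<open>rot\<close> has the entries \<open>\<i>\<close> and
    \<open>- \<i>\<close>, so the factor is \<open>\<i>\<close> times the sign, and for swapped
    indices the product is \<open>\<i> * (- \<i>) = 1\<close>. The odd groups have size 2, since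
    \<open>2 * j\<close> and \<open>2 * j + 1\<close> carry the same y-coordinate.\<close>
  have P: "pairing ?X (n1 + n2) (2 * m1 + 2 * m2) ?\<tau> ?\<sigma> (\<lambda>a. \<i> * of_real (?\<sigma> a)) ?\<kappa>"
  proof (rule pairing_blk[OF blk X(1,2)])
    fix c b a assume "c \<in> coords ?X"
    then have c: "c \<in> ixs n m" by (simp add: X)
    have base: "base ?X (Inl i) = rot (Inl i) (Inl (n1 + i))"
      "base ?X (Inr i) = rot (Inr (2 * i)) (Inr (2 * m1 + 2 * i)) + rot (Inr (2 * i + 1)) (Inr (2 * m1 + 2 * i + 1))" for i
      by (simp_all add: pair_osp_osp_def)
    have le: "n \<le> n1" "n \<le> n2" "2 * m \<le> 2 * m1" "2 * m \<le> 2 * m2" by (auto simp: n_def m_def)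
    have half: "x div 2 = i \<longleftrightarrow> x = 2 * i \<or> x = Suc (2 * i)" for x i :: nat by presburger
    show "base ?X c b a = (if a \<in> idx ?X \<and> b = ?\<tau> a \<and> ?\<kappa> a = c \<and> ?\<sigma> a \<noteq> 0 then \<i> * of_real (?\<sigma> a) else 0)"
    proof (cases a)
      case (Inl x)
      show ?thesis
        by (cases rule: blk_cases[where a = x and v = n and A = n1])
           (use c le in \<open>auto simp: Inl X ixs_def base munit_def rot_def mscale_def blk_first blk_second blk_neither split: if_splits\<close>)
    next
      case (Inr x)
      show ?thesis
        by (cases rule: blk_cases[where a = x and v = "2 * m" and A = "2 * m1"])
           (use c le in \<open>auto simp: Inr X ixs_def base munit_def rot_def mscale_def blk_first blk_second blk_neither half split: if_splits\<close>)
    qed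
  next
    fix a assume "?\<sigma> a \<noteq> 0"
    then show "\<i> * of_real (?\<sigma> a) * (\<i> * of_real (?\<sigma> (?\<tau> a))) = 1"
      using blk.swap(3)[OF blk(1)] blk.swap(3)[OF blk(2)]
      by (cases a) (auto simp: blk_sgn_def split: if_splits)
  qed
  interpret pairing ?X "n1 + n2" "2 * m1 + 2 * m2" ?\<tau> ?\<sigma> "\<lambda>a. \<i> * of_real (?\<sigma> a)" ?\<kappa> by fact
  define m0 where "m0 = (real (n1 + n2) - 2 * real (1 * n)) - (real (2 * m1 + 2 * m2) - 2 * real (2 * m))"
  \<comment> \<open>The unpaired odd vectors come in twos, as the odd dimensions are
    \<open>2 * m1\<close> and \<open>2 * m2\<close>; hence the factor 2 in comparison with the
    general linear pairs.\<close>
  have m0: "m0 = - 2 * p" by (auto simp: m0_def p_def n_def m_def min_def)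
  note sgn = pairing_sgn_sum[OF P blk X(2), of ?w, OF refl, folded m0_def]
  have F: "form_frame ?X (n1 + n2) (2 * m1 + 2 * m2) form_std g g' \<epsilon>"
  proof (rule form_frame_osp[OF X(3) form_std_parity form_std_sym])
    fix i j assume "i \<in> idx ?X" "j \<in> idx ?X"
    then show "(\<Sum>l\<in>idx ?X. form_std l i * form_std l j) = (if i = j then 1 else 0)"
      "(\<Sum>l\<in>idx ?X. form_std i l * form_std j l) = (if i = j then 1 else 0)"
      using form_std_orthogonal[of i "n1 + n2" "m1 + m2" j] by (simp_all add: X)
  next
    fix i j c assume ij: "i \<in> idx ?X" "j \<in> idx ?X"
    have le: "2 * m \<le> 2 * m1" by (simp add: m_def)
    \<comment> \<open>The offset \<open>2 * m1\<close> is even, so exchanging the blocks commutes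
      with the partner map of the form.\<close>
    note fl = blk_flip[of "2 * m1" "2 * m", OF _ _ le, simplified]
    note sgn_swap = blk.swap(3)[OF blk(1)] blk.swap(3)[OF blk(2)]
    show "form_std (?\<tau> i) j * (if ?\<kappa> i = c \<and> ?\<sigma> i \<noteq> 0 then \<i> * of_real (?\<sigma> i) else 0) =
       - (form_std i (?\<tau> j) * (if ?\<kappa> j = c \<and> ?\<sigma> j \<noteq> 0 then \<i> * of_real (?\<sigma> j) else 0))"
    proof (rule monomial_form_invariant[OF _ _ _ _ _ _ ij,
        where s = "map_sum id flip" and e = "case_sum (\<lambda>_. 1) (\<lambda>b. if even b then 1 else - 1)"])
      fix i j assume i: "i \<in> idx ?X"
      show "form_std i j = (if j = map_sum id flip i then case_sum (\<lambda>_. 1) (\<lambda>b. if even b then 1 else - 1) i else 0)"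
        by (cases i; cases j) (auto simp: flip_def elim!: oddE)
      show "map_sum id flip i \<in> idx ?X"
        using i flip_less[of "2 * m1 + 2 * m2"] by (cases i) (auto simp: X ixs_def)
      show "map_sum id flip (?\<tau> i) = ?\<tau> (map_sum id flip i)" "?\<sigma> (map_sum id flip i) = 0 \<longleftrightarrow> ?\<sigma> i = 0"
        "?\<sigma> i \<noteq> 0 \<Longrightarrow> ?\<kappa> (map_sum id flip i) = ?\<kappa> i"
        by (cases i; simp add: fl)+
      show "case_sum (\<lambda>_. 1) (\<lambda>b. if even b then 1 else - 1) (?\<tau> i) * (\<i> * of_real (?\<sigma> i)) =
        - (case_sum (\<lambda>_. 1) (\<lambda>b. if even b then 1 else - 1) i * (\<i> * of_real (?\<sigma> (?\<tau> (map_sum id flip i)))))"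
        using sgn_swap by (cases i) (simp_all add: fl)
    qed
  qed
  interpret root_data ?X "- 1 / 2" ?w 1 "\<lambda>K. m0 * real 1 * ?w K" "\<lambda>K. ((real 1)\<^sup>2 * (?w K)\<^sup>2 - real 1 * ?w K) / 2"
    by (rule osp_root_data[OF F _ _ _ _ sgn]) (auto simp: X)
  show ?thesis
  proof (rule BC_conjugated[OF refl X(2)])
    show "dual_norm ?X c = 1 / ?w c" if "c \<in> coords ?X" for c
      by (rule dual_norm_base[OF that _ _ _ sgn]) (auto simp: X)
  qed (auto simp: BC_parameters_def m0)
qed

section \<open>The orthosymplectic pairs with a general linear fixed subalgebra\<close>

lemma form_split_parity: "isl i \<noteq> isl j \<Longrightarrow> form_split l m i j = 0"
  by (cases i; cases j) auto

text \<open>The assumption on \<open>i\<close> rules out an odd index when \<open>m = 0\<close>,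
  where the conditions \<open>b = a + m\<close> and \<open>a = b + m\<close> coincide.\<close>

lemma form_split_sym: "i \<in> ixs (2 * l) (2 * m) \<Longrightarrow> form_split l m i j = (if isl j then 1 else - 1) * form_split l m j i"
  by (cases i; cases j) (auto simp: ixs_def)

text \<open>The form is a signed permutation matrix, so its rows are orthonormal. The columns follow
  by supersymmetry: for \<open>i\<close> and \<open>j\<close> of equal parity the two signs cancel,
  and for different parity both products are zero.\<close>

lemma form_split_orthogonal:
  assumes "i \<in> ixs (2 * l) (2 * m)" "j \<in> ixs (2 * l) (2 * m)"
  shows "(\<Sum>c\<in>ixs (2 * l) (2 * m). form_split l m c i * form_split l m c j) = (if i = j then 1 else 0)"
    and "(\<Sum>c\<in>ixs (2 * l) (2 * m). form_split l m i c * form_split l m j c) = (if i = j then 1 else 0)"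
proof -
  let ?I = "ixs (2 * l) (2 * m)"
  define s where "s = map_sum (\<lambda>a. if a < l then a + l else a - l) (\<lambda>b. if b < m then b + m else b - m)"
  define e :: "ix \<Rightarrow> complex" where "e = case_sum (\<lambda>_. 1) (\<lambda>b. if b < m then 1 else - 1)"
  have s: "s i \<in> ?I" "s (s i) = i" if "i \<in> ?I" for i
    using that by (cases i; auto simp: s_def ixs_def)+
  have G: "form_split l m i c = (if c = s i then e i else 0)" if "i \<in> ?I" "c \<in> ?I" for i c
    using that by (cases i; cases c) (auto simp: s_def e_def ixs_def)
  have e: "e i * e i = 1" for i by (cases i) (auto simp: e_def)
  have *: "(\<Sum>c\<in>?I. form_split l m i c * form_split l m j c) = (if i = j then 1 else 0)" if "i \<in> ?I" "j \<in> ?I" for i j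
  proof -
    have "(\<Sum>c\<in>?I. form_split l m i c * form_split l m j c) = (\<Sum>c\<in>?I. if c = s i then e i * (if s i = s j then e j else 0) else 0)"
      using that by (intro sum.cong) (auto simp: G)
    also have "\<dots> = e i * (if s i = s j then e j else 0)" using s that by simp
    finally show ?thesis using s(2) that e by auto metis
  qed
  show "(\<Sum>c\<in>?I. form_split l m i c * form_split l m j c) = (if i = j then 1 else 0)"
    by (rule *[OF assms])
  have "(\<Sum>c\<in>?I. form_split l m c i * form_split l m c j) = (\<Sum>c\<in>?I. form_split l m i c * form_split l m j c)"
  proof (rule sum.cong[OF refl])
    fix c assume "c \<in> ?I"
    then show "form_split l m c i * form_split l m c j = form_split l m i c * form_split l m j c"
      using form_split_sym[of c l m i] form_split_sym[of c l m j] form_split_parity[of c i l m] form_split_parity[of c j l m]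
      by (cases "isl i"; cases "isl j"; cases "isl c") auto
  qed
  then show "(\<Sum>c\<in>?I. form_split l m c i * form_split l m c j) = (if i = j then 1 else 0)"
    using *[OF assms] by simp
qed

lemma pair_osp_gl_conjugated:
  fixes l m :: nat
  defines "n \<equiv> l div 2" and "p \<equiv> - 2 * real (l mod 2)"
  shows "radial_part_conjugated (pair_osp_gl l m) (deformed_CMS_BC n m (- 2) p (- 1 / 2) (- p / 2) (- 1 / 2))"
proof -
  let ?X = "pair_osp_gl l m"
  let ?w = "\<lambda>K :: ix. if isl K then 1 else - real 1 / real 2"
  let ?\<sigma> = "case_sum (blk_sgn l (2 * n)) (blk_sgn m (1 * m))"
  let ?\<tau> = "map_sum (blk_swap flip l (2 * n)) (blk_swap id m (1 * m))"
  let ?\<kappa> = "map_sum (\<lambda>a. blk_pos l (2 * n) a div 2) (\<lambda>b. blk_pos m (1 * m) b div 1)"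
  \<comment> \<open>The signs of the four matrix units in \<open>base\<close>: plus at even and
    minus at odd positions of the first block, and the reverse on the dual block.\<close>
  let ?\<eta> = "case_sum (\<lambda>a. of_real (blk_sgn l (2 * n) a) * (if even (blk_pos l (2 * n) a) then 1 else - 1)) (\<lambda>_. 1 :: complex)"
  have n: "l = 2 * n \<or> l = 2 * n + 1" unfolding n_def by presburger
  have le: "2 * n \<le> l" using n by auto
  have X: "idx ?X = ixs (2 * l) (2 * m)" "coords ?X = ixs n m"
    "alg ?X = osp_alg (2 * l) (2 * m) (form_split l m)" "scal ?X = 4"
    by (simp_all add: pair_osp_gl_def n_def)
  have blk: "blk 2 n l (2 * l) flip" "blk 1 m m (2 * m) id"
    by unfold_locales (use le in auto)
  have P: "pairing ?X (2 * l) (2 * m) ?\<tau> ?\<sigma> ?\<eta> ?\<kappa>"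
  proof (rule pairing_blk[OF blk X(1,2)])
    fix c b a assume "c \<in> coords ?X"
    then have c: "c \<in> ixs n m" by (simp add: X)
    have base: "base ?X (Inl i) = munit (Inl (l + 2 * i + 1)) (Inl (2 * i)) - munit (Inl (l + 2 * i)) (Inl (2 * i + 1))
                + munit (Inl (2 * i)) (Inl (l + 2 * i + 1)) - munit (Inl (2 * i + 1)) (Inl (l + 2 * i))"
      "base ?X (Inr i) = munit (Inr (m + i)) (Inr i) + munit (Inr i) (Inr (m + i))" for i
      by (simp_all add: pair_osp_gl_def)
    have half: "x div 2 = i \<longleftrightarrow> x = 2 * i \<or> x = Suc (2 * i)" for x i :: nat by presburger
    show "base ?X c b a = (if a \<in> idx ?X \<and> b = ?\<tau> a \<and> ?\<kappa> a = c \<and> ?\<sigma> a \<noteq> 0 then ?\<eta> a else 0)"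
    proof (cases a)
      case (Inl x)
      show ?thesis
        by (cases rule: blk_cases[where a = x and v = "2 * n" and A = l])
           (use c le in \<open>auto simp: Inl X ixs_def base munit_def blk_first blk_second blk_neither half flip_def split: if_splits\<close>, presburger+)
    next
      case (Inr x)
      show ?thesis
        by (cases rule: blk_cases[where a = x and v = m and A = m])
           (use c in \<open>auto simp: Inr X ixs_def base munit_def blk_first blk_second blk_neither split: if_splits\<close>)
    qed
  next
    fix a assume "?\<sigma> a \<noteq> 0"
    then show "?\<eta> a * ?\<eta> (?\<tau> a) = 1"
    proof (cases a)
      case (Inl x)
      with \<open>?\<sigma> a \<noteq> 0\<close> show ?thesis
        by (cases rule: blk_cases[where a = x and v = "2 * n" and A = l]) (use le in \<open>auto simp: blk_first blk_second blk_neither flip_less\<close>)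
    qed simp
  qed
  interpret pairing ?X "2 * l" "2 * m" ?\<tau> ?\<sigma> ?\<eta> ?\<kappa> by fact
  define m0 where "m0 = (real (2 * l) - 2 * real (2 * n)) - (real (2 * m) - 2 * real (1 * m))"
  \<comment> \<open>For odd \<open>l\<close> one even basis vector of the isotropic subspace and one
    of its dual remain unpaired, so \<open>m0\<close> is 2; for even \<open>l\<close> it is 0. This
    separates the two sets of parameters.\<close>
  have m0: "m0 = - p" using n by (auto simp: m0_def p_def)
  note sgn = pairing_sgn_sum[OF P blk X(2), of ?w, OF refl, folded m0_def]
  have F: "form_frame ?X (2 * l) (2 * m) (form_split l m) g g' \<epsilon>"
  proof (rule form_frame_osp[OF X(3) form_split_parity])
    fix i j assume "i \<in> idx ?X" "j \<in> idx ?X"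
    then show "(\<Sum>c\<in>idx ?X. form_split l m c i * form_split l m c j) = (if i = j then 1 else 0)"
      "(\<Sum>c\<in>idx ?X. form_split l m i c * form_split l m j c) = (if i = j then 1 else 0)"
      "form_split l m i j = (if isl j then 1 else - 1) * form_split l m j i"
      using form_split_orthogonal[of i l m j] form_split_sym[of i l m j] by (simp_all add: X)
  next
    fix i j c assume ij: "i \<in> idx ?X" "j \<in> idx ?X"
    let ?s = "map_sum (\<lambda>a. if a < l then l + a else a - l) (\<lambda>b. if b < m then m + b else b - m)"
    let ?e = "case_sum (\<lambda>_. 1) (\<lambda>b. if b < m then 1 else - 1 :: complex)"
    show "form_split l m (?\<tau> i) j * (if ?\<kappa> i = c \<and> ?\<sigma> i \<noteq> 0 then ?\<eta> i else 0) =
       - (form_split l m i (?\<tau> j) * (if ?\<kappa> j = c \<and> ?\<sigma> j \<noteq> 0 then ?\<eta> j else 0))"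
    proof (rule monomial_form_invariant[OF _ _ _ _ _ _ ij, where s = ?s and e = ?e])
      fix i j assume i: "i \<in> idx ?X"
      show "form_split l m i j = (if j = ?s i then ?e i else 0)" if "j \<in> idx ?X"
        using i that by (cases i; cases j) (auto simp: X ixs_def)
      show "?s i \<in> idx ?X" using i by (cases i) (auto simp: X ixs_def)
      have "?s (?\<tau> i) = ?\<tau> (?s i) \<and> (?\<sigma> (?s i) = 0 \<longleftrightarrow> ?\<sigma> i = 0) \<and>
        (?\<sigma> i \<noteq> 0 \<longrightarrow> ?\<kappa> (?s i) = ?\<kappa> i \<and> ?e (?\<tau> i) * ?\<eta> i = - (?e i * ?\<eta> (?\<tau> (?s i))))"
      proof (cases i)
        case (Inl x)
        show ?thesis
        proof (cases rule: blk_cases[where a = x and v = "2 * n" and A = l])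
          case 1
          then have "x < l" "flip x < 2 * n" "flip x < l" using le flip_less[of "2 * n" x] by auto
          with 1 Inl show ?thesis using le by (simp add: blk_first blk_second)
        next
          case (2 y)
          then have "y < l" "flip y < 2 * n" "flip y < l" using le flip_less[of "2 * n" y] by auto
          with 2 Inl show ?thesis using le by (simp add: blk_first blk_second)
        next
          case 3
          have "x < 2 * l" using i Inl by (auto simp: X ixs_def)
          then have "\<not> y < 2 * n \<and> \<not> (l \<le> y \<and> y < l + 2 * n)" if "y = (if x < l then l + x else x - l)" for y
            using 3 that by auto
          then have "blk_swap flip l (2 * n) y = y" "blk_sgn l (2 * n) y = 0" if "y = (if x < l then l + x else x - l)" for y
            using that by (blast intro: blk_neither)+
          with 3 Inl show ?thesis by (simp add: blk_neither)
        qed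
      next
        case (Inr x)
        have "x < 2 * m" using i Inr by (auto simp: X ixs_def)
        then show ?thesis
          by (cases rule: blk_cases[where a = x and v = m and A = m]) (auto simp: Inr blk_first blk_second)
      qed
      then show "?s (?\<tau> i) = ?\<tau> (?s i)" "?\<sigma> (?s i) = 0 \<longleftrightarrow> ?\<sigma> i = 0"
        "?\<sigma> i \<noteq> 0 \<Longrightarrow> ?\<kappa> (?s i) = ?\<kappa> i" "?\<sigma> i \<noteq> 0 \<Longrightarrow> ?e (?\<tau> i) * ?\<eta> i = - (?e i * ?\<eta> (?\<tau> (?s i)))"
        by blast+
    qed
  qed
  interpret root_data ?X "- 2" ?w 1 "\<lambda>K. m0 * real 2 * ?w K" "\<lambda>K. ((real 2)\<^sup>2 * (?w K)\<^sup>2 - real 2 * ?w K) / 2"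
    by (rule osp_root_data[OF F _ _ _ _ sgn]) (auto simp: X)
  show ?thesis
  proof (rule BC_conjugated[OF refl X(2)])
    show "dual_norm ?X c = 1 / ?w c" if "c \<in> coords ?X" for c
      by (rule dual_norm_base[OF that _ _ _ sgn]) (auto simp: X)
  qed (auto simp: BC_parameters_def m0 power2_eq_square)
qed

section \<open>The general linear pairs with an orthosymplectic fixed subalgebra\<close>

lemma pair_gl_osp_conjugated:
  "radial_part_conjugated (pair_gl_osp n m) (deformed_CMS_A n m (- 1 / 2))"
proof -
  let ?X = "pair_gl_osp n m"
  let ?I = "ixs n (2 * m)"
  define \<kappa> :: "ix \<Rightarrow> ix" where "\<kappa> = map_sum id (\<lambda>b. b div 2)"
  define \<epsilon> :: "ix \<Rightarrow> ix \<Rightarrow> real" where "\<epsilon> a = (if a \<in> ?I then unit_wt (\<kappa> a) else 0)" for a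
  \<comment> \<open>Every y-coordinate is the weight of two odd basis vectors, which gives
    \<open>- 2\<close>, that is, \<open>1 / k\<close>.\<close>
  define w :: "ix \<Rightarrow> real" where "w K = (if isl K then 1 else - 2)" for K
  have X: "idx ?X = ?I" "coords ?X = ixs n m" "alg ?X = gl_on (idx ?X)" "scal ?X = 1"
    by (simp_all add: pair_gl_osp_def gl_alg_gl_on)
  have \<kappa>: "\<kappa> a \<in> ixs n m" if "a \<in> ?I" for a
    using that by (cases a) (auto simp: \<kappa>_def ixs_def)
  have half: "x div 2 = i \<longleftrightarrow> x = 2 * i \<or> x = Suc (2 * i)" for x i :: nat by presburger
  have base: "base ?X c b a = (if a \<in> ?I \<and> b = a \<and> \<kappa> a = c then 1 else 0)" if "c \<in> coords ?X" for c b a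
    using that unfolding X
    by (cases a; cases c) (auto simp: pair_gl_osp_def munit_def \<kappa>_def ixs_def half)
  have wt: "\<epsilon> a c = (if a \<in> ?I \<and> \<kappa> a = c then 1 else 0)" for a c
    by (auto simp: \<epsilon>_def unit_wt_apply)
  have one: "one_on ?I \<in> gl_on ?I" by (simp add: one_on_def gl_on_def)
  have one_parity: "one_on ?I i j = 0" if "isl i \<noteq> isl j" for i j
    using that by (auto simp: one_on_def)
  have base_gl: "base ?X c \<in> gl_on ?I" if "c \<in> coords ?X" for c
    using base[OF that] by (auto simp: gl_on_def)
  \<comment> \<open>The matrices \<open>base c\<close> are already diagonal, so identity matrices
    form the frame.\<close>
  have F: "frame ?X (one_on ?I) (one_on ?I) (one_on ?I) (one_on ?I) \<epsilon> \<epsilon>"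
  proof (unfold_locales, unfold X(1))
    fix c i j assume c: "c \<in> coords ?X"
    show "mmul ?I (one_on ?I) (base ?X c) i j = of_real (\<epsilon> i c) * one_on ?I i j"
      "mmul ?I (base ?X c) (one_on ?I) i j = one_on ?I i j * of_real (\<epsilon> j c)"
      unfolding mmul_one_left[OF finite_ixs base_gl[OF c]] mmul_one_right[OF finite_ixs base_gl[OF c]]
      by (auto simp: base[OF c] wt one_on_def)
    show "base ?X c i j = 0" if "isl i \<noteq> isl j" using that by (auto simp: base[OF c])
  next
    fix i c assume "c \<notin> coords ?X"
    then show "\<epsilon> i c = 0" using \<kappa>[of i] by (auto simp: wt X)
  qed (use base_gl one one_parity mmul_one_left[OF finite_ixs one] subspace_gl_on in \<open>auto simp: X\<close>)
  have sgn: "(\<Sum>a\<in>idx ?X. ix_sgn a * f (\<epsilon> a)) = (\<Sum>K\<in>coords ?X. w K * f (unit_wt K))" for f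
  proof -
    have "(\<Sum>a\<in>?I. ix_sgn a * f (\<epsilon> a)) = (\<Sum>a\<in>?I. ix_sgn a * f (unit_wt (\<kappa> a)))"
      by (intro sum.cong) (auto simp: \<epsilon>_def)
    also have "\<dots> = (\<Sum>i<n. f (unit_wt (Inl i))) - (\<Sum>b<2 * m. f (unit_wt (Inr (b div 2))))"
      by (simp add: sum_ixs ix_sgn_def \<kappa>_def sum_negf)
    also have "\<dots> = (\<Sum>i<n. f (unit_wt (Inl i))) - 2 * (\<Sum>b<m. f (unit_wt (Inr b)))"
      using sum_div_blocks[of 2 "\<lambda>b. f (unit_wt (Inr b))" m] by simp
    finally show ?thesis by (simp add: X sum_ixs w_def sum_distrib_left sum_negf)
  qed
  have dual: "dual_norm ?X c = 1 / w c" if c: "c \<in> coords ?X" for c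
  proof -
    have "mmul ?I (base ?X c) (base ?X c) a a = of_real (\<epsilon> a c)" if "a \<in> ?I" for a
    proof -
      have "mmul ?I (base ?X c) (base ?X c) a a = (\<Sum>l\<in>{a}. base ?X c a l * base ?X c l a)"
        unfolding mmul_def using that by (intro sum.mono_neutral_right) (auto simp: base[OF c])
      then show ?thesis using that by (simp add: base[OF c] wt)
    qed
    then have "supertrace ?I (mmul ?I (base ?X c) (base ?X c)) = of_real (\<Sum>a\<in>?I. ix_sgn a * \<epsilon> a c)"
      by (simp add: supertrace_def of_real_sum ix_sgn_def) (rule sum.cong, auto)
    also have "(\<Sum>a\<in>?I. ix_sgn a * \<epsilon> a c) = w c"
      using sgn[of "\<lambda>\<alpha>. \<alpha> c"] c
      by (simp add: X unit_wt_apply if_distrib[where f = "\<lambda>x. _ * x"] cong: if_cong)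
    finally show ?thesis by (simp add: dual_norm_def X)
  qed
  interpret root_data ?X "- 1 / 2" w 0 "\<lambda>_. 0" "\<lambda>_. 0"
    by (rule gl_root_data_A[OF F[folded X(1)] X(3) _ _ sgn]) (auto simp: X w_def)
  show ?thesis
    by (rule A_conjugated[OF refl X(2)]) (auto simp: w_def dual)
qed

theorem corollary3p4:
  shows
    "(\<forall>n m. radial_part_conjugated (pair_gl_osp n m) (deformed_CMS_A n m (-1/2)))
   \<and> (\<forall>n1 n2 m1 m2. even_type (pair_gl_gl n1 n2 m1 m2) \<longrightarrow>
        (let n = min n1 n2; m = min m1 m2; k = -1;
             p = \<bar>real m1 - real m2\<bar> - \<bar>real n1 - real n2\<bar>; r = - p; q = -1/2; s = -1/2
         in BC_parameters k p q r s \<and>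
            radial_part_conjugated (pair_gl_gl n1 n2 m1 m2) (deformed_CMS_BC n m k p q r s)))
   \<and> (\<forall>n1 n2 m1 m2. even_type (pair_osp_osp n1 n2 m1 m2) \<longrightarrow>
        (let n = min n1 n2; m = min m1 m2; k = -1/2;
             p = \<bar>real m1 - real m2\<bar> - 1/2 * \<bar>real n1 - real n2\<bar>; r = - 2 * p; q = 0; s = -3/2
         in BC_parameters k p q r s \<and>
            radial_part_conjugated (pair_osp_osp n1 n2 m1 m2) (deformed_CMS_BC n m k p q r s)))
   \<and> (\<forall>l m n. l = 2 * n \<longrightarrow>
        (let k = -2; p = 0; r = 0; q = -1/2; s = -1/2
         in BC_parameters k p q r s \<and>
            radial_part_conjugated (pair_osp_gl l m) (deformed_CMS_BC n m k p q r s)))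
   \<and> (\<forall>l m n. l = 2 * n + 1 \<longrightarrow>
        (let k = -2; p = -2; r = 1; q = -1/2; s = -1/2
         in BC_parameters k p q r s \<and>
            radial_part_conjugated (pair_osp_gl l m) (deformed_CMS_BC n m k p q r s)))"
proof -
  \<comment> \<open>The two parities of \<open>l\<close> are instances of
    \<open>p = - 2 * real (l mod 2)\<close> and \<open>r = - p / 2\<close>.\<close>
  have "radial_part_conjugated (pair_osp_gl (2 * n) m) (deformed_CMS_BC n m (-2) 0 (-1/2) 0 (-1/2))"
    "radial_part_conjugated (pair_osp_gl (2 * n + 1) m) (deformed_CMS_BC n m (-2) (-2) (-1/2) 1 (-1/2))" for n m
    using pair_osp_gl_conjugated[of "2 * n" m] pair_osp_gl_conjugated[of "2 * n + 1" m] by simp_all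
  then show ?thesis
    using pair_gl_osp_conjugated pair_gl_gl_conjugated pair_osp_osp_conjugated
    by (simp add: Let_def BC_parameters_def)
qed

end
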